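(* Let $a\in C[0,1]$ satisfy: the open sets $\Omega_-:=a^{-1}((-\infty,0))$ and $\Omega_+:=a^{-1}((0,\infty))$ consist of finitely many nontrivial open intervals, $a$ vanishes at their endpoints, and these intervals are adjacent and interlacing (each interior interval is surrounded by two intervals of the opposite sign). For $\lambda\in\mathbb R$ and $u_0\in C[0,1]$, $u_0\ge0$, let $u(x,t;u_0,\lambda)$ be the unique solution of $$\partial_t u-\partial_{xx}u=\lambda u+a(x)u^2\ (t>0,\ x\in(0,1)),\quad u(0,t)=u(1,t)=0,\quad u(x,0)=u_0(x),$$ with maximal existence time $T_{\max}(u_0,\lambda)\in(0,\infty]$, and set $T_{\max}(u_0):=\lim_{\lambda\downarrow-\infty}T_{\max}(u_0,\lambda)\in(0,\infty]$ (this limit exists since $T_{\max}(u_0,\lambda)$ is non-increasing in $\lambda$). Suppose that $u_0\gneq0$ is a (weak) subsolution of $-u''=\lambda u+a(x)u^2$ in $(0,1)$, $u(0)=u(1)=0$. Then, for every $x\in\Omega_-$ and $t\in(0,T_{\max}(u_0))$, $$\lim_{\lambda\downarrow-\infty}u(x,t;u_0,\lambda)=0,$$ and the limit is uniform on compact subsets of $\Omega_-$.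
   Context: A subsolution of $-u''=\lambda u+au^2$, $u(0)=u(1)=0$ is a function $\underline u\in C[0,1]$ with $\underline u(0),\underline u(1)\le 0$ and $-\underline u''\le\lambda\underline u+a\underline u^2$ in the weak sense in $(0,1)$. *)

theory Defs
  imports "HOL-Analysis.Analysis"
begin

text \<open>Structural hypothesis on the weight a: [0,1] is cut by points
  0 \<le> p 0 < p 1 < ... < p n \<le> 1 into the open intervals (p i, p (i+1)), on which
  a has constant strict sign, alternating from one interval to the next
  (adjacent and interlacing); a vanishes at every p i and outside (p 0, p n).
  Hence a^{-1}(-oo,0) and a^{-1}(0,oo) are exactly the unions of these intervals.\<close>
definition interlacing_weight :: "(real \<Rightarrow> real) \<Rightarrow> bool" where
  "interlacing_weight a \<longleftrightarrow>
     (\<exists>(n::nat) (p::nat \<Rightarrow> real) (\<sigma>::real).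
        (\<sigma> = 1 \<or> \<sigma> = -1) \<and>
        (\<forall>i<n. p i < p (Suc i)) \<and> 0 \<le> p 0 \<and> p n \<le> 1 \<and>
        (\<forall>i<n. \<forall>x \<in> {p i<..<p (Suc i)}. sgn (a x) = \<sigma> * (-1) ^ i) \<and>
        (\<forall>x \<in> {0..1}. (\<forall>i<n. x \<notin> {p i<..<p (Suc i)}) \<longrightarrow> a x = 0))"

definition test_fun :: "(real \<Rightarrow> real) \<Rightarrow> bool" where
  "test_fun \<phi> \<longleftrightarrow>
     (\<forall>k x. ((deriv ^^ k) \<phi>) differentiable (at x)) \<and>
     (\<exists>\<epsilon>>0. \<forall>x. x \<notin> {\<epsilon>..1 - \<epsilon>} \<longrightarrow> \<phi> x = 0)"

definition weak_subsolution :: "(real \<Rightarrow> real) \<Rightarrow> real \<Rightarrow> (real \<Rightarrow> real) \<Rightarrow> bool" where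
  "weak_subsolution a l v \<longleftrightarrow>
     continuous_on {0..1} v \<and> v 0 \<le> 0 \<and> v 1 \<le> 0 \<and>
     (\<forall>\<phi>. test_fun \<phi> \<and> (\<forall>x. \<phi> x \<ge> 0) \<longrightarrow>
        integral {0..1} (\<lambda>x. v x * (- deriv (deriv \<phi>) x))
          \<le> integral {0..1} (\<lambda>x. (l * v x + a x * (v x)\<^sup>2) * \<phi> x))"

definition is_solution ::
  "(real \<Rightarrow> real) \<Rightarrow> real \<Rightarrow> (real \<Rightarrow> real) \<Rightarrow> real \<Rightarrow> (real \<Rightarrow> real \<Rightarrow> real) \<Rightarrow> bool" where
  "is_solution a l u0 T u \<longleftrightarrow>
     0 < T \<and>
     continuous_on ({0..1} \<times> {0..<T}) (\<lambda>(x, t). u x t) \<and>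
     (\<forall>x \<in> {0..1}. u x 0 = u0 x) \<and>
     (\<forall>t \<in> {0..<T}. u 0 t = 0 \<and> u 1 t = 0) \<and>
     (\<exists>ut ux uxx :: real \<Rightarrow> real \<Rightarrow> real.
        continuous_on ({0<..<1} \<times> {0<..<T}) (\<lambda>(x, t). ut x t) \<and>
        continuous_on ({0<..<1} \<times> {0<..<T}) (\<lambda>(x, t). uxx x t) \<and>
        (\<forall>x \<in> {0<..<1}. \<forall>t \<in> {0<..<T}.
           ((\<lambda>s. u x s) has_real_derivative ut x t) (at t) \<and>
           ((\<lambda>y. u y t) has_real_derivative ux x t) (at x) \<and>
           ((\<lambda>y. ux y t) has_real_derivative uxx x t) (at x) \<and>
           ut x t - uxx x t = l * u x t + a x * (u x t)\<^sup>2))"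

definition Tmax :: "(real \<Rightarrow> real) \<Rightarrow> (real \<Rightarrow> real) \<Rightarrow> real \<Rightarrow> ereal" where
  "Tmax a u0 l = Sup {ereal T | T. \<exists>u. is_solution a l u0 T u}"

definition Tmax_lim :: "(real \<Rightarrow> real) \<Rightarrow> (real \<Rightarrow> real) \<Rightarrow> ereal" where
  "Tmax_lim a u0 = Lim at_bot (\<lambda>l. Tmax a u0 l)"

end

theory Submission
  imports Defs "HOL-Probability.Probability" "HOL-Real_Asymp.Real_Asymp"
begin

text \<open>Decay on the set where \<open>a < 0\<close> is a barrier argument. For \<open>l \<le> l1\<close> comparison gives
  \<open>0 \<le> U l \<le> U l1\<close>, hence a bound \<open>M\<close> independent of \<open>l\<close>. On an interval of radius
  \<open>\<delta>\<close> around \<open>x\<close> on which \<open>a \<le> 0\<close>, the solution is a subsolution of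
  \<open>w\<^sub>t = w\<^sub>x\<^sub>x + l * w\<close>, so it lies below a sum of three exponentials and
  \<open>U l x t \<le> M * (2 * exp (- sqrt (- l) * \<delta>) + exp (l * t))\<close>.

  What remains is that \<open>Tmax_lim\<close> is a genuine limit, i.e. that the existence time is monotone in the
  parameter: a solution for \<open>l\<close> must yield one for every \<open>l' < l\<close> on each shorter time interval.
  The equation for \<open>l'\<close> is truncated to a globally Lipschitz one and extended to the line by odd
  reflection, where the Gaussian mild formulation has a fixed point. A bounded source makes the
  mild solution Hoelder continuous in time with exponent 1/2, and this makes the second
  space derivative of the Duhamel term converge, so the mild solution is classical even though \<open>a\<close>
  is merely continuous. Comparison with the given solution shows that the truncation is inactive.\<close>

section \<open>Gaussian averages and the heat kernel\<close>

text \<open>\<open>Tmax_lim\<close> is written with \<open>Lim\<close>, a description operator that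
  carries no information until convergence is proved; this is what forces an existence theory into a
  statement about decay. Existence is needed only next to a given solution and on slightly shorter
  time intervals, so neither blow-up criteria nor continuation arguments occur. The heat semigroup
  is used in two shapes. Averaging \<open>h (x + sqrt (2 * r) * z)\<close> against the normal
  density gives bounds by moments and continuity down to \<open>r = 0\<close>, with the initial
  value built in. Convolving with the kernel moves \<open>x\<close> and \<open>r\<close> off
  \<open>h\<close>, so that the average of a merely continuous \<open>h\<close> can be
  differentiated for \<open>r > 0\<close>. Working on the line avoids the Dirichlet kernel: the
  boundary conditions become a symmetry of the fixed point. This dictates the truncation, which has
  to be odd in the unknown.\<close>

lemma continuous_on_lebesgue_integral:
  fixes g :: "'p::metric_space \<Rightarrow> 'b \<Rightarrow> real"
  assumes cont: "\<And>z. z \<in> space M \<Longrightarrow> continuous_on A (\<lambda>p. g p z)"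
    and meas: "\<And>p. p \<in> A \<Longrightarrow> g p \<in> borel_measurable M"
    and bound: "\<And>p z. p \<in> A \<Longrightarrow> z \<in> space M \<Longrightarrow> \<bar>g p z\<bar> \<le> w z"
    and w: "integrable M w"
  shows "continuous_on A (\<lambda>p. \<integral>z. g p z \<partial>M)"
proof (rule continuous_on_sequentiallyI)
  fix u a assume u: "\<forall>n. u n \<in> A" and a: "a \<in> A" and lim: "u \<longlonglongrightarrow> a"
  show "(\<lambda>n. \<integral>z. g (u n) z \<partial>M) \<longlonglongrightarrow> (\<integral>z. g a z \<partial>M)"
  proof (rule integral_dominated_convergence[where w=w])
    show "AE z in M. (\<lambda>n. g (u n) z) \<longlonglongrightarrow> g a z"
      using continuous_on_tendsto_compose[OF cont lim a] u by (intro AE_I2) auto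
    show "\<And>n. AE z in M. norm (g (u n) z) \<le> w z"
      using bound u by (intro AE_I2) auto
  qed (use meas u a w in auto)
qed

text \<open>The mean value inequality on the ball turns the bound \<open>w\<close> on the derivative
  into the same bound on every difference quotient, so \<open>w\<close> itself is the majorant for
  dominated convergence.\<close>

lemma has_real_derivative_lebesgue_integral:
  fixes g g' :: "real \<Rightarrow> 'b \<Rightarrow> real"
  assumes e: "0 < e"
    and int: "\<And>r. r \<in> ball r0 e \<Longrightarrow> integrable M (g r)"
    and der: "\<And>r z. r \<in> ball r0 e \<Longrightarrow> z \<in> space M \<Longrightarrow>
                ((\<lambda>r. g r z) has_real_derivative g' r z) (at r)"
    and bound: "\<And>r z. r \<in> ball r0 e \<Longrightarrow> z \<in> space M \<Longrightarrow> \<bar>g' r z\<bar> \<le> w z"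
    and meas: "g' r0 \<in> borel_measurable M"
    and w: "integrable M w"
  shows "((\<lambda>r. \<integral>z. g r z \<partial>M) has_real_derivative (\<integral>z. g' r0 z \<partial>M)) (at r0)"
proof -
  have r0: "r0 \<in> ball r0 e" using e by simp
  have "((\<lambda>r. ((\<integral>z. g r z \<partial>M) - (\<integral>z. g r0 z \<partial>M)) / (r - r0)) \<longlongrightarrow> (\<integral>z. g' r0 z \<partial>M))
          (at r0 within ball r0 e)"
    unfolding tendsto_at_iff_sequentially
  proof (intro allI impI)
    fix X :: "nat \<Rightarrow> real"
    assume X: "\<forall>i. X i \<in> ball r0 e - {r0}" and lim: "X \<longlonglongrightarrow> r0"
    have "(\<lambda>n. \<integral>z. (g (X n) z - g r0 z) / (X n - r0) \<partial>M) \<longlonglongrightarrow> (\<integral>z. g' r0 z \<partial>M)"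
    proof (rule integral_dominated_convergence[where w=w])
      show "g' r0 \<in> borel_measurable M" by fact
      show "\<And>n. (\<lambda>z. (g (X n) z - g r0 z) / (X n - r0)) \<in> borel_measurable M"
      proof -
        fix n
        have [measurable]: "g (X n) \<in> borel_measurable M" "g r0 \<in> borel_measurable M"
          using int X r0 by (auto intro: borel_measurable_integrable)
        show "(\<lambda>z. (g (X n) z - g r0 z) / (X n - r0)) \<in> borel_measurable M" by measurable
      qed
      show "AE z in M. (\<lambda>n. (g (X n) z - g r0 z) / (X n - r0)) \<longlonglongrightarrow> g' r0 z"
      proof (intro AE_I2)
        fix z assume "z \<in> space M"
        from der[OF r0 this] have "((\<lambda>r. (g r z - g r0 z) / (r - r0)) \<longlongrightarrow> g' r0 z) (at r0)"
          by (simp add: has_field_derivative_iff)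
        then show "(\<lambda>n. (g (X n) z - g r0 z) / (X n - r0)) \<longlonglongrightarrow> g' r0 z"
          unfolding tendsto_at_iff_sequentially using X lim by (auto simp: o_def)
      qed
      show "AE z in M. norm ((g (X n) z - g r0 z) / (X n - r0)) \<le> w z" for n
      proof (intro AE_I2)
        fix z assume z: "z \<in> space M"
        have "norm (g (X n) z - g r0 z) \<le> w z * norm (X n - r0)"
        proof (rule field_differentiable_bound[of "ball r0 e" "\<lambda>r. g r z" "\<lambda>r. g' r z"])
          show "((\<lambda>r. g r z) has_field_derivative g' r z) (at r within ball r0 e)"
            if "r \<in> ball r0 e" for r
            using der[OF that z] by (rule has_field_derivative_at_within)
        qed (use X r0 bound z in auto)
        moreover have "0 < norm (X n - r0)" using X by auto
        ultimately show "norm ((g (X n) z - g r0 z) / (X n - r0)) \<le> w z"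
          by (simp add: norm_divide pos_divide_le_eq)
      qed
    qed (rule w)
    moreover have "(\<integral>z. (g (X n) z - g r0 z) / (X n - r0) \<partial>M)
        = ((\<integral>z. g (X n) z \<partial>M) - (\<integral>z. g r0 z \<partial>M)) / (X n - r0)" for n
    proof -
      have "integrable M (g (X n))" "integrable M (g r0)" using int X r0 by auto
      then have "(\<integral>z. g (X n) z - g r0 z \<partial>M) = (\<integral>z. g (X n) z \<partial>M) - (\<integral>z. g r0 z \<partial>M)" by simp
      then show ?thesis unfolding integral_divide_zero by (rule arg_cong)
    qed
    ultimately show "((\<lambda>r. ((\<integral>z. g r z \<partial>M) - (\<integral>z. g r0 z \<partial>M)) / (r - r0)) \<circ> X) \<longlonglongrightarrow> (\<integral>z. g' r0 z \<partial>M)"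
      unfolding o_def by (rule back_subst[where P="\<lambda>f. f \<longlonglongrightarrow> _", OF _ ext])
  qed
  then show ?thesis
    using at_within_open[OF r0] by (simp add: has_field_derivative_iff)
qed

text \<open>For \<open>\<omega> = 1\<close> this is the heat semigroup at time \<open>r\<close>; the
  variance is \<open>2 * r\<close> because the second space derivative carries no factor 1/2. The
  Hermite weights \<open>z\<close> and \<open>z\<^sup>2 - 1\<close> yield its derivatives up to
  powers of \<open>r\<close>.\<close>

definition gauss_avg :: "(real \<Rightarrow> real) \<Rightarrow> (real \<Rightarrow> real) \<Rightarrow> real \<Rightarrow> real \<Rightarrow> real" where
  "gauss_avg \<omega> h x r = (\<integral>z. std_normal_density z * \<omega> z * h (x + sqrt (2 * r) * z) \<partial>lborel)"

definition gauss_weight :: "(real \<Rightarrow> real) \<Rightarrow> bool" where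
  "gauss_weight \<omega> \<longleftrightarrow> continuous_on UNIV \<omega> \<and> integrable lborel (\<lambda>z. std_normal_density z * \<bar>\<omega> z\<bar>)"

definition gauss_norm :: "(real \<Rightarrow> real) \<Rightarrow> real" where
  "gauss_norm \<omega> = (\<integral>z. std_normal_density z * \<bar>\<omega> z\<bar> \<partial>lborel)"

lemma gauss_weight_1 [simp]: "gauss_weight (\<lambda>z. 1)"
  by (simp add: gauss_weight_def)

lemma gauss_weight_id [simp]: "gauss_weight (\<lambda>z. z)"
  using integrable_std_normal_moment_abs[of 1] by (simp add: gauss_weight_def)

lemma gauss_weight_hermite2 [simp]: "gauss_weight (\<lambda>z. z\<^sup>2 - 1)"
proof -
  have "integrable lborel (\<lambda>z. std_normal_density z * \<bar>z\<^sup>2 - 1\<bar>)"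
  proof (rule Bochner_Integration.integrable_bound)
    show "integrable lborel (\<lambda>z::real. std_normal_density z * z^2 + std_normal_density z)"
      using integrable_std_normal_moment[of 2] by simp
    show "AE z in lborel. norm (std_normal_density z * \<bar>z\<^sup>2 - 1\<bar>)
            \<le> norm (std_normal_density z * z^2 + std_normal_density z)"
    proof (intro AE_I2)
      fix z :: real
      have "std_normal_density z * \<bar>z\<^sup>2 - 1\<bar> \<le> std_normal_density z * (z\<^sup>2 + 1)"
        by (intro mult_left_mono) (auto simp: abs_le_iff)
      then show "norm (std_normal_density z * \<bar>z\<^sup>2 - 1\<bar>)
            \<le> norm (std_normal_density z * z^2 + std_normal_density z)"
        by (simp add: abs_mult algebra_simps)
    qed
  qed measurable
  then show ?thesis
    by (auto simp: gauss_weight_def intro!: continuous_intros)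
qed

lemma gauss_norm_1 [simp]: "gauss_norm (\<lambda>z. 1) = 1"
  by (simp add: gauss_norm_def)

lemma gauss_norm_nonneg [simp]: "0 \<le> gauss_norm \<omega>"
  unfolding gauss_norm_def by (intro integral_nonneg_AE AE_I2) auto

lemma gauss_avg_integrable:
  assumes \<omega>: "gauss_weight \<omega>" and h: "continuous_on UNIV h" and B: "\<And>y. \<bar>h y\<bar> \<le> B"
  shows "integrable lborel (\<lambda>z. std_normal_density z * \<omega> z * h (x + sqrt (2 * r) * z))"
proof (rule Bochner_Integration.integrable_bound)
  show "integrable lborel (\<lambda>z. B * (std_normal_density z * \<bar>\<omega> z\<bar>))"
    using \<omega> by (simp add: gauss_weight_def)
  have [measurable]: "\<omega> \<in> borel_measurable borel"
    using \<omega> by (auto simp: gauss_weight_def intro: borel_measurable_continuous_onI)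
  have [measurable]: "h \<in> borel_measurable borel"
    using h by (rule borel_measurable_continuous_onI)
  show "(\<lambda>z. std_normal_density z * \<omega> z * h (x + sqrt (2 * r) * z)) \<in> borel_measurable lborel"
    by measurable
  show "AE z in lborel. norm (std_normal_density z * \<omega> z * h (x + sqrt (2 * r) * z))
          \<le> norm (B * (std_normal_density z * \<bar>\<omega> z\<bar>))"
  proof (intro AE_I2)
    fix z :: real
    have "std_normal_density z * \<bar>\<omega> z\<bar> * \<bar>h (x + sqrt (2 * r) * z)\<bar> \<le> std_normal_density z * \<bar>\<omega> z\<bar> * B"
      by (intro mult_left_mono B) simp
    moreover have "0 \<le> B" using B[of 0] by linarith
    ultimately show "norm (std_normal_density z * \<omega> z * h (x + sqrt (2 * r) * z))
          \<le> norm (B * (std_normal_density z * \<bar>\<omega> z\<bar>))"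
      by (simp add: abs_mult mult.commute mult.assoc)
  qed
qed

lemma gauss_avg_bound:
  assumes \<omega>: "gauss_weight \<omega>" and h: "continuous_on UNIV h" and B: "\<And>y. \<bar>h y\<bar> \<le> B"
  shows "\<bar>gauss_avg \<omega> h x r\<bar> \<le> B * gauss_norm \<omega>"
proof -
  have "\<bar>gauss_avg \<omega> h x r\<bar> \<le> (\<integral>z. \<bar>std_normal_density z * \<omega> z * h (x + sqrt (2 * r) * z)\<bar> \<partial>lborel)"
    unfolding gauss_avg_def by (rule integral_abs_bound)
  also have "\<dots> \<le> (\<integral>z. B * (std_normal_density z * \<bar>\<omega> z\<bar>) \<partial>lborel)"
  proof (rule integral_mono)
    show "integrable lborel (\<lambda>z. \<bar>std_normal_density z * \<omega> z * h (x + sqrt (2 * r) * z)\<bar>)"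
      using gauss_avg_integrable[OF assms] by (rule integrable_abs)
    show "integrable lborel (\<lambda>z. B * (std_normal_density z * \<bar>\<omega> z\<bar>))"
      using \<omega> by (simp add: gauss_weight_def)
    fix z :: real
    have "std_normal_density z * \<bar>\<omega> z\<bar> * \<bar>h (x + sqrt (2 * r) * z)\<bar> \<le> std_normal_density z * \<bar>\<omega> z\<bar> * B"
      by (intro mult_left_mono B) simp
    then show "\<bar>std_normal_density z * \<omega> z * h (x + sqrt (2 * r) * z)\<bar> \<le> B * (std_normal_density z * \<bar>\<omega> z\<bar>)"
      by (simp add: abs_mult mult.commute mult.assoc)
  qed
  also have "\<dots> = B * gauss_norm \<omega>"
    by (simp add: gauss_norm_def)
  finally show ?thesis .
qed

lemma gauss_avg_diff:
  assumes "gauss_weight \<omega>" "continuous_on UNIV h" "\<And>y. \<bar>h y\<bar> \<le> B"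
    "continuous_on UNIV h'" "\<And>y. \<bar>h' y\<bar> \<le> B'"
  shows "gauss_avg \<omega> h x r - gauss_avg \<omega> h' x r = gauss_avg \<omega> (\<lambda>y. h y - h' y) x r"
  using gauss_avg_integrable[OF assms(1-3), of x r] gauss_avg_integrable[OF assms(1,4,5), of x r]
  by (simp add: gauss_avg_def right_diff_distrib)

text \<open>The parameters occur only in the arguments of the bounded \<open>f\<close>, so one
  multiple of the weighted density dominates all integrands. No sign condition on \<open>r\<close>
  is needed, as \<open>sqrt\<close> is continuous on the whole real line; in particular
  \<open>r = 0\<close> is an ordinary point.\<close>

lemma gauss_avg_continuous:
  fixes f :: "real \<Rightarrow> real \<Rightarrow> real"
  assumes \<omega>: "gauss_weight \<omega>" and f: "continuous_on UNIV (\<lambda>(y, s). f y s)"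
    and B: "\<And>y s. \<bar>f y s\<bar> \<le> B"
  shows "continuous_on UNIV (\<lambda>(x, r, s). gauss_avg \<omega> (\<lambda>y. f y s) x r)"
proof -
  have [measurable]: "\<omega> \<in> borel_measurable borel"
    using \<omega> by (auto simp: gauss_weight_def intro: borel_measurable_continuous_onI)
  have fs: "continuous_on UNIV (\<lambda>y. f y s)" for s
    by (rule continuous_on_compose2[OF f, of UNIV "\<lambda>y. (y, s)", simplified]) (intro continuous_intros)
  have [measurable]: "(\<lambda>y. f y s) \<in> borel_measurable borel" for s
    by (rule borel_measurable_continuous_onI[OF fs])
  have "continuous_on UNIV (\<lambda>p. \<integral>z. std_normal_density z * \<omega> z *
          f (fst p + sqrt (2 * fst (snd p)) * z) (snd (snd p)) \<partial>lborel)"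
  proof (rule continuous_on_lebesgue_integral)
    fix z :: real
    show "continuous_on UNIV (\<lambda>p. std_normal_density z * \<omega> z *
          f (fst p + sqrt (2 * fst (snd p)) * z) (snd (snd p)))"
      by (intro continuous_on_mult continuous_on_const
          continuous_on_compose2[OF f, of UNIV "\<lambda>p. (fst p + sqrt (2 * fst (snd p)) * z, snd (snd p))", simplified]
          continuous_intros)
  next
    fix p :: "real \<times> real \<times> real"
    show "(\<lambda>z. std_normal_density z * \<omega> z *
          f (fst p + sqrt (2 * fst (snd p)) * z) (snd (snd p))) \<in> borel_measurable lborel"
      by measurable
  next
    fix p :: "real \<times> real \<times> real" and z :: real
    have "std_normal_density z * \<bar>\<omega> z\<bar> * \<bar>f (fst p + sqrt (2 * fst (snd p)) * z) (snd (snd p))\<bar>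
      \<le> std_normal_density z * \<bar>\<omega> z\<bar> * B"
      by (intro mult_left_mono B) simp
    then show "\<bar>std_normal_density z * \<omega> z * f (fst p + sqrt (2 * fst (snd p)) * z) (snd (snd p))\<bar>
      \<le> B * (std_normal_density z * \<bar>\<omega> z\<bar>)"
      by (simp add: abs_mult mult.commute mult.assoc)
  next
    show "integrable lborel (\<lambda>z. B * (std_normal_density z * \<bar>\<omega> z\<bar>))"
      using \<omega> by (simp add: gauss_weight_def)
  qed
  then show ?thesis
    by (simp add: gauss_avg_def case_prod_unfold)
qed

section \<open>Heat kernel: common majorant and derivatives\<close>

definition heat_kernel :: "real \<Rightarrow> real \<Rightarrow> real" where
  "heat_kernel w r = exp (- w\<^sup>2 / (4 * r)) / sqrt (4 * pi * r)"

text \<open>Substituting \<open>y = x + sqrt (2 * r) * z\<close> leaves \<open>x\<close> and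
  \<open>r\<close> in smooth factors only. The price is \<open>0 < r\<close>.\<close>

lemma gauss_avg_kernel:
  assumes "0 < r"
  shows "gauss_avg \<omega> h x r = (\<integral>y. heat_kernel (y - x) r * \<omega> ((y - x) / sqrt (2 * r)) * h y \<partial>lborel)"
proof -
  let ?c = "sqrt (2 * r)"
  have c: "0 < ?c" using assms by simp
  have eq: "?c * heat_kernel (?c * z) r = std_normal_density z" for z
  proof -
    have "(?c * z)\<^sup>2 / (4 * r) = z\<^sup>2 / 2"
      using assms by (simp add: power_mult_distrib field_simps)
    moreover have "sqrt (4 * pi * r) = ?c * sqrt (2 * pi)"
      by (simp add: real_sqrt_mult[symmetric] mult_ac)
    ultimately show ?thesis
      using c by (simp add: heat_kernel_def std_normal_density_def)
  qed
  have "(\<integral>y. heat_kernel (y - x) r * \<omega> ((y - x) / ?c) * h y \<partial>lborel)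
    = ?c * (\<integral>z. heat_kernel (?c * z) r * \<omega> z * h (x + ?c * z) \<partial>lborel)"
    using c by (subst lborel_integral_real_affine[where c="?c" and t=x]) auto
  also have "\<dots> = (\<integral>z. (?c * heat_kernel (?c * z) r) * \<omega> z * h (x + ?c * z) \<partial>lborel)"
    by (subst integral_mult_right_zero[symmetric]) (simp add: mult_ac)
  finally show ?thesis
    by (simp add: gauss_avg_def eq)
qed

lemma heat_kernel_pos: "0 < r \<Longrightarrow> 0 < heat_kernel w r"
  by (simp add: heat_kernel_def)

lemma heat_kernel_measurable [measurable]: "(\<lambda>y. heat_kernel (y - x) r) \<in> borel_measurable borel"
  unfolding heat_kernel_def by measurable

text \<open>The quadratic factor is absorbed by half of the Gaussian exponent. Recentring from
  \<open>x\<close> to \<open>x0\<close> by \<open>(y - x0)\<^sup>2 \<le> 2 * (y - x)\<^sup>2 + 2 *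
  (x - x0)\<^sup>2\<close> costs another factor 2. Hence 16 in place of 4, and a bound that no
  longer depends on \<open>x\<close> and \<open>r\<close>.\<close>

lemma heat_kernel_bound:
  assumes "0 < r1" "r1 \<le> r" "r \<le> r2" "\<bar>x - x0\<bar> \<le> 1"
  shows "heat_kernel (y - x) r * (1 + (y - x)\<^sup>2)
    \<le> (1 + 8 * r2) / sqrt (4 * pi * r1) * exp (1 / (8 * r1)) * exp (- (y - x0)\<^sup>2 / (16 * r2))"
proof -
  define w where "w = y - x"
  have r: "0 < r" "0 < r2" using assms by auto
  define v where "v = w\<^sup>2 / (4 * r)"
  have v0: "0 \<le> v" using r by (simp add: v_def)
  have w2: "w\<^sup>2 = 4 * r * v" using r by (simp add: v_def)
  have 1: "1 + w\<^sup>2 \<le> (1 + 8 * r2) * exp (v / 2)"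
  proof -
    have "v / 2 \<le> exp (v / 2)" "1 \<le> exp (v / 2)"
      using exp_ge_add_one_self[of "v / 2"] v0 by linarith+
    moreover from this have "4 * r * v \<le> 8 * r2 * exp (v / 2)"
      using mult_mono[of "8 * r" "8 * r2" "v / 2" "exp (v / 2)"] assms v0 r by simp
    ultimately have "1 + 4 * r * v \<le> exp (v / 2) + 8 * r2 * exp (v / 2)" by linarith
    then show ?thesis unfolding w2 by (simp add: algebra_simps)
  qed
  have "heat_kernel w r * (1 + w\<^sup>2) \<le> exp (- v) / sqrt (4 * pi * r1) * ((1 + 8 * r2) * exp (v / 2))"
  proof (rule mult_mono[OF _ 1])
    show "heat_kernel w r \<le> exp (- v) / sqrt (4 * pi * r1)"
      using assms by (simp add: heat_kernel_def v_def divide_left_mono)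
  qed (use assms in auto)
  also have "\<dots> = (1 + 8 * r2) / sqrt (4 * pi * r1) * exp (- v / 2)"
    by (simp add: exp_add[symmetric])
  also have "\<dots> \<le> (1 + 8 * r2) / sqrt (4 * pi * r1) * (exp (1 / (8 * r1)) * exp (- (y - x0)\<^sup>2 / (16 * r2)))"
  proof (rule mult_left_mono)
    have "(y - x0)\<^sup>2 \<le> 2 * w\<^sup>2 + 2 * (x - x0)\<^sup>2"
      using zero_le_power2[of "w - (x - x0)"] by (simp add: w_def power2_eq_square algebra_simps)
    moreover have "(x - x0)\<^sup>2 \<le> 1" using assms(4) by (simp add: abs_square_le_1)
    ultimately have "(y - x0)\<^sup>2 / 2 - 1 \<le> w\<^sup>2" by simp
    then have "((y - x0)\<^sup>2 / 2 - 1) / (8 * r) \<le> w\<^sup>2 / (8 * r)"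
      using r by (intro divide_right_mono) auto
    moreover have "(y - x0)\<^sup>2 / (16 * r2) \<le> (y - x0)\<^sup>2 / (16 * r)"
      using assms r by (intro divide_left_mono) auto
    moreover have "1 / (8 * r) \<le> 1 / (8 * r1)"
      using assms r by (intro divide_left_mono) auto
    ultimately have "- v / 2 \<le> 1 / (8 * r1) - (y - x0)\<^sup>2 / (16 * r2)"
      by (simp add: v_def diff_divide_distrib)
    then show "exp (- v / 2) \<le> exp (1 / (8 * r1)) * exp (- (y - x0)\<^sup>2 / (16 * r2))"
      by (simp add: exp_add[symmetric])
  qed (use assms r in auto)
  finally show ?thesis by (simp add: w_def mult.assoc)
qed

lemma integrable_gaussian_bump:
  assumes "0 < r" shows "integrable lborel (\<lambda>y::real. C * exp (- (y - x0)\<^sup>2 / (16 * r)))"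
proof -
  define s where "s = sqrt (8 * r)"
  have s: "2 * s\<^sup>2 = 16 * r" "0 < s" using assms by (auto simp: s_def)
  have "(\<lambda>y. C * exp (- (y - x0)\<^sup>2 / (16 * r)))
      = (\<lambda>y. C * sqrt (2 * pi * s\<^sup>2) * normal_density x0 s y)"
    using s by (auto simp: normal_density_def fun_eq_iff)
  then show ?thesis using s integrable_normal_density[of s x0] by simp
qed

lemma heat_kernel_deriv_space:
  assumes "0 < r"
  shows "((\<lambda>x. heat_kernel (y - x) r) has_real_derivative (y - x) / (2 * r) * heat_kernel (y - x) r) (at x)"
proof -
  define c where "c = sqrt (4 * pi * r)"
  have "0 < c" using assms by (simp add: c_def)
  then show ?thesis
    unfolding heat_kernel_def c_def[symmetric] using assms
    by (auto intro!: derivative_eq_intros simp: field_simps power2_eq_square)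
qed

lemma heat_kernel_deriv_time:
  assumes "0 < r"
  shows "((\<lambda>r. heat_kernel w r) has_real_derivative
           (w\<^sup>2 / (4 * r\<^sup>2) - 1 / (2 * r)) * heat_kernel w r) (at r)"
proof -
  define c where "c = sqrt (4 * pi * r)"
  have c: "0 < c" "c * c = 4 * pi * r" using assms mult_pos_pos[OF pi_gt_zero assms] by (auto simp: c_def)
  have "((\<lambda>r. sqrt (4 * pi * r)) has_real_derivative 2 * pi / c) (at r)"
    using assms by (auto intro!: derivative_eq_intros simp: c_def field_simps mult_less_0_iff)
  moreover have "((\<lambda>r. exp (- w\<^sup>2 / (4 * r))) has_real_derivative
      exp (- w\<^sup>2 / (4 * r)) * (w\<^sup>2 / (4 * r\<^sup>2))) (at r)"
    using assms by (auto intro!: derivative_eq_intros simp: field_simps power2_eq_square)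
  ultimately have "((\<lambda>r. heat_kernel w r) has_real_derivative
     (exp (- w\<^sup>2 / (4 * r)) * (w\<^sup>2 / (4 * r\<^sup>2)) * c - exp (- w\<^sup>2 / (4 * r)) * (2 * pi / c)) / (c * c)) (at r)"
    unfolding heat_kernel_def c_def using assms by (intro DERIV_divide) auto
  moreover have "(exp (- w\<^sup>2 / (4 * r)) * (w\<^sup>2 / (4 * r\<^sup>2)) * c - exp (- w\<^sup>2 / (4 * r)) * (2 * pi / c)) / (c * c)
     = (w\<^sup>2 / (4 * r\<^sup>2) - 2 * pi / (c * c)) * (exp (- w\<^sup>2 / (4 * r)) / c)"
    using c(1) by (simp add: field_simps)
  moreover have "2 * pi / (c * c) = 1 / (2 * r)"
    unfolding c(2) using assms by simp
  ultimately show ?thesis by (simp add: heat_kernel_def c_def)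
qed

lemma bounded_density_integrable:
  fixes k h :: "real \<Rightarrow> real"
  assumes "integrable lborel g" "k \<in> borel_measurable borel" "continuous_on UNIV h"
    "\<And>y. \<bar>h y\<bar> \<le> B" "\<And>y. \<bar>k y\<bar> \<le> g y"
  shows "integrable lborel (\<lambda>y. k y * h y)"
proof (rule Bochner_Integration.integrable_bound)
  show "integrable lborel (\<lambda>y. g y * B)" using assms(1) by simp
  have [measurable]: "h \<in> borel_measurable borel" "k \<in> borel_measurable borel"
    using assms by (auto intro: borel_measurable_continuous_onI)
  show "(\<lambda>y. k y * h y) \<in> borel_measurable lborel" by measurable
  show "AE y in lborel. norm (k y * h y) \<le> norm (g y * B)"
  proof (intro AE_I2)
    fix y
    have "\<bar>k y\<bar> * \<bar>h y\<bar> \<le> \<bar>g y\<bar> * \<bar>B\<bar>"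
      using assms(4)[of y] assms(5)[of y] by (intro mult_mono) auto
    then show "norm (k y * h y) \<le> norm (g y * B)" by (simp add: abs_mult)
  qed
qed

text \<open>All kernels below are dominated by the heat kernel times \<open>1 + w\<^sup>2\<close>, which makes one
  Gaussian majorant serve for every differentiation under the integral sign.\<close>

lemma has_derivative_kernel_integral:
  fixes k k' :: "real \<Rightarrow> real \<Rightarrow> real"
  assumes h: "continuous_on UNIV h" "\<And>y. \<bar>h y\<bar> \<le> B"
    and e: "0 < e" and r1: "0 < r1"
    and par: "\<And>p. p \<in> ball p0 e \<Longrightarrow> r1 \<le> \<rho> p \<and> \<rho> p \<le> r2 \<and> \<bar>\<xi> p - x0\<bar> \<le> 1"
    and der: "\<And>p y. p \<in> ball p0 e \<Longrightarrow> ((\<lambda>p. k p y) has_real_derivative k' p y) (at p)"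
    and bnd: "\<And>p y. p \<in> ball p0 e \<Longrightarrow> \<bar>k p y\<bar> \<le> C * (heat_kernel (y - \<xi> p) (\<rho> p) * (1 + (y - \<xi> p)\<^sup>2))"
    and bnd': "\<And>p y. p \<in> ball p0 e \<Longrightarrow> \<bar>k' p y\<bar> \<le> C * (heat_kernel (y - \<xi> p) (\<rho> p) * (1 + (y - \<xi> p)\<^sup>2))"
    and meas: "\<And>p. k p \<in> borel_measurable borel" "\<And>p. k' p \<in> borel_measurable borel"
    and C: "0 \<le> C"
  shows "((\<lambda>p. \<integral>y. k p y * h y \<partial>lborel) has_real_derivative (\<integral>y. k' p0 y * h y \<partial>lborel)) (at p0)"
proof -
  define g where "g = (\<lambda>y. C * ((1 + 8 * r2) / sqrt (4 * pi * r1) * exp (1 / (8 * r1))) * exp (- (y - x0)\<^sup>2 / (16 * r2)))"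
  have r2: "0 < r2" using par[of p0] e r1 by auto
  have g: "integrable lborel g" unfolding g_def by (rule integrable_gaussian_bump[OF r2])
  have le: "C * (heat_kernel (y - \<xi> p) (\<rho> p) * (1 + (y - \<xi> p)\<^sup>2)) \<le> g y" if "p \<in> ball p0 e" for p y
    using mult_left_mono[OF heat_kernel_bound[OF r1, of "\<rho> p" r2 "\<xi> p" x0 y] C] par[OF that]
    by (simp add: g_def mult.assoc)
  have B: "0 \<le> B" using h(2)[of 0] by linarith
  show ?thesis
  proof (rule has_real_derivative_lebesgue_integral[OF e, where w="\<lambda>y. g y * B"])
    show "integrable lborel (\<lambda>y. k p y * h y)" if "p \<in> ball p0 e" for p
      by (rule bounded_density_integrable[OF g meas(1) h]) (use bnd[OF that] le[OF that] order_trans in blast)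
    show "((\<lambda>p. k p y * h y) has_real_derivative k' p y * h y) (at p)" if "p \<in> ball p0 e" for p y
      using der[OF that] by (rule DERIV_cmult_right)
    show "\<bar>k' p y * h y\<bar> \<le> g y * B" if "p \<in> ball p0 e" for p y
    proof -
      have "\<bar>k' p y\<bar> \<le> g y" using bnd'[OF that] le[OF that] order_trans by blast
      then show ?thesis unfolding abs_mult using h(2)[of y] by (intro mult_mono) auto
    qed
    have [measurable]: "h \<in> borel_measurable borel" "k' p0 \<in> borel_measurable borel"
      using h meas by (auto intro: borel_measurable_continuous_onI)
    show "(\<lambda>y. k' p0 y * h y) \<in> borel_measurable lborel" by measurable
    show "integrable lborel (\<lambda>y. g y * B)" using g by simp
  qed
qed

abbreviation heat_avg where "heat_avg \<equiv> gauss_avg (\<lambda>z. 1)"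

definition heat_dx :: "(real \<Rightarrow> real) \<Rightarrow> real \<Rightarrow> real \<Rightarrow> real" where
  "heat_dx h x r = gauss_avg (\<lambda>z. z) h x r / sqrt (2 * r)"

text \<open>The time derivative and the second space derivative of \<open>heat_avg\<close> at once;
  that one formula serves for both is the heat equation.\<close>

definition heat_dt :: "(real \<Rightarrow> real) \<Rightarrow> real \<Rightarrow> real \<Rightarrow> real" where
  "heat_dt h x r = gauss_avg (\<lambda>z. z\<^sup>2 - 1) h x r / (2 * r)"

lemma heat_dx_kernel:
  assumes "0 < r"
  shows "heat_dx h x r = (\<integral>y. (y - x) / (2 * r) * heat_kernel (y - x) r * h y \<partial>lborel)"
proof -
  have s: "sqrt (2 * r) * sqrt (2 * r) = 2 * r" "0 < sqrt (2 * r)" using assms by auto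
  have "heat_dx h x r = (\<integral>y. heat_kernel (y - x) r * ((y - x) / sqrt (2 * r)) * h y / sqrt (2 * r) \<partial>lborel)"
    unfolding heat_dx_def gauss_avg_kernel[OF assms] by simp
  also have "(\<lambda>y. heat_kernel (y - x) r * ((y - x) / sqrt (2 * r)) * h y / sqrt (2 * r))
     = (\<lambda>y. (y - x) / (sqrt (2 * r) * sqrt (2 * r)) * heat_kernel (y - x) r * h y)"
    using s(2) by (simp add: fun_eq_iff mult_ac)
  finally show ?thesis unfolding s(1) .
qed

lemma heat_dt_kernel:
  assumes "0 < r"
  shows "heat_dt h x r = (\<integral>y. ((y - x)\<^sup>2 / (4 * r\<^sup>2) - 1 / (2 * r)) * heat_kernel (y - x) r * h y \<partial>lborel)"
proof -
  have "heat_dt h x r = (\<integral>y. heat_kernel (y - x) r * (((y - x) / sqrt (2 * r))\<^sup>2 - 1) * h y / (2 * r) \<partial>lborel)"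
    unfolding heat_dt_def gauss_avg_kernel[OF assms] by simp
  also have "(\<lambda>y. heat_kernel (y - x) r * (((y - x) / sqrt (2 * r))\<^sup>2 - 1) * h y / (2 * r))
     = (\<lambda>y. ((y - x)\<^sup>2 / (4 * r\<^sup>2) - 1 / (2 * r)) * heat_kernel (y - x) r * h y)"
    using assms by (simp add: fun_eq_iff power_divide field_simps power2_eq_square)
  finally show ?thesis .
qed

text \<open>Brings the coefficient into the form of a constant times \<open>1 + w\<^sup>2\<close>,
  which the common majorant absorbs, uniformly for times bounded away from zero.\<close>

lemma heat_dt_coeff_bound:
  fixes r r1 w :: real
  assumes "0 < r1" "r1 \<le> r"
  shows "\<bar>w\<^sup>2 / (4 * r\<^sup>2) - 1 / (2 * r)\<bar> \<le> (1 + 1 / (2 * r1) + 1 / (4 * r1\<^sup>2)) * (1 + w\<^sup>2)"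
proof -
  have "1 / (4 * r\<^sup>2) \<le> 1 / (4 * r1\<^sup>2)" "1 / (2 * r) \<le> 1 / (2 * r1)"
    using assms by (auto intro!: divide_left_mono power_mono mult_pos_pos)
  then have le: "w\<^sup>2 * (1 / (4 * r\<^sup>2)) \<le> (1 + w\<^sup>2) * (1 / (4 * r1\<^sup>2))"
    "1 * (1 / (2 * r)) \<le> (1 + w\<^sup>2) * (1 / (2 * r1))"
    using assms by (intro mult_mono; auto)+
  have tri: "\<bar>X - Y\<bar> \<le> X' + Y'" if "0 \<le> X" "0 \<le> Y" "X \<le> X'" "Y \<le> Y'" for X Y X' Y' :: real
    using that by linarith
  have "\<bar>w\<^sup>2 * (1 / (4 * r\<^sup>2)) - 1 * (1 / (2 * r))\<bar>
      \<le> (1 + w\<^sup>2) * (1 / (4 * r1\<^sup>2)) + (1 + w\<^sup>2) * (1 / (2 * r1))"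
    by (rule tri[OF _ _ le]) (use assms in auto)
  then have "\<bar>w\<^sup>2 / (4 * r\<^sup>2) - 1 / (2 * r)\<bar> \<le> (1 + w\<^sup>2) * (1 / (4 * r1\<^sup>2)) + (1 + w\<^sup>2) * (1 / (2 * r1))"
    by simp
  also have "\<dots> \<le> (1 + 1 / (2 * r1) + 1 / (4 * r1\<^sup>2)) * (1 + w\<^sup>2)"
    by (simp add: algebra_simps)
  finally show ?thesis .
qed

lemma abs_le_1_plus_square: "\<bar>w\<bar> \<le> 1 + (w::real)\<^sup>2"
proof -
  have "2 * \<bar>w\<bar> \<le> 1 + w\<^sup>2" using zero_le_power2[of "\<bar>w\<bar> - 1"] by (simp add: power2_eq_square algebra_simps)
  then show ?thesis using zero_le_power2[of w] by linarith
qed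

lemma heat_avg_deriv_time:
  assumes h: "continuous_on UNIV h" "\<And>y. \<bar>h y\<bar> \<le> B" and r: "0 < r"
  shows "((\<lambda>r. heat_avg h x r) has_real_derivative heat_dt h x r) (at r)"
proof -
  define C where "C = 1 + 1 / (2 * (r/2)) + 1 / (4 * (r/2)\<^sup>2)"
  have C: "1 \<le> C" using r by (simp add: C_def)
  \<comment> \<open>Radius \<open>r / 2\<close> keeps the time away from the singularity of the
    kernel at zero.\<close>
  have pos: "r / 2 \<le> p \<and> p \<le> 3 * r / 2" if "p \<in> ball r (r / 2)" for p
    using that by (auto simp: dist_real_def abs_real_def split: if_splits)
  have "((\<lambda>r. \<integral>y. heat_kernel (y - x) r * h y \<partial>lborel) has_real_derivative
    (\<integral>y. ((y - x)\<^sup>2 / (4 * r\<^sup>2) - 1 / (2 * r)) * heat_kernel (y - x) r * h y \<partial>lborel)) (at r)"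
  proof (rule has_derivative_kernel_integral[OF h, where e="r/2" and \<rho>="\<lambda>p. p" and \<xi>="\<lambda>p. x"
        and ?r1.0="r/2" and ?r2.0="3*r/2" and ?x0.0=x and C=C])
    fix p y assume p: "p \<in> ball r (r / 2)"
    note p' = pos[OF p]
    then have p0: "0 < p" using r by simp
    show "((\<lambda>p. heat_kernel (y - x) p) has_real_derivative
        ((y - x)\<^sup>2 / (4 * p\<^sup>2) - 1 / (2 * p)) * heat_kernel (y - x) p) (at p)"
      by (rule heat_kernel_deriv_time[OF p0])
    show "\<bar>heat_kernel (y - x) p\<bar> \<le> C * (heat_kernel (y - x) p * (1 + (y - x)\<^sup>2))"
    proof -
      have "1 * heat_kernel (y - x) p * 1 \<le> C * heat_kernel (y - x) p * (1 + (y - x)\<^sup>2)"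
        using heat_kernel_pos[OF p0, of "y - x"] C by (intro mult_mono) auto
      then show ?thesis using heat_kernel_pos[OF p0, of "y - x"] by (simp add: mult_ac)
    qed
    have "\<bar>(y - x)\<^sup>2 / (4 * p\<^sup>2) - 1 / (2 * p)\<bar> * heat_kernel (y - x) p \<le> C * (1 + (y - x)\<^sup>2) * heat_kernel (y - x) p"
      unfolding C_def using heat_kernel_pos[OF p0, of "y - x"] p' r
      by (intro mult_right_mono heat_dt_coeff_bound) auto
    then show "\<bar>((y - x)\<^sup>2 / (4 * p\<^sup>2) - 1 / (2 * p)) * heat_kernel (y - x) p\<bar>
       \<le> C * (heat_kernel (y - x) p * (1 + (y - x)\<^sup>2))"
      using heat_kernel_pos[OF p0, of "y - x"] by (simp add: abs_mult mult_ac)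
  qed (use r pos C in auto)
  \<comment> \<open>The kernel formula holds for positive times only, so the two functions are
    compared near \<open>r\<close> and not everywhere.\<close>
  moreover have "\<forall>\<^sub>F r' in nhds r. heat_avg h x r' = (\<integral>y. heat_kernel (y - x) r' * h y \<partial>lborel)"
    using eventually_nhds_in_open[of "{0<..}" r] r
    by (auto elim!: eventually_mono simp: gauss_avg_kernel)
  ultimately show ?thesis
    unfolding heat_dt_kernel[OF r] by (subst DERIV_cong_ev[OF refl _ refl])
qed

lemma heat_avg_deriv_space:
  assumes h: "continuous_on UNIV h" "\<And>y. \<bar>h y\<bar> \<le> B" and r: "0 < r"
  shows "((\<lambda>x. heat_avg h x r) has_real_derivative heat_dx h x r) (at x)"
proof -
  define C where "C = 1 + 1 / (2 * r)"
  have C: "1 \<le> C" using r by (simp add: C_def)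
  have "((\<lambda>x. \<integral>y. heat_kernel (y - x) r * h y \<partial>lborel) has_real_derivative
    (\<integral>y. (y - x) / (2 * r) * heat_kernel (y - x) r * h y \<partial>lborel)) (at x)"
  proof (rule has_derivative_kernel_integral[OF h, where e=1 and \<rho>="\<lambda>p. r" and \<xi>="\<lambda>p. p"
        and ?r1.0=r and ?r2.0=r and ?x0.0=x and C=C])
    fix p y
    show "((\<lambda>p. heat_kernel (y - p) r) has_real_derivative (y - p) / (2 * r) * heat_kernel (y - p) r) (at p)"
      by (rule heat_kernel_deriv_space[OF r])
    show "\<bar>heat_kernel (y - p) r\<bar> \<le> C * (heat_kernel (y - p) r * (1 + (y - p)\<^sup>2))"
    proof -
      have "1 * heat_kernel (y - p) r * 1 \<le> C * heat_kernel (y - p) r * (1 + (y - p)\<^sup>2)"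
        using heat_kernel_pos[OF r, of "y - p"] C by (intro mult_mono) auto
      then show ?thesis using heat_kernel_pos[OF r, of "y - p"] by (simp add: mult_ac)
    qed
    have "\<bar>y - p\<bar> * (1 / (2 * r)) * heat_kernel (y - p) r \<le> (1 + (y - p)\<^sup>2) * C * heat_kernel (y - p) r"
      using heat_kernel_pos[OF r, of "y - p"] r abs_le_1_plus_square[of "y - p"]
      by (intro mult_right_mono mult_mono) (auto simp: C_def)
    then show "\<bar>(y - p) / (2 * r) * heat_kernel (y - p) r\<bar>
       \<le> C * (heat_kernel (y - p) r * (1 + (y - p)\<^sup>2))"
      using heat_kernel_pos[OF r, of "y - p"] r by (simp add: abs_mult mult_ac)
  qed (use r C in \<open>auto simp: dist_real_def\<close>)
  then show ?thesis
    unfolding heat_dx_kernel[OF r] by (simp add: gauss_avg_kernel[OF r])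
qed

lemma heat_dx_deriv_space:
  assumes h: "continuous_on UNIV h" "\<And>y. \<bar>h y\<bar> \<le> B" and r: "0 < r"
  shows "((\<lambda>x. heat_dx h x r) has_real_derivative heat_dt h x r) (at x)"
proof -
  define C where "C = 1 + 1 / (2 * r) + 1 / (4 * r\<^sup>2)"
  have C: "1 \<le> C" "1 / (2 * r) \<le> C" using r by (simp_all add: C_def)
  have "((\<lambda>x. \<integral>y. (y - x) / (2 * r) * heat_kernel (y - x) r * h y \<partial>lborel) has_real_derivative
    (\<integral>y. ((y - x)\<^sup>2 / (4 * r\<^sup>2) - 1 / (2 * r)) * heat_kernel (y - x) r * h y \<partial>lborel)) (at x)"
  proof (rule has_derivative_kernel_integral[OF h, where e=1 and \<rho>="\<lambda>p. r" and \<xi>="\<lambda>p. p"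
        and ?r1.0=r and ?r2.0=r and ?x0.0=x and C=C])
    fix p y
    show "((\<lambda>p. (y - p) / (2 * r) * heat_kernel (y - p) r) has_real_derivative
        ((y - p)\<^sup>2 / (4 * r\<^sup>2) - 1 / (2 * r)) * heat_kernel (y - p) r) (at p)"
      using r by (auto intro!: derivative_eq_intros heat_kernel_deriv_space simp: field_simps power2_eq_square)
    have "\<bar>y - p\<bar> * (1 / (2 * r)) * heat_kernel (y - p) r \<le> (1 + (y - p)\<^sup>2) * C * heat_kernel (y - p) r"
      using heat_kernel_pos[OF r, of "y - p"] r abs_le_1_plus_square[of "y - p"] C
      by (intro mult_right_mono mult_mono) auto
    then show "\<bar>(y - p) / (2 * r) * heat_kernel (y - p) r\<bar>
       \<le> C * (heat_kernel (y - p) r * (1 + (y - p)\<^sup>2))"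
      using heat_kernel_pos[OF r, of "y - p"] r by (simp add: abs_mult mult_ac)
    have "\<bar>(y - p)\<^sup>2 / (4 * r\<^sup>2) - 1 / (2 * r)\<bar> * heat_kernel (y - p) r \<le> C * (1 + (y - p)\<^sup>2) * heat_kernel (y - p) r"
      unfolding C_def using heat_kernel_pos[OF r, of "y - p"] r
      by (intro mult_right_mono heat_dt_coeff_bound) auto
    then show "\<bar>((y - p)\<^sup>2 / (4 * r\<^sup>2) - 1 / (2 * r)) * heat_kernel (y - p) r\<bar>
       \<le> C * (heat_kernel (y - p) r * (1 + (y - p)\<^sup>2))"
      using heat_kernel_pos[OF r, of "y - p"] by (simp add: abs_mult mult_ac)
  qed (use r C in \<open>auto simp: dist_real_def\<close>)
  then show ?thesis
    unfolding heat_dt_kernel[OF r] by (simp add: heat_dx_kernel[OF r])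
qed

lemma heat_avg_0 [simp]: "heat_avg h x 0 = h x"
  by (simp add: gauss_avg_def)

section \<open>Duhamel integrals of bounded sources\<close>

lemma integral_rescale:
  fixes g :: "real \<Rightarrow> real"
  assumes "0 \<le> c" "g integrable_on {0..c}"
  shows "integral {0..c} g = c * integral {0..1} (\<lambda>\<sigma>. g (c * \<sigma>))"
proof (cases "c = 0")
  case False
  then have c: "0 < c" using assms by simp
  have "(g has_integral integral {0..c} g) (cbox 0 c)" using assms(2) by (simp add: integrable_integral)
  from has_integral_affinity'[OF this c, of 0] c
  have "((\<lambda>\<sigma>. g (c * \<sigma>)) has_integral integral {0..c} g / c) {0..1}" by (simp add: divide_inverse mult.commute)
  then show ?thesis using c by (simp add: integral_unique)
qed simp

text \<open>Substituting \<open>s = c p * \<sigma>\<close> fixes the interval of integration, which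
  reduces the claim to continuity in a parameter over the unit interval.\<close>

lemma continuous_on_moving_integral:
  fixes k :: "'p::topological_space \<Rightarrow> real \<Rightarrow> real"
  assumes c: "continuous_on A c" "\<And>p. p \<in> A \<Longrightarrow> 0 \<le> c p"
    and k: "continuous_on (Sigma A (\<lambda>p. {0..c p})) (\<lambda>(p, s). k p s)"
  shows "continuous_on A (\<lambda>p. integral {0..c p} (k p))"
proof -
  have "continuous_on (A \<times> cbox 0 1) (\<lambda>q. (fst q, c (fst q) * snd q))"
    by (intro continuous_intros continuous_on_compose2[OF c(1)]) auto
  moreover have "(\<lambda>q. (fst q, c (fst q) * snd q)) ` (A \<times> cbox 0 1) \<subseteq> Sigma A (\<lambda>p. {0..c p})"
    using c(2) by (auto simp: mult_left_le)
  ultimately have "continuous_on (A \<times> cbox 0 1) (\<lambda>(p, \<sigma>). k p (c p * \<sigma>))"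
    unfolding case_prod_unfold using continuous_on_compose2[OF k, of "A \<times> cbox 0 1" "\<lambda>q. (fst q, c (fst q) * snd q)"]
    by (simp only: fst_conv snd_conv prod.case)
  then have "continuous_on A (\<lambda>p. c p * integral (cbox 0 1) (\<lambda>\<sigma>. k p (c p * \<sigma>)))"
    by (intro continuous_on_mult c(1) integral_continuous_on_param)
  moreover have "integral {0..c p} (k p) = c p * integral (cbox 0 1) (\<lambda>\<sigma>. k p (c p * \<sigma>))" if p: "p \<in> A" for p
  proof -
    have "continuous_on {0..c p} (\<lambda>s. k p s)"
    proof -
      have "continuous_on {0..c p} (\<lambda>s. (p, s))" by (intro continuous_intros)
      from continuous_on_compose2[OF k this] p show ?thesis by (simp add: image_subset_iff)
    qed
    then show ?thesis using integral_rescale[OF c(2)[OF p]] integrable_continuous_interval by auto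
  qed
  ultimately show ?thesis by (simp cong: continuous_on_cong)
qed

lemma integral_inverse_sqrt_bound:
  fixes g :: "real \<Rightarrow> real"
  assumes ab: "a \<le> b" "b \<le> t" and g: "continuous_on {a..b} g"
    and le: "\<And>s. a \<le> s \<Longrightarrow> s < b \<Longrightarrow> \<bar>g s\<bar> \<le> K / sqrt (t - s)" and K: "0 \<le> K"
  shows "\<bar>integral {a..b} g\<bar> \<le> 2 * K * sqrt (t - a)"
proof -
  have "((\<lambda>s. K / sqrt (t - s)) has_integral (- 2 * K * sqrt (t - b)) - (- 2 * K * sqrt (t - a))) {a..b}"
  proof (rule fundamental_theorem_of_calculus_interior[OF ab(1)])
    show "continuous_on {a..b} (\<lambda>s. - 2 * K * sqrt (t - s))" by (intro continuous_intros)
    fix s assume "s \<in> {a<..<b}"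
    then have "0 < t - s" using ab by auto
    then have "((\<lambda>s. - 2 * K * sqrt (t - s)) has_real_derivative K / sqrt (t - s)) (at s)"
      by (auto intro!: derivative_eq_intros simp: field_simps)
    then show "((\<lambda>s. - 2 * K * sqrt (t - s)) has_vector_derivative K / sqrt (t - s)) (at s)"
      by (simp add: has_real_derivative_iff_has_vector_derivative)
  qed
  then have I: "((\<lambda>s. K / sqrt (t - s)) has_integral 2 * K * (sqrt (t - a) - sqrt (t - b))) {a..b}"
    by (simp add: algebra_simps)
  \<comment> \<open>For \<open>b = t\<close> the majorant takes the value \<open>K / 0 = 0\<close>
    at the endpoint, where nothing is assumed about \<open>g\<close>; changing \<open>g\<close> at
    this single point does not affect the integral.\<close>
  let ?g = "\<lambda>s. if s = b then 0 else g s"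
  have "g integrable_on {a..b}" using g by (rule integrable_continuous_interval)
  then have int: "?g integrable_on {a..b}" and eq: "integral {a..b} ?g = integral {a..b} g"
    using integrable_spike[of g "{a..b}" "{b}" ?g] integral_spike[of "{b}" "{a..b}" g ?g] by auto
  have "norm (integral {a..b} ?g) \<le> integral {a..b} (\<lambda>s. K / sqrt (t - s))"
    by (rule integral_norm_bound_integral[OF int]) (use I le ab K in \<open>auto simp: integrable_on_def\<close>)
  also have "\<dots> = 2 * K * (sqrt (t - a) - sqrt (t - b))"
    using I by (rule integral_unique)
  also have "\<dots> \<le> 2 * K * sqrt (t - a)" using K ab by (intro mult_left_mono) auto
  finally show ?thesis by (simp add: eq)
qed

text \<open>The integral is regarded as a function of two independent variables, the parameter and
  the upper limit. Its partial derivatives combine to a total derivative because the one in the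
  upper limit is jointly continuous, and the chain rule along the path
  \<open>(t, c + (t - t0))\<close> adds them up.\<close>

lemma leibniz_moving_limit:
  fixes k k' :: "real \<Rightarrow> real \<Rightarrow> real"
  assumes e: "0 < e" "e \<le> c"
    and k: "continuous_on ({t0-e<..<t0+e} \<times> {0..c+e}) (\<lambda>(t, s). k t s)"
    and k': "continuous_on ({t0-e<..<t0+e} \<times> {0..c+e}) (\<lambda>(t, s). k' t s)"
    and der: "\<And>t s. t \<in> {t0-e<..<t0+e} \<Longrightarrow> s \<in> {0..c+e} \<Longrightarrow> ((\<lambda>t. k t s) has_real_derivative k' t s) (at t)"
  shows "((\<lambda>t. integral {0..c + (t - t0)} (k t)) has_real_derivative k t0 c + integral {0..c} (k' t0)) (at t0)"
proof -
  let ?X = "{t0-e<..<t0+e}" and ?Y = "{c-e<..<c+e}"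
  let ?J = "\<lambda>t \<tau>. integral {0..\<tau>} (k t)"
  have kt: "continuous_on {0..c+e} (k t)" if "t \<in> ?X" for t
  proof -
    have "continuous_on {0..c+e} (\<lambda>s. (t, s))" by (intro continuous_intros)
    from continuous_on_compose2[OF k this] that show ?thesis by (simp add: image_subset_iff)
  qed
  have sub: "continuous_on (?X \<times> cbox 0 c) (\<lambda>(t, s). k' t s)"
    using e by (intro continuous_on_subset[OF k']) auto
  have "((\<lambda>t. integral (cbox 0 c) (k t)) has_real_derivative integral (cbox 0 c) (k' t0)) (at t0 within ?X)"
  proof (rule leibniz_rule_field_derivative[OF _ _ sub])
    show "((\<lambda>x. k x t) has_real_derivative k' x t) (at x within ?X)" if "x \<in> ?X" "t \<in> cbox 0 c" for x t
      using der[of x t] that e by (auto intro: has_field_derivative_at_within)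
    show "k x integrable_on cbox 0 c" if "x \<in> ?X" for x
      using continuous_on_subset[OF kt[OF that], of "{0..c}"] e
      by (auto intro: integrable_continuous_interval)
  qed (use e in auto)
  then have 1: "((\<lambda>t. ?J t c) has_derivative (*) (integral {0..c} (k' t0))) (at t0 within ?X)"
    by (simp add: has_field_derivative_def)
  have 2: "((\<lambda>\<tau>. ?J t \<tau>) has_derivative blinfun_apply (blinfun_mult_right (k t \<tau>))) (at \<tau> within ?Y)"
    if "t \<in> ?X" "\<tau> \<in> ?Y" for t \<tau>
  proof -
    have "((\<lambda>\<tau>. ?J t \<tau>) has_real_derivative k t \<tau>) (at \<tau> within {0..c+e})"
      by (rule integral_has_real_derivative[OF kt]) (use that e in auto)
    then have "((\<lambda>\<tau>. ?J t \<tau>) has_real_derivative k t \<tau>) (at \<tau> within ?Y)"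
      by (rule DERIV_subset) (use e in auto)
    then show ?thesis by (simp add: has_field_derivative_def)
  qed
  have "continuous_on (?X \<times> ?Y) (\<lambda>(t, s). blinfun_mult_right (k t s))"
  proof -
    have "continuous_on (?X \<times> ?Y) (\<lambda>(t, s). k t s)"
      by (rule continuous_on_subset[OF k]) (use e in auto)
    from bounded_linear.continuous_on[OF bounded_linear_blinfun_mult_right this]
    show ?thesis by (simp add: case_prod_unfold)
  qed
  then have 3: "continuous (at (t0, c) within ?X \<times> ?Y) (\<lambda>(t, s). blinfun_mult_right (k t s))"
    using e by (auto simp: continuous_on_eq_continuous_within)
  have "((\<lambda>(t, \<tau>). ?J t \<tau>) has_derivative (\<lambda>(tx, ty). integral {0..c} (k' t0) * tx + blinfun_mult_right (k t0 c) ty))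
      (at (t0, c) within ?X \<times> ?Y)"
    by (rule has_derivative_partialsI[OF 1 2 3]) (use e in auto)
  then have "((\<lambda>(t, \<tau>). ?J t \<tau>) has_derivative (\<lambda>(tx, ty). integral {0..c} (k' t0) * tx + k t0 c * ty)) (at (t0, c))"
    using e by (subst (asm) at_within_open) (auto intro: open_Times)
  moreover have "((\<lambda>t. (t, c + (t - t0))) has_derivative (\<lambda>h. (h, h))) (at t0)"
    by (auto intro!: derivative_eq_intros)
  ultimately have "((\<lambda>t. case (t, c + (t - t0)) of (t, \<tau>) \<Rightarrow> ?J t \<tau>) has_derivative
     (\<lambda>h. case (h, h) of (tx, ty) \<Rightarrow> integral {0..c} (k' t0) * tx + k t0 c * ty)) (at t0)"
    by (intro has_derivative_compose[of "\<lambda>t. (t, c + (t - t0))" "\<lambda>h. (h, h)" t0 UNIV "\<lambda>(t, \<tau>). ?J t \<tau>"]) simp_all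
  then have "((\<lambda>t. integral {0..c + (t - t0)} (k t)) has_derivative
     (\<lambda>h. integral {0..c} (k' t0) * h + k t0 c * h)) (at t0)" by simp
  then show ?thesis
    unfolding has_field_derivative_def
    by (rule has_derivative_eq_rhs) (simp add: fun_eq_iff algebra_simps)
qed

lemma has_real_derivative_uniform_limit:
  fixes f f' :: "nat \<Rightarrow> real \<Rightarrow> real"
  assumes S: "convex S" "open S" "x \<in> S"
    and der: "\<And>n y. y \<in> S \<Longrightarrow> (f n has_real_derivative f' n y) (at y)"
    and ul: "uniform_limit S f' g' sequentially"
    and lim: "\<And>y. y \<in> S \<Longrightarrow> (\<lambda>n. f n y) \<longlonglongrightarrow> g y"
  shows "(g has_real_derivative g' x) (at x)"
proof -
  have "\<exists>G. \<forall>y\<in>S. (\<lambda>n. f n y) \<longlonglongrightarrow> G y \<and> (G has_derivative (*) (g' y)) (at y within S)"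
  proof (rule has_derivative_sequence[where f=f and f'="\<lambda>n y. (*) (f' n y)" and ?x0.0=x and l="g x", OF S(1) _ _ S(3) lim[OF S(3)]])
    show "(f n has_derivative (*) (f' n y)) (at y within S)" if "y \<in> S" for n y
      using der[OF that] by (simp add: has_field_derivative_def has_derivative_at_withinI)
    show "\<forall>\<^sub>F n in sequentially. \<forall>y\<in>S. \<forall>h. norm (f' n y * h - g' y * h) \<le> e * norm h" if "0 < e" for e
      using uniform_limitD[OF ul that]
    proof eventually_elim
      case (elim n)
      show ?case
      proof (intro ballI allI)
        fix y h assume "y \<in> S"
        then have "\<bar>f' n y - g' y\<bar> * \<bar>h\<bar> \<le> e * \<bar>h\<bar>"
          using elim by (intro mult_right_mono) (auto simp: dist_real_def less_imp_le)
        then show "norm (f' n y * h - g' y * h) \<le> e * norm h"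
          by (simp add: abs_mult[symmetric] left_diff_distrib)
      qed
    qed
  qed
  then obtain G where G: "\<And>y. y \<in> S \<Longrightarrow> (\<lambda>n. f n y) \<longlonglongrightarrow> G y"
     "\<And>y. y \<in> S \<Longrightarrow> (G has_derivative (*) (g' y)) (at y within S)" by blast
  \<comment> \<open>The sequence theorem provides some limit function; uniqueness of pointwise
    limits identifies it with \<open>g\<close>.\<close>
  have eq: "G y = g y" if "y \<in> S" for y
    using LIMSEQ_unique[OF G(1)[OF that] lim[OF that]] .
  have "(G has_real_derivative g' x) (at x)"
    using G(2)[OF S(3)] at_within_open[OF S(3,2)] by (simp add: has_field_derivative_def)
  then show ?thesis
    by (rule has_field_derivative_transform_within_open[OF _ S(2,3)]) (rule eq)
qed

text \<open>The time derivative is of order \<open>1 / r\<close>, which bounds the increment by the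
  ratio \<open>q = (r' - r) / r\<close>, and \<open>q \<le> sqrt q\<close> as long as
  \<open>q \<le> 1\<close>; for larger \<open>q\<close> the trivial bound \<open>2 * B\<close> is
  good enough. The square root is chosen because \<open>1 / sqrt r\<close> is integrable at zero,
  unlike \<open>1 / r\<close>.\<close>

lemma heat_avg_time_holder:
  assumes h: "continuous_on UNIV h" "\<And>y. \<bar>h y\<bar> \<le> B" and r: "0 < r" "r \<le> r'"
  shows "\<bar>heat_avg h x r' - heat_avg h x r\<bar> \<le> (2 + gauss_norm (\<lambda>z. z\<^sup>2 - 1)) * B * sqrt ((r' - r) / r)"
proof -
  define c where "c = gauss_norm (\<lambda>z. z\<^sup>2 - 1)"
  have c0: "0 \<le> c" by (simp add: c_def)
  have B: "0 \<le> B" using h(2)[of 0] by linarith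
  define q where "q = (r' - r) / r"
  have q0: "0 \<le> q" using r by (simp add: q_def)
  show ?thesis
  proof (cases "q \<le> 1")
    case True
    have "norm (heat_avg h x r' - heat_avg h x r) \<le> c * B / r * norm (r' - r)"
    proof (rule field_differentiable_bound[of "{r..r'}" "\<lambda>r. heat_avg h x r" "heat_dt h x"])
      fix \<rho> assume \<rho>: "\<rho> \<in> {r..r'}"
      then have \<rho>0: "0 < \<rho>" using r by auto
      show "((\<lambda>r. heat_avg h x r) has_real_derivative heat_dt h x \<rho>) (at \<rho> within {r..r'})"
        using heat_avg_deriv_time[OF h \<rho>0] by (rule has_field_derivative_at_within)
      have "\<bar>gauss_avg (\<lambda>z. z\<^sup>2 - 1) h x \<rho>\<bar> / (2 * \<rho>) \<le> (B * c) / r"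
        using gauss_avg_bound[OF gauss_weight_hermite2 h, of x \<rho>] \<rho> \<rho>0 r B c0
        by (intro frac_le) (auto simp: c_def)
      then show "norm (heat_dt h x \<rho>) \<le> c * B / r"
        using \<rho>0 by (simp add: heat_dt_def mult.commute)
    qed (use r in auto)
    also have "\<dots> = c * B * q" using r by (simp add: q_def)
    also have "\<dots> \<le> (2 + c) * B * sqrt q"
    proof (rule mult_mono)
      have "q * q \<le> q * 1" using True q0 by (intro mult_left_mono)
      then show "q \<le> sqrt q" using q0 by (intro real_le_rsqrt) (simp add: power2_eq_square)
    qed (use B c0 q0 in \<open>auto simp: mult_right_mono\<close>)
    finally show ?thesis by (simp add: q_def c_def)
  next
    case False
    have "\<bar>heat_avg h x r' - heat_avg h x r\<bar> \<le> 2 * B * 1"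
      using gauss_avg_bound[OF gauss_weight_1 h, of x r] gauss_avg_bound[OF gauss_weight_1 h, of x r'] by simp
    also have "\<dots> \<le> (2 + c) * B * sqrt q"
      using False B c0 by (intro mult_mono) auto
    finally show ?thesis by (simp add: q_def c_def)
  qed
qed

text \<open>The parameter \<open>d\<close> cuts off the last stretch of time before
  \<open>t\<close>, where the differentiated kernels are singular. The genuine Duhamel term has
  \<open>d = 0\<close>; every differentiation is carried out for \<open>d > 0\<close> and followed
  by a limit.\<close>

definition duhamel :: "(real \<Rightarrow> real \<Rightarrow> real) \<Rightarrow> real \<Rightarrow> real \<Rightarrow> real \<Rightarrow> real" where
  "duhamel f d x t = integral {0..t - d} (\<lambda>s. heat_avg (\<lambda>y. f y s) x (t - s))"

definition duhamel_dx :: "(real \<Rightarrow> real \<Rightarrow> real) \<Rightarrow> real \<Rightarrow> real \<Rightarrow> real \<Rightarrow> real" where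
  "duhamel_dx f d x t = integral {0..t - d} (\<lambda>s. heat_dx (\<lambda>y. f y s) x (t - s))"

definition duhamel_dxx :: "(real \<Rightarrow> real \<Rightarrow> real) \<Rightarrow> real \<Rightarrow> real \<Rightarrow> real \<Rightarrow> real" where
  "duhamel_dxx f d x t = integral {0..t - d} (\<lambda>s. heat_dt (\<lambda>y. f y s) x (t - s))"

locale bounded_source =
  fixes f :: "real \<Rightarrow> real \<Rightarrow> real" and B :: real
  assumes f_cont: "continuous_on UNIV (\<lambda>(y, s). f y s)"
    and f_bound: "\<And>y s. \<bar>f y s\<bar> \<le> B"
begin

lemma f_cont_slice: "continuous_on UNIV (\<lambda>y. f y s)"
  by (rule continuous_on_compose2[OF f_cont, of UNIV "\<lambda>y. (y, s)", simplified]) (intro continuous_intros)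

lemma B_nonneg: "0 \<le> B"
  using f_bound[of 0 0] by linarith

lemmas source_avg_cont = gauss_avg_continuous[OF _ f_cont f_bound]

lemma source_avg_compose:
  assumes "gauss_weight \<omega>" "continuous_on A X" "continuous_on A R" "continuous_on A \<Sigma>"
  shows "continuous_on A (\<lambda>p. gauss_avg \<omega> (\<lambda>y. f y (\<Sigma> p)) (X p) (R p))"
proof -
  have "continuous_on A (\<lambda>p. (X p, R p, \<Sigma> p))" using assms(2-) by (intro continuous_intros)
  from continuous_on_compose2[OF source_avg_cont[OF assms(1)] this] show ?thesis by auto
qed

lemma source_dx_compose:
  assumes "continuous_on A X" "continuous_on A R" "continuous_on A \<Sigma>" "\<And>p. p \<in> A \<Longrightarrow> 0 < R p"
  shows "continuous_on A (\<lambda>p. heat_dx (\<lambda>y. f y (\<Sigma> p)) (X p) (R p))"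
  unfolding heat_dx_def using assms
  by (intro continuous_intros source_avg_compose) (auto dest: assms(4))

lemma source_dt_compose:
  assumes "continuous_on A X" "continuous_on A R" "continuous_on A \<Sigma>" "\<And>p. p \<in> A \<Longrightarrow> 0 < R p"
  shows "continuous_on A (\<lambda>p. heat_dt (\<lambda>y. f y (\<Sigma> p)) (X p) (R p))"
  unfolding heat_dt_def using assms
  by (intro continuous_intros source_avg_compose) (auto dest: assms(4))

lemma duhamel_deriv_space:
  assumes "0 < d"
  shows "((\<lambda>x. duhamel f d x t) has_real_derivative duhamel_dx f d x t) (at x)"
proof -
  have "((\<lambda>x. integral (cbox 0 (t - d)) (\<lambda>s. heat_avg (\<lambda>y. f y s) x (t - s))) has_real_derivative
    integral (cbox 0 (t - d)) (\<lambda>s. heat_dx (\<lambda>y. f y s) x (t - s))) (at x within UNIV)"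
  proof (rule leibniz_rule_field_derivative)
    show "((\<lambda>x. heat_avg (\<lambda>y. f y s) x (t - s)) has_real_derivative heat_dx (\<lambda>y. f y s) x (t - s)) (at x within UNIV)"
      if "s \<in> cbox 0 (t - d)" for x s
      using heat_avg_deriv_space[OF f_cont_slice f_bound, of "t - s"] that assms by auto
    show "(\<lambda>s. heat_avg (\<lambda>y. f y s) x (t - s)) integrable_on cbox 0 (t - d)" for x
      by (intro integrable_continuous source_avg_compose continuous_intros) auto
    show "continuous_on (UNIV \<times> cbox 0 (t - d)) (\<lambda>(x, s). heat_dx (\<lambda>y. f y s) x (t - s))"
      unfolding case_prod_unfold
      by (intro source_dx_compose continuous_intros) (use assms in auto)
  qed auto
  then show ?thesis by (simp add: duhamel_def duhamel_dx_def)
qed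

lemma duhamel_dx_deriv_space:
  assumes "0 < d"
  shows "((\<lambda>x. duhamel_dx f d x t) has_real_derivative duhamel_dxx f d x t) (at x)"
proof -
  have "((\<lambda>x. integral (cbox 0 (t - d)) (\<lambda>s. heat_dx (\<lambda>y. f y s) x (t - s))) has_real_derivative
    integral (cbox 0 (t - d)) (\<lambda>s. heat_dt (\<lambda>y. f y s) x (t - s))) (at x within UNIV)"
  proof (rule leibniz_rule_field_derivative)
    show "((\<lambda>x. heat_dx (\<lambda>y. f y s) x (t - s)) has_real_derivative heat_dt (\<lambda>y. f y s) x (t - s)) (at x within UNIV)"
      if "s \<in> cbox 0 (t - d)" for x s
      using heat_dx_deriv_space[OF f_cont_slice f_bound, of "t - s"] that assms by auto
    show "(\<lambda>s. heat_dx (\<lambda>y. f y s) x (t - s)) integrable_on cbox 0 (t - d)" for x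
      by (intro integrable_continuous source_dx_compose continuous_intros) (use assms in auto)
    show "continuous_on (UNIV \<times> cbox 0 (t - d)) (\<lambda>(x, s). heat_dt (\<lambda>y. f y s) x (t - s))"
      unfolding case_prod_unfold
      by (intro source_dt_compose continuous_intros) (use assms in auto)
  qed auto
  then show ?thesis by (simp add: duhamel_dx_def duhamel_dxx_def)
qed

text \<open>The moving upper limit contributes the average over the short time \<open>d\<close>. As
  \<open>d\<close> tends to zero it becomes the source itself, which is how the right-hand side of
  the equation arises.\<close>

lemma duhamel_deriv_time:
  assumes d: "0 < d" "d < t"
  shows "((\<lambda>t. duhamel f d x t) has_real_derivative
           heat_avg (\<lambda>y. f y (t - d)) x d + duhamel_dxx f d x t) (at t)"
proof -
  \<comment> \<open>On the enlarged rectangle \<open>t' - s\<close> exceeds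
    \<open>d - 2 * e\<close>, so \<open>e \<le> d / 3\<close> keeps the kernel away from its
    singularity.\<close>
  define e where "e = min (d / 3) (t - d)"
  have e: "0 < e" "e \<le> t - d" "e \<le> d / 3" using d by (auto simp: e_def min_def)
  have pos: "0 < t' - s" if "t' \<in> {t-e<..<t+e}" "s \<in> {0..(t-d)+e}" for t' s
    using that e d by auto
  have "((\<lambda>t'. integral {0..(t - d) + (t' - t)} (\<lambda>s. heat_avg (\<lambda>y. f y s) x (t' - s))) has_real_derivative
     heat_avg (\<lambda>y. f y (t - d)) x (t - (t - d)) + integral {0..t-d} (\<lambda>s. heat_dt (\<lambda>y. f y s) x (t - s))) (at t)"
  proof (rule leibniz_moving_limit[OF e(1,2)])
    show "continuous_on ({t-e<..<t+e} \<times> {0..(t-d)+e}) (\<lambda>(t, s). heat_avg (\<lambda>y. f y s) x (t - s))"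
      unfolding case_prod_unfold by (intro source_avg_compose continuous_intros) auto
    show "continuous_on ({t-e<..<t+e} \<times> {0..(t-d)+e}) (\<lambda>(t, s). heat_dt (\<lambda>y. f y s) x (t - s))"
      unfolding case_prod_unfold by (intro source_dt_compose continuous_intros) (rule pos; simp add: mem_Times_iff)
    fix t' s assume *: "t' \<in> {t-e<..<t+e}" "s \<in> {0..(t-d)+e}"
    show "((\<lambda>t. heat_avg (\<lambda>y. f y s) x (t - s)) has_real_derivative heat_dt (\<lambda>y. f y s) x (t' - s)) (at t')"
    proof -
      have "((\<lambda>t. t - s) has_real_derivative 1) (at t')" by (auto intro!: derivative_eq_intros)
      from DERIV_chain2[where f="heat_avg (\<lambda>y. f y s) x", OF heat_avg_deriv_time[OF f_cont_slice f_bound pos[OF *]] this]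
      show ?thesis by simp
    qed
  qed
  moreover have "(t - d) + (t' - t) = t' - d" for t' by simp
  ultimately show ?thesis by (simp add: duhamel_def duhamel_dxx_def)
qed

lemma duhamel_cont:
  "continuous_on (UNIV \<times> {0..}) (\<lambda>(x, t). duhamel f 0 x t)"
  unfolding duhamel_def case_prod_unfold
proof (rule continuous_on_moving_integral)
  show "continuous_on (UNIV \<times> {0..}) (\<lambda>p::real \<times> real. snd p - 0)" by (intro continuous_intros)
  show "continuous_on (SIGMA p:UNIV \<times> {0..}. {0..snd p - 0})
      (\<lambda>(p, s). heat_avg (\<lambda>y. f y s) (fst p) (snd p - s))"
    unfolding case_prod_unfold by (intro source_avg_compose gauss_weight_1 continuous_intros)
qed auto

lemma duhamel_dxx_cont:
  assumes "0 < d"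
  shows "continuous_on (UNIV \<times> {d..}) (\<lambda>(x, t). duhamel_dxx f d x t)"
  unfolding duhamel_dxx_def case_prod_unfold
proof (rule continuous_on_moving_integral)
  show "continuous_on (UNIV \<times> {d..}) (\<lambda>p::real \<times> real. snd p - d)" by (intro continuous_intros)
  show "continuous_on (SIGMA p:UNIV \<times> {d..}. {0..snd p - d})
      (\<lambda>(p, s). heat_dt (\<lambda>y. f y s) (fst p) (snd p - s))"
    unfolding case_prod_unfold by (intro source_dt_compose continuous_intros) (use assms in auto)
qed auto

text \<open>The increment splits into the change of the kernel over the old time interval, where the
  Hoelder bound for averages leaves an integrable \<open>1 / sqrt (t - s)\<close>, and the
  contribution of the new interval, at most \<open>B * (t' - t)\<close>. A bounded continuous source
  suffices, so this regularity can be fed back into the source.\<close>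

lemma duhamel_time_holder:
  assumes t: "0 \<le> t" "t \<le> t'" "t' \<le> T"
  shows "\<bar>duhamel f 0 x t' - duhamel f 0 x t\<bar>
    \<le> (2 * (2 + gauss_norm (\<lambda>z. z\<^sup>2 - 1)) + 1) * B * sqrt T * sqrt (t' - t)"
proof -
  define K where "K = (2 + gauss_norm (\<lambda>z. z\<^sup>2 - 1)) * B"
  have K: "0 \<le> K" using B_nonneg by (simp add: K_def)
  let ?g = "\<lambda>t s. heat_avg (\<lambda>y. f y s) x (t - s)"
  have cont: "continuous_on S (?g t)" for S t
    by (intro source_avg_compose continuous_intros) auto
  then have int: "?g t integrable_on {a..b}" for t a b
    by (rule integrable_continuous_interval)
  have "integral {0..t'} (?g t') = integral {0..t} (?g t') + integral {t..t'} (?g t')"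
    using Henstock_Kurzweil_Integration.integral_combine[OF t(1,2) int] by simp
  then have "duhamel f 0 x t' - duhamel f 0 x t = integral {0..t} (\<lambda>s. ?g t' s - ?g t s) + integral {t..t'} (?g t')"
    using Henstock_Kurzweil_Integration.integral_diff[OF int[of t' 0 t] int[of t 0 t]] by (simp add: duhamel_def)
  moreover have "\<bar>integral {0..t} (\<lambda>s. ?g t' s - ?g t s)\<bar> \<le> 2 * (K * sqrt (t' - t)) * sqrt (t - 0)"
  proof (rule integral_inverse_sqrt_bound[OF t(1) order_refl])
    show "continuous_on {0..t} (\<lambda>s. ?g t' s - ?g t s)" by (intro continuous_on_diff cont)
    show "\<bar>?g t' s - ?g t s\<bar> \<le> K * sqrt (t' - t) / sqrt (t - s)" if "0 \<le> s" "s < t" for s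
      using heat_avg_time_holder[OF f_cont_slice f_bound, of "t - s" "t' - s" s x] that t
      by (simp add: K_def real_sqrt_divide)
  qed (use K t in auto)
  moreover have "\<bar>integral {t..t'} (?g t')\<bar> \<le> B * (t' - t)"
    using integral_bound[OF t(2) cont[of "{t..t'}" t'], of B]
      gauss_avg_bound[OF gauss_weight_1 f_cont_slice f_bound] by simp
  moreover have "2 * (K * sqrt (t' - t)) * sqrt t \<le> 2 * (K * sqrt (t' - t)) * sqrt T"
    using t K by (intro mult_left_mono) auto
  moreover have "B * (t' - t) \<le> B * (sqrt T * sqrt (t' - t))"
  proof (rule mult_left_mono[OF _ B_nonneg])
    have "t' - t = sqrt (t' - t) * sqrt (t' - t)" using t by simp
    also have "\<dots> \<le> sqrt T * sqrt (t' - t)" using t by (intro mult_right_mono) auto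
    finally show "t' - t \<le> sqrt T * sqrt (t' - t)" .
  qed
  ultimately have "\<bar>duhamel f 0 x t' - duhamel f 0 x t\<bar> \<le> 2 * (K * sqrt (t' - t)) * sqrt T + B * (sqrt T * sqrt (t' - t))"
    by simp
  also have "\<dots> = (2 * (2 + gauss_norm (\<lambda>z. z\<^sup>2 - 1)) + 1) * B * sqrt T * sqrt (t' - t)"
    by (simp add: K_def algebra_simps)
  finally show ?thesis .
qed

lemma duhamel_cutoff_error:
  assumes "0 \<le> d" "d \<le> t"
  shows "\<bar>duhamel f 0 x t - duhamel f d x t\<bar> \<le> B * d"
proof -
  let ?g = "\<lambda>s. heat_avg (\<lambda>y. f y s) x (t - s)"
  have cont: "continuous_on S ?g" for S
    by (intro source_avg_compose continuous_intros) auto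
  have "duhamel f 0 x t - duhamel f d x t = integral {t - d..t} ?g"
    using Henstock_Kurzweil_Integration.integral_combine[of 0 "t - d" t ?g] integrable_continuous_interval[OF cont] assms
    by (simp add: duhamel_def)
  then show ?thesis
    using integral_bound[of "t - d" t ?g B] cont assms
      gauss_avg_bound[OF gauss_weight_1 f_cont_slice f_bound] by simp
qed

text \<open>The first derivative of the kernel costs only \<open>1 / sqrt r\<close>, which is
  integrable; boundedness of the source is enough here.\<close>

lemma duhamel_dx_cutoff_diff:
  assumes "0 < d'" "d' \<le> d" "d \<le> t"
  shows "\<bar>duhamel_dx f d' x t - duhamel_dx f d x t\<bar> \<le> 2 * (B * gauss_norm (\<lambda>z. z)) * sqrt d"
proof -
  let ?g = "\<lambda>s. heat_dx (\<lambda>y. f y s) x (t - s)"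
  have cont: "continuous_on {a..t-d'} ?g" for a
    by (intro source_dx_compose continuous_intros) (use assms in auto)
  have "duhamel_dx f d' x t - duhamel_dx f d x t = integral {t - d..t - d'} ?g"
    using Henstock_Kurzweil_Integration.integral_combine[of 0 "t - d" "t - d'" ?g] integrable_continuous_interval[OF cont] assms
    by (simp add: duhamel_dx_def)
  moreover have "\<bar>integral {t - d..t - d'} ?g\<bar> \<le> 2 * (B * gauss_norm (\<lambda>z. z)) * sqrt (t - (t - d))"
  proof (rule integral_inverse_sqrt_bound[OF _ _ cont])
    fix s assume s: "t - d \<le> s" "s < t - d'"
    then have "0 < t - s" using assms by auto
    then show "\<bar>?g s\<bar> \<le> B * gauss_norm (\<lambda>z. z) / sqrt (t - s)"
      using gauss_avg_bound[OF gauss_weight_id f_cont_slice f_bound, of s x "t - s"]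
      unfolding heat_dx_def abs_divide by (intro frac_le) auto
  qed (use assms B_nonneg in auto)
  ultimately show ?thesis by simp
qed

text \<open>The kernel \<open>heat_dt\<close> is of order \<open>1/r\<close>, which is not integrable; subtracting the source
  frozen at the final time gains the factor \<open>sqrt r\<close>, and the frozen part integrates explicitly.\<close>

lemma duhamel_dxx_cutoff_diff:
  assumes d: "0 < d'" "d' \<le> d" "d \<le> t"
    and H: "0 \<le> H" "\<And>y s. t - d \<le> s \<Longrightarrow> s \<le> t \<Longrightarrow> \<bar>f y s - f y t\<bar> \<le> H * sqrt (t - s)"
  shows "\<bar>duhamel_dxx f d' x t - duhamel_dxx f d x t\<bar>
    \<le> 2 * (H * gauss_norm (\<lambda>z. z\<^sup>2 - 1)) * sqrt d
       + \<bar>heat_avg (\<lambda>y. f y t) x d - heat_avg (\<lambda>y. f y t) x d'\<bar>"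
proof -
  let ?g = "\<lambda>s. heat_dt (\<lambda>y. f y s) x (t - s)" and ?k = "\<lambda>s. heat_dt (\<lambda>y. f y t) x (t - s)"
  have cont: "continuous_on {a..t-d'} ?g" for a
    by (intro source_dt_compose continuous_intros) (use d in auto)
  have contk: "continuous_on {a..t-d'} ?k" for a
    by (intro source_dt_compose continuous_intros) (use d in auto)
  have eq: "duhamel_dxx f d' x t - duhamel_dxx f d x t = integral {t - d..t - d'} ?g"
    using Henstock_Kurzweil_Integration.integral_combine[of 0 "t - d" "t - d'" ?g] integrable_continuous_interval[OF cont] d
    by (simp add: duhamel_dxx_def)
  have "(?k has_integral (- heat_avg (\<lambda>y. f y t) x (t - (t - d'))) - (- heat_avg (\<lambda>y. f y t) x (t - (t - d)))) {t-d..t-d'}"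
  proof (rule fundamental_theorem_of_calculus)
    fix s assume "s \<in> {t - d..t - d'}"
    then have "0 < t - s" using d by auto
    from heat_avg_deriv_time[OF f_cont_slice f_bound this, of t x]
    have "((\<lambda>s. - heat_avg (\<lambda>y. f y t) x (t - s)) has_real_derivative - (?k s * (0 - 1))) (at s)"
      by (intro DERIV_minus DERIV_chain2[where f="heat_avg (\<lambda>y. f y t) x"] DERIV_diff DERIV_const DERIV_ident)
    then show "((\<lambda>s. - heat_avg (\<lambda>y. f y t) x (t - s)) has_vector_derivative ?k s) (at s within {t - d..t - d'})"
      by (simp add: has_real_derivative_iff_has_vector_derivative has_vector_derivative_at_within)
  qed (use d in auto)
  then have k: "integral {t-d..t-d'} ?k = heat_avg (\<lambda>y. f y t) x d - heat_avg (\<lambda>y. f y t) x d'"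
    by (simp add: integral_unique)
  have "integral {t-d..t-d'} (\<lambda>s. ?g s - ?k s) = integral {t-d..t-d'} ?g - integral {t-d..t-d'} ?k"
    by (intro Henstock_Kurzweil_Integration.integral_diff integrable_continuous_interval cont contk)
  moreover have "\<bar>integral {t-d..t-d'} (\<lambda>s. ?g s - ?k s)\<bar>
     \<le> 2 * (H * gauss_norm (\<lambda>z. z\<^sup>2 - 1)) * sqrt (t - (t - d))"
  proof (rule integral_inverse_sqrt_bound)
    show "continuous_on {t-d..t-d'} (\<lambda>s. ?g s - ?k s)" by (intro continuous_on_diff cont contk)
    fix s assume s: "t - d \<le> s" "s < t - d'"
    define r where "r = t - s"
    have r: "0 < r" using s d by (simp add: r_def)
    have "\<bar>gauss_avg (\<lambda>z. z\<^sup>2 - 1) (\<lambda>y. f y s - f y t) x r\<bar> \<le> (H * sqrt r) * gauss_norm (\<lambda>z. z\<^sup>2 - 1)"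
      by (rule gauss_avg_bound) (use s d H(2)[of s] in \<open>auto simp: r_def intro!: continuous_intros f_cont_slice\<close>)
    moreover have "?g s - ?k s = gauss_avg (\<lambda>z. z\<^sup>2 - 1) (\<lambda>y. f y s - f y t) x r / (2 * r)"
      unfolding heat_dt_def r_def[symmetric] diff_divide_distrib[symmetric]
      by (simp add: gauss_avg_diff[OF gauss_weight_hermite2 f_cont_slice f_bound f_cont_slice f_bound])
    ultimately have "\<bar>?g s - ?k s\<bar> \<le> (H * sqrt r) * gauss_norm (\<lambda>z. z\<^sup>2 - 1) / r"
      using r H(1) by (auto simp: abs_divide intro!: frac_le)
    also have "\<dots> = H * gauss_norm (\<lambda>z. z\<^sup>2 - 1) * (sqrt r / r)" by simp
    also have "sqrt r / r = 1 / sqrt r" using r by (simp add: field_simps)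
    finally show "\<bar>?g s - ?k s\<bar> \<le> H * gauss_norm (\<lambda>z. z\<^sup>2 - 1) / sqrt (t - s)"
      by (simp add: r_def)
  qed (use d H(1) in auto)
  ultimately show ?thesis using eq k by simp
qed

text \<open>Since the averages are jointly continuous up to and including \<open>r = 0\<close>,
  where they equal the source, uniform continuity on a compact box gives the initial limit
  uniformly.\<close>

lemma heat_avg_uniform_initial:
  assumes "0 < \<epsilon>"
  obtains \<eta> where "0 < \<eta>"
    "\<And>x t r s. x \<in> {x1..x2} \<Longrightarrow> t \<in> {t1..t2} \<Longrightarrow> 0 \<le> r \<Longrightarrow> r < \<eta> \<Longrightarrow> \<bar>s - t\<bar> < \<eta> \<Longrightarrow>
       \<bar>heat_avg (\<lambda>y. f y s) x r - f x t\<bar> < \<epsilon>"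
proof -
  \<comment> \<open>The time range is widened by 1 to make room for the shifted times
    \<open>s\<close> with \<open>\<bar>s - t\<bar> < \<eta>\<close>.\<close>
  let ?K = "{x1..x2} \<times> {0..1::real} \<times> {t1-1..t2+1}"
  let ?F = "\<lambda>(x, r, s). heat_avg (\<lambda>y. f y s) x r"
  have "uniformly_continuous_on ?K ?F"
    by (intro compact_uniformly_continuous continuous_on_subset[OF source_avg_cont] compact_Times) auto
  then obtain \<delta> where \<delta>: "0 < \<delta>"
    and D: "\<And>p q. p \<in> ?K \<Longrightarrow> q \<in> ?K \<Longrightarrow> dist q p < \<delta> \<Longrightarrow> dist (?F q) (?F p) < \<epsilon>"
    using assms unfolding uniformly_continuous_on_def by metis
  show thesis
  proof (rule that[of "min 1 (\<delta> / 2)"])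
    show "0 < min 1 (\<delta> / 2)" using \<delta> by simp
    fix x t r s assume *: "x \<in> {x1..x2}" "t \<in> {t1..t2}" "0 \<le> r" "r < min 1 (\<delta> / 2)" "\<bar>s - t\<bar> < min 1 (\<delta> / 2)"
    have "dist (x, r, s) (x, 0, t) \<le> \<bar>r\<bar> + \<bar>s - t\<bar>"
      using sqrt_sum_squares_le_sum_abs[of r "s - t"] by (simp add: dist_Pair_Pair dist_real_def)
    also have "\<dots> < \<delta>" using * by auto
    finally have "dist (?F (x, r, s)) (?F (x, 0, t)) < \<epsilon>"
      by (intro D) (use * in \<open>auto simp: abs_less_iff\<close>)
    then show "\<bar>heat_avg (\<lambda>y. f y s) x r - f x t\<bar> < \<epsilon>" by (simp add: dist_real_def)
  qed
qed

text \<open>Only the derivatives of the cut-off integrals have to converge uniformly. The first is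
  Cauchy by integrability of its kernel, the second by the Hoelder bound in time, and the time
  derivative then converges because it is the second space derivative plus a boundary term tending
  to \<open>f\<close>.\<close>

theorem duhamel_classical:
  assumes t1: "0 < t1"
    and H: "\<And>y s t. t1 / 2 \<le> s \<Longrightarrow> s \<le> t \<Longrightarrow> t \<le> t2 \<Longrightarrow> \<bar>f y s - f y t\<bar> \<le> H * sqrt (t - s)"
  obtains X Z where
    "continuous_on ({x1<..<x2} \<times> {t1<..<t2}) (\<lambda>(x, t). Z x t)"
    "\<And>x t. x \<in> {x1<..<x2} \<Longrightarrow> t \<in> {t1<..<t2} \<Longrightarrow> ((\<lambda>x. duhamel f 0 x t) has_real_derivative X x t) (at x)"
    "\<And>x t. x \<in> {x1<..<x2} \<Longrightarrow> t \<in> {t1<..<t2} \<Longrightarrow> ((\<lambda>x. X x t) has_real_derivative Z x t) (at x)"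
    "\<And>x t. x \<in> {x1<..<x2} \<Longrightarrow> t \<in> {t1<..<t2} \<Longrightarrow> ((\<lambda>t. duhamel f 0 x t) has_real_derivative f x t + Z x t) (at t)"
proof -
  \<comment> \<open>The offset 2 makes every cutoff at most \<open>t1 / 2\<close>, so that for
    \<open>t > t1\<close> the times in \<open>{t - d n..t}\<close> stay in the range of the Hoelder
    hypothesis.\<close>
  define d where "d = (\<lambda>n::nat. t1 / (real n + 2))"
  have d_pos: "0 < d n" for n using t1 by (simp add: d_def)
  have d_le: "d n \<le> t1 / 2" for n
    unfolding d_def using t1 by (intro divide_left_mono) auto
  have d_less: "d n < t" if "t1 < t" for n t
    using d_le[of n] t1 that by linarith
  have d_mono: "d n \<le> d m" if "m \<le> n" for m n
    unfolding d_def using t1 that by (intro divide_left_mono) auto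
  have d_lim: "d \<longlonglongrightarrow> 0"
    unfolding d_def by real_asymp
  have sd_lim: "(\<lambda>n. C * sqrt (d n)) \<longlonglongrightarrow> 0" for C
    using tendsto_mult[OF tendsto_const tendsto_real_sqrt[OF d_lim], of C] by simp
  define H' where "H' = \<bar>H\<bar>"
  have H': "\<bar>f y s - f y t\<bar> \<le> H' * sqrt (t - s)" if "t1 / 2 \<le> s" "s \<le> t" "t \<le> t2" for y s t
    using order_trans[OF H[OF that, of y] mult_right_mono[of H H' "sqrt (t - s)"]] that by (simp add: H'_def)
  let ?A = "{x1<..<x2} \<times> {t1<..<t2}"
  have "uniformly_Cauchy_on ?A (\<lambda>n p. duhamel_dx f (d n) (fst p) (snd p))"
  proof (rule uniformly_Cauchy_onI')
    fix e :: real assume e: "0 < e"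
    obtain N where N: "\<And>n. N \<le> n \<Longrightarrow> 2 * (B * gauss_norm (\<lambda>z. z)) * sqrt (d n) < e"
      using order_tendstoD(2)[OF sd_lim e] unfolding eventually_sequentially by blast
    have "dist (duhamel_dx f (d m) (fst p) (snd p)) (duhamel_dx f (d n) (fst p) (snd p)) < e"
      if "p \<in> ?A" "N \<le> m" "m < n" for p m n
      using duhamel_dx_cutoff_diff[OF d_pos[of n] d_mono[of m n], of "snd p" "fst p"] that N[of m] d_le[of m] t1
      by (auto simp: dist_real_def abs_minus_commute)
    then show "\<exists>M. \<forall>p\<in>?A. \<forall>m\<ge>M. \<forall>n>m. dist (duhamel_dx f (d m) (fst p) (snd p)) (duhamel_dx f (d n) (fst p) (snd p)) < e"
      by blast
  qed
  then obtain X where X: "uniform_limit ?A (\<lambda>n p. duhamel_dx f (d n) (fst p) (snd p)) X sequentially"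
    using Cauchy_uniformly_convergent unfolding uniformly_convergent_on_def by blast
  have "uniformly_Cauchy_on ?A (\<lambda>n p. duhamel_dxx f (d n) (fst p) (snd p))"
  proof (rule uniformly_Cauchy_onI')
    fix e :: real assume e: "0 < e"
    then have e3: "0 < e / 3" by simp
    obtain N where N: "\<And>n. N \<le> n \<Longrightarrow> 2 * (H' * gauss_norm (\<lambda>z. z\<^sup>2 - 1)) * sqrt (d n) < e / 3"
      using order_tendstoD(2)[OF sd_lim e3] unfolding eventually_sequentially by blast
    obtain \<eta> where \<eta>: "0 < \<eta>" and I: "\<And>x t r s. x \<in> {x1..x2} \<Longrightarrow> t \<in> {t1..t2} \<Longrightarrow> 0 \<le> r \<Longrightarrow> r < \<eta> \<Longrightarrow> \<bar>s - t\<bar> < \<eta> \<Longrightarrow>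
       \<bar>heat_avg (\<lambda>y. f y s) x r - f x t\<bar> < e / 3"
      by (rule heat_avg_uniform_initial[OF e3, of x1 x2 t1 t2]) (rule that)
    obtain N' where N': "\<And>n. N' \<le> n \<Longrightarrow> d n < \<eta>"
      using order_tendstoD(2)[OF d_lim \<eta>] unfolding eventually_sequentially by blast
    have "dist (duhamel_dxx f (d m) (fst p) (snd p)) (duhamel_dxx f (d n) (fst p) (snd p)) < e"
      if p: "p \<in> ?A" and m: "max N N' \<le> m" "m < n" for p m n
    proof -
      obtain x t where xt: "p = (x, t)" "x1 < x" "x < x2" "t1 < t" "t < t2" using p by auto
      have "\<bar>duhamel_dxx f (d n) x t - duhamel_dxx f (d m) x t\<bar>
         \<le> 2 * (H' * gauss_norm (\<lambda>z. z\<^sup>2 - 1)) * sqrt (d m)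
           + \<bar>heat_avg (\<lambda>y. f y t) x (d m) - heat_avg (\<lambda>y. f y t) x (d n)\<bar>"
        using d_le[of m] xt t1 m
        by (intro duhamel_dxx_cutoff_diff d_pos d_mono H') (auto simp: H'_def)
      moreover have "\<bar>heat_avg (\<lambda>y. f y t) x (d m) - f x t\<bar> < e / 3" "\<bar>heat_avg (\<lambda>y. f y t) x (d n) - f x t\<bar> < e / 3"
        using I[of x t "d m" t] I[of x t "d n" t] xt N'[of m] N'[of n] m d_pos[of m] d_pos[of n] \<eta> by auto
      ultimately have "\<bar>duhamel_dxx f (d m) x t - duhamel_dxx f (d n) x t\<bar> < e" using N[of m] m by linarith
      then show ?thesis by (simp add: xt dist_real_def)
    qed
    then show "\<exists>M. \<forall>p\<in>?A. \<forall>m\<ge>M. \<forall>n>m. dist (duhamel_dxx f (d m) (fst p) (snd p)) (duhamel_dxx f (d n) (fst p) (snd p)) < e"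
      by blast
  qed
  then obtain Z where Z: "uniform_limit ?A (\<lambda>n p. duhamel_dxx f (d n) (fst p) (snd p)) Z sequentially"
    using Cauchy_uniformly_convergent unfolding uniformly_convergent_on_def by blast
  have D_lim: "(\<lambda>n. duhamel f (d n) x t) \<longlonglongrightarrow> duhamel f 0 x t" if "t1 < t" for x t
  proof (rule LIM_zero_cancel, rule Lim_null_comparison)
    have "norm (duhamel f (d n) x t - duhamel f 0 x t) \<le> B * d n" for n
      using duhamel_cutoff_error[of "d n" t x] d_pos[of n] d_less[OF that, of n]
      by (simp add: abs_minus_commute)
    then show "\<forall>\<^sub>F n in sequentially. norm (duhamel f (d n) x t - duhamel f 0 x t) \<le> B * d n"
      by (intro always_eventually allI)
    show "(\<lambda>n. B * d n) \<longlonglongrightarrow> 0" using tendsto_mult[OF tendsto_const d_lim, of B] by simp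
  qed
  have slice_x: "uniform_limit {x1<..<x2} (\<lambda>n x. G n (x, t)) (\<lambda>x. L (x, t)) sequentially"
    if "uniform_limit ?A G L sequentially" "t \<in> {t1<..<t2}" for G :: "nat \<Rightarrow> real \<times> real \<Rightarrow> real" and L t
    using uniform_limit_compose'[OF that(1), of "\<lambda>x. (x, t)" "{x1<..<x2}"] that(2) by auto
  have slice_t: "uniform_limit {t1<..<t2} (\<lambda>n t. G n (x, t)) (\<lambda>t. L (x, t)) sequentially"
    if "uniform_limit ?A G L sequentially" "x \<in> {x1<..<x2}" for G :: "nat \<Rightarrow> real \<times> real \<Rightarrow> real" and L x
    using uniform_limit_compose'[OF that(1), of "\<lambda>t. (x, t)" "{t1<..<t2}"] that(2) by auto
  show thesis
  proof (rule that[of "\<lambda>x t. Z (x, t)" "\<lambda>x t. X (x, t)"])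
    have "continuous_on ?A Z"
    proof (rule uniform_limit_theorem[OF _ Z])
      have "continuous_on ?A (\<lambda>p. duhamel_dxx f (d n) (fst p) (snd p))" for n
      proof -
        have "?A \<subseteq> UNIV \<times> {d n..}" using d_less[of _ n] by (auto intro: less_imp_le)
        from continuous_on_subset[OF duhamel_dxx_cont[OF d_pos] this] show ?thesis
          by (simp add: case_prod_unfold)
      qed
      then show "\<forall>\<^sub>F n in sequentially. continuous_on ?A (\<lambda>p. duhamel_dxx f (d n) (fst p) (snd p))"
        by simp
    qed simp
    then show "continuous_on ?A (\<lambda>(x, t). Z (x, t))" by simp
  next
    fix x t assume x: "x \<in> {x1<..<x2}" and t: "t \<in> {t1<..<t2}"
    show "((\<lambda>x. duhamel f 0 x t) has_real_derivative X (x, t)) (at x)"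
      using slice_x[OF X t] t D_lim[of t]
      by (intro has_real_derivative_uniform_limit[OF _ _ x duhamel_deriv_space[OF d_pos]]) auto
    show "((\<lambda>x. X (x, t)) has_real_derivative Z (x, t)) (at x)"
      using slice_x[OF Z t] tendsto_uniform_limitI[OF slice_x[OF X t]]
      by (intro has_real_derivative_uniform_limit[OF _ _ x duhamel_dx_deriv_space[OF d_pos]]) auto
    \<comment> \<open>The boundary term averages over time \<open>d n\<close> a source taken at the
      shifted time \<open>t - d n\<close>; the uniform initial limit was stated with a separate
      \<open>s\<close> to cover this shift.\<close>
    have "uniform_limit {t1<..<t2} (\<lambda>n t. heat_avg (\<lambda>y. f y (t - d n)) x (d n)) (\<lambda>t. f x t) sequentially"
    proof (rule uniform_limitI)
      fix e :: real assume e: "0 < e"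
      obtain \<eta> where \<eta>: "0 < \<eta>" and I: "\<And>x t r s. x \<in> {x1..x2} \<Longrightarrow> t \<in> {t1..t2} \<Longrightarrow> 0 \<le> r \<Longrightarrow> r < \<eta> \<Longrightarrow> \<bar>s - t\<bar> < \<eta> \<Longrightarrow>
         \<bar>heat_avg (\<lambda>y. f y s) x r - f x t\<bar> < e"
        by (rule heat_avg_uniform_initial[OF e, of x1 x2 t1 t2]) (rule that)
      have "\<forall>\<^sub>F n in sequentially. d n < \<eta>" using order_tendstoD(2)[OF d_lim \<eta>] .
      then show "\<forall>\<^sub>F n in sequentially. \<forall>t\<in>{t1<..<t2}. dist (heat_avg (\<lambda>y. f y (t - d n)) x (d n)) (f x t) < e"
      proof eventually_elim
        case (elim n)
        show ?case
        proof
          fix t assume "t \<in> {t1<..<t2}"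
          then show "dist (heat_avg (\<lambda>y. f y (t - d n)) x (d n)) (f x t) < e"
            using I[of x t "d n" "t - d n"] x elim d_pos[of n] by (auto simp: dist_real_def)
        qed
      qed
    qed
    from uniform_limit_add[OF this slice_t[OF Z x]]
    have "uniform_limit {t1<..<t2} (\<lambda>n t. heat_avg (\<lambda>y. f y (t - d n)) x (d n) + duhamel_dxx f (d n) x t)
        (\<lambda>t. f x t + Z (x, t)) sequentially" by simp
    then show "((\<lambda>t. duhamel f 0 x t) has_real_derivative f x t + Z (x, t)) (at t)"
    proof (rule has_real_derivative_uniform_limit[OF _ _ t, rotated 3])
      fix n t' assume "t' \<in> {t1<..<t2}"
      then show "((\<lambda>t. duhamel f (d n) x t) has_real_derivative
          heat_avg (\<lambda>y. f y (t' - d n)) x (d n) + duhamel_dxx f (d n) x t') (at t')"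
        "(\<lambda>n. duhamel f (d n) x t') \<longlonglongrightarrow> duhamel f 0 x t'"
        by (auto intro!: duhamel_deriv_time d_pos d_less D_lim)
    qed auto
  qed
qed

end

section \<open>Semilinear heat equations on the line\<close>

lemma gauss_avg_reflect:
  "heat_avg (\<lambda>y. - h (2 * c - y)) x r = - heat_avg h (2 * c - x) r"
proof -
  have "(\<integral>z. std_normal_density z * h ((2 * c - x) + sqrt (2 * r) * z) \<partial>lborel)
      = (\<integral>z. std_normal_density z * h (2 * c - (x + sqrt (2 * r) * z)) \<partial>lborel)"
    by (subst lborel_integral_real_affine[where c="-1" and t=0])
       (simp_all add: std_normal_density_def algebra_simps)
  then show ?thesis by (simp add: gauss_avg_def)
qed

lemma duhamel_reflect:
  assumes "\<And>y s. g y s = - f (2 * c - y) s"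
  shows "duhamel g 0 x t = - duhamel f 0 (2 * c - x) t"
proof -
  have "heat_avg (\<lambda>y. g y s) x r = - heat_avg (\<lambda>y. f y s) (2 * c - x) r" for s r
    using gauss_avg_reflect[of "\<lambda>y. f y s" c x r] by (simp add: assms)
  then show ?thesis by (simp add: duhamel_def)
qed

lemma duhamel_bound:
  assumes "bounded_source f B" "0 \<le> t"
  shows "\<bar>duhamel f 0 x t\<bar> \<le> B * t"
proof -
  interpret bounded_source f B by fact
  let ?g = "\<lambda>s. heat_avg (\<lambda>y. f y s) x (t - s)"
  have "continuous_on {0..t} ?g" by (intro source_avg_compose gauss_weight_1 continuous_intros)
  from integral_bound[OF assms(2) this, of B] show ?thesis
    using gauss_avg_bound[OF gauss_weight_1 f_cont_slice f_bound] by (simp add: duhamel_def)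
qed

text \<open>Integrating a weight that grows like \<open>exp (k * s)\<close> reproduces the weight
  and gains \<open>1 / k\<close>; the choice of \<open>k\<close> then beats any Lipschitz
  constant.\<close>

lemma duhamel_diff_bound:
  assumes f: "bounded_source f B" and g: "bounded_source g B'"
    and k: "0 < k" and t: "0 \<le> t" and D: "0 \<le> D"
    and le: "\<And>y s. 0 \<le> s \<Longrightarrow> s \<le> t \<Longrightarrow> \<bar>f y s - g y s\<bar> \<le> D * exp (k * s)"
  shows "\<bar>duhamel f 0 x t - duhamel g 0 x t\<bar> \<le> D / k * exp (k * t)"
proof -
  interpret f: bounded_source f B by fact
  interpret g: bounded_source g B' by fact
  let ?F = "\<lambda>s. heat_avg (\<lambda>y. f y s) x (t - s)" and ?G = "\<lambda>s. heat_avg (\<lambda>y. g y s) x (t - s)"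
  have F: "?F integrable_on {0..t}"
    by (intro integrable_continuous_interval f.source_avg_compose gauss_weight_1 continuous_intros)
  have G: "?G integrable_on {0..t}"
    by (intro integrable_continuous_interval g.source_avg_compose gauss_weight_1 continuous_intros)
  have E: "((\<lambda>s. D * exp (k * s)) has_integral D / k * exp (k * t) - D / k * exp (k * 0)) {0..t}"
  proof (rule fundamental_theorem_of_calculus[OF t])
    fix s
    have "((\<lambda>s. D / k * exp (k * s)) has_real_derivative D * exp (k * s)) (at s within {0..t})"
      using k by (auto intro!: derivative_eq_intros)
    then show "((\<lambda>s. D / k * exp (k * s)) has_vector_derivative D * exp (k * s)) (at s within {0..t})"
      by (simp add: has_real_derivative_iff_has_vector_derivative)
  qed
  have "duhamel f 0 x t - duhamel g 0 x t = integral {0..t} (\<lambda>s. ?F s - ?G s)"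
    using Henstock_Kurzweil_Integration.integral_diff[OF F G] by (simp add: duhamel_def)
  also have "norm \<dots> \<le> integral {0..t} (\<lambda>s. D * exp (k * s))"
  proof (rule integral_norm_bound_integral)
    show "(\<lambda>s. ?F s - ?G s) integrable_on {0..t}"
      using F G by (rule Henstock_Kurzweil_Integration.integrable_diff)
    show "(\<lambda>s. D * exp (k * s)) integrable_on {0..t}" using E by (auto simp: integrable_on_def)
    fix s assume s: "s \<in> {0..t}"
    have "?F s - ?G s = heat_avg (\<lambda>y. f y s - g y s) x (t - s)"
      by (rule gauss_avg_diff[OF gauss_weight_1 f.f_cont_slice f.f_bound g.f_cont_slice g.f_bound])
    also have "\<bar>\<dots>\<bar> \<le> D * exp (k * s) * gauss_norm (\<lambda>z. 1)"
      using s le by (intro gauss_avg_bound gauss_weight_1 continuous_on_diff f.f_cont_slice g.f_cont_slice) auto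
    finally show "norm (?F s - ?G s) \<le> D * exp (k * s)" by simp
  qed
  also have "\<dots> \<le> D / k * exp (k * t)"
    unfolding integral_unique[OF E] using k D by simp
  finally show ?thesis by simp
qed

locale semilinear_line =
  fixes F :: "real \<Rightarrow> real \<Rightarrow> real" and U0 :: "real \<Rightarrow> real" and L M T :: real
  assumes F_cont: "continuous_on UNIV (\<lambda>(x, u). F x u)"
    and F_lip: "\<And>x u v. \<bar>F x u - F x v\<bar> \<le> L * \<bar>u - v\<bar>"
    and F_0: "\<And>x. F x 0 = 0"
    and L_pos: "0 < L"
    and U0_cont: "continuous_on UNIV U0"
    and U0_bound: "\<And>x. \<bar>U0 x\<bar> \<le> M"
    and T_pos: "0 < T"
begin

text \<open>Times are clamped to the interval from \<open>0\<close> to \<open>T\<close>, so that the Picard map acts on bounded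
  continuous functions on the whole plane; the factor \<open>exp (- 2 * L * t)\<close> makes it a contraction.\<close>

definition clampT :: "real \<Rightarrow> real" where "clampT t = min T (max 0 t)"

text \<open>The unknown \<open>w\<close> is the solution multiplied by
  \<open>exp (- 2 * L * t)\<close>. In this form the weighted norm is the plain norm of bounded
  continuous functions, and the exponential inside \<open>F\<close> undoes the weight.\<close>

definition src :: "((real \<times> real) \<Rightarrow>\<^sub>C real) \<Rightarrow> real \<Rightarrow> real \<Rightarrow> real" where
  "src w y s = F y (exp (2 * L * clampT s) * w (y, s))"

definition picard_fun :: "((real \<times> real) \<Rightarrow>\<^sub>C real) \<Rightarrow> real \<times> real \<Rightarrow> real" where
  "picard_fun w = (\<lambda>(x, t). exp (- 2 * L * clampT t) *
      (heat_avg U0 x (clampT t) + duhamel (src w) 0 x (clampT t)))"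

definition picard :: "((real \<times> real) \<Rightarrow>\<^sub>C real) \<Rightarrow> ((real \<times> real) \<Rightarrow>\<^sub>C real)" where
  "picard w = Bcontfun (picard_fun w)"

lemma clampT_bounds: "0 \<le> clampT t" "clampT t \<le> T"
  using T_pos by (auto simp: clampT_def)

lemma clampT_id [simp]: "0 \<le> t \<Longrightarrow> t \<le> T \<Longrightarrow> clampT t = t"
  by (simp add: clampT_def)

lemma clampT_cont [continuous_intros]: "continuous_on A g \<Longrightarrow> continuous_on A (\<lambda>p. clampT (g p))"
  unfolding clampT_def by (intro continuous_intros)

sublocale init: bounded_source "\<lambda>y s. U0 y" M
proof
  show "continuous_on UNIV (\<lambda>(y, s::real). U0 y)"
    unfolding case_prod_unfold by (intro continuous_on_compose2[OF U0_cont] continuous_intros) auto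
qed (rule U0_bound)

lemma F_bound: "\<bar>F x u\<bar> \<le> L * \<bar>u\<bar>"
  using F_lip[of x u 0] by (simp add: F_0)

lemma src_bounded: "bounded_source (src w) (L * (exp (2 * L * T) * norm w))"
proof
  have "continuous_on UNIV (\<lambda>p. (fst p, exp (2 * L * clampT (snd p)) * apply_bcontfun w p))"
    by (intro continuous_intros) auto
  from continuous_on_compose2[OF F_cont this]
  show "continuous_on UNIV (\<lambda>(y, s). src w y s)"
    by (simp add: src_def case_prod_unfold)
next
  fix y s
  have "\<bar>src w y s\<bar> \<le> L * \<bar>exp (2 * L * clampT s) * w (y, s)\<bar>"
    unfolding src_def by (rule F_bound)
  also have "\<dots> \<le> L * (exp (2 * L * T) * norm w)"
    using clampT_bounds[of s] L_pos norm_bounded[of w "(y, s)"]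
    by (intro mult_left_mono) (auto simp: abs_mult intro!: mult_mono)
  finally show "\<bar>src w y s\<bar> \<le> L * (exp (2 * L * T) * norm w)" .
qed

lemma picard_fun_bcontfun: "picard_fun w \<in> bcontfun"
proof (rule bcontfun_normI)
  interpret src: bounded_source "src w" "L * (exp (2 * L * T) * norm w)" by (rule src_bounded)
  have "continuous_on UNIV (\<lambda>p. (fst p, clampT (snd p)))"
    by (intro continuous_intros)
  from continuous_on_compose2[OF src.duhamel_cont this]
  have "continuous_on UNIV (\<lambda>p. duhamel (src w) 0 (fst p) (clampT (snd p)))"
    using clampT_bounds(1) by (auto simp: image_subset_iff)
  then show "continuous_on UNIV (picard_fun w)"
    unfolding picard_fun_def case_prod_unfold
    by (intro continuous_intros init.source_avg_compose gauss_weight_1)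
  fix p :: "real \<times> real"
  obtain x t where p: "p = (x, t)" by (cases p)
  let ?B = "L * (exp (2 * L * T) * norm w)"
  have "\<bar>heat_avg U0 x (clampT t) + duhamel (src w) 0 x (clampT t)\<bar> \<le> M + ?B * T"
  proof -
    have "\<bar>heat_avg U0 x (clampT t)\<bar> \<le> M"
      using gauss_avg_bound[OF gauss_weight_1 U0_cont U0_bound] by simp
    moreover have "\<bar>duhamel (src w) 0 x (clampT t)\<bar> \<le> ?B * clampT t"
      by (rule duhamel_bound[OF src_bounded clampT_bounds(1)])
    moreover have "?B * clampT t \<le> ?B * T"
      using clampT_bounds[of t] L_pos by (intro mult_left_mono) auto
    ultimately show ?thesis by linarith
  qed
  moreover have "exp (- 2 * L * clampT t) \<le> 1"
    using clampT_bounds[of t] L_pos by simp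
  ultimately have "exp (- 2 * L * clampT t) * \<bar>heat_avg U0 x (clampT t) + duhamel (src w) 0 x (clampT t)\<bar>
      \<le> 1 * (M + ?B * T)" by (intro mult_mono) auto
  then show "norm (picard_fun w p) \<le> M + ?B * T"
    by (simp add: p picard_fun_def abs_mult)
qed

lemma picard_apply: "apply_bcontfun (picard w) = picard_fun w"
  unfolding picard_def by (rule Bcontfun_inverse[OF picard_fun_bcontfun])

text \<open>The Lipschitz constant contributes \<open>L\<close> and the weight
  \<open>1 / (2 * L)\<close>. The resulting factor one half does not depend on \<open>T\<close>, so
  a single fixed point covers the whole time interval.\<close>

lemma picard_contraction: "dist (picard v) (picard w) \<le> 1 / 2 * dist v w"
proof (rule dist_bound)
  fix p :: "real \<times> real"
  obtain x t where p: "p = (x, t)" by (cases p)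
  let ?t = "clampT t"
  have "\<bar>duhamel (src v) 0 x ?t - duhamel (src w) 0 x ?t\<bar> \<le> (L * dist v w) / (2 * L) * exp (2 * L * ?t)"
  proof (rule duhamel_diff_bound[OF src_bounded src_bounded])
    fix y s assume s: "0 \<le> s" "s \<le> ?t"
    then have c: "clampT s = s" using clampT_bounds(2)[of t] by simp
    have "\<bar>src v y s - src w y s\<bar> \<le> L * \<bar>exp (2 * L * s) * v (y, s) - exp (2 * L * s) * w (y, s)\<bar>"
      unfolding src_def c by (rule F_lip)
    also have "\<dots> = L * (exp (2 * L * s) * dist (v (y, s)) (w (y, s)))"
      by (simp add: dist_real_def right_diff_distrib[symmetric] abs_mult)
    also have "\<dots> \<le> L * (exp (2 * L * s) * dist v w)"
      using L_pos by (intro mult_left_mono dist_bounded) auto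
    finally show "\<bar>src v y s - src w y s\<bar> \<le> L * dist v w * exp (2 * L * s)" by (simp add: mult_ac)
  qed (use L_pos clampT_bounds in auto)
  then have "exp (- 2 * L * ?t) * \<bar>duhamel (src v) 0 x ?t - duhamel (src w) 0 x ?t\<bar>
      \<le> exp (- 2 * L * ?t) * (dist v w / 2 * exp (2 * L * ?t))"
    using L_pos by (intro mult_left_mono) auto
  also have "\<dots> = (exp (- 2 * L * ?t) * exp (2 * L * ?t)) * (dist v w / 2)" by simp
  also have "exp (- 2 * L * ?t) * exp (2 * L * ?t) = 1" by (simp add: exp_add[symmetric])
  finally have "exp (- 2 * L * ?t) * \<bar>duhamel (src v) 0 x ?t - duhamel (src w) 0 x ?t\<bar> \<le> 1 / 2 * dist v w"
    by simp
  moreover have "dist (picard v p) (picard w p)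
     = exp (- 2 * L * ?t) * \<bar>duhamel (src v) 0 x ?t - duhamel (src w) 0 x ?t\<bar>"
  proof -
    have "picard v p - picard w p = exp (- 2 * L * ?t) * (duhamel (src v) 0 x ?t - duhamel (src w) 0 x ?t)"
      by (simp add: picard_apply picard_fun_def p algebra_simps)
    then show ?thesis by (simp only: dist_real_def abs_mult abs_exp_cancel)
  qed
  ultimately show "dist (picard v p) (picard w p) \<le> 1 / 2 * dist v w" by simp
qed

lemma picard_fixpoint: "\<exists>!w. picard w = w"
  by (rule banach_fix_type[of "1/2"]) (use picard_contraction in auto)

definition fixpoint where "fixpoint = (THE w. picard w = w)"

lemma picard_fixpoint_eq: "picard fixpoint = fixpoint"
  unfolding fixpoint_def by (rule theI'[OF picard_fixpoint])

definition sol :: "real \<Rightarrow> real \<Rightarrow> real" where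
  "sol x t = exp (2 * L * clampT t) * fixpoint (x, t)"

definition rhs :: "real \<Rightarrow> real \<Rightarrow> real" where "rhs y s = F y (sol y s)"

lemma rhs_eq: "rhs = src fixpoint"
  by (simp add: fun_eq_iff rhs_def src_def sol_def)

sublocale rhs: bounded_source rhs "L * (exp (2 * L * T) * norm fixpoint)"
  unfolding rhs_eq by (rule src_bounded)

lemma sol_mild: "0 \<le> t \<Longrightarrow> t \<le> T \<Longrightarrow> sol x t = heat_avg U0 x t + duhamel rhs 0 x t"
proof -
  assume t: "0 \<le> t" "t \<le> T"
  have "fixpoint (x, t) = picard_fun fixpoint (x, t)"
    by (metis picard_apply picard_fixpoint_eq)
  then have "sol x t = (exp (2 * L * t) * exp (- 2 * L * t)) * (heat_avg U0 x t + duhamel rhs 0 x t)"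
    using t by (simp add: sol_def picard_fun_def rhs_eq mult.assoc)
  also have "exp (2 * L * t) * exp (- 2 * L * t) = 1" by (simp add: exp_add[symmetric])
  finally show ?thesis by simp
qed

lemma sol_init: "sol x 0 = U0 x"
  using sol_mild[of 0 x] T_pos by (simp add: duhamel_def)

lemma sol_cont: "continuous_on UNIV (\<lambda>(x, t). sol x t)"
  unfolding sol_def case_prod_unfold by (intro continuous_intros) auto

text \<open>Reflecting the fixed point about \<open>c\<close> and changing its sign gives a fixed
  point again. Uniqueness makes the solution odd about \<open>c\<close>, hence zero there.\<close>

lemma sol_reflect:
  assumes F: "\<And>x u. F (2 * c - x) (- u) = - F x u" and U: "\<And>x. U0 (2 * c - x) = - U0 x"
  shows "sol c t = 0"
proof -
  define v where "v = Bcontfun (\<lambda>p. - apply_bcontfun fixpoint (2 * c - fst p, snd p))"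
  have "continuous_on UNIV (\<lambda>p. (2 * c - fst p, snd p) :: real \<times> real)"
    by (intro continuous_intros)
  from continuous_on_compose2[OF continuous_on_apply_bcontfun[of UNIV fixpoint] this]
  have "(\<lambda>p. - apply_bcontfun fixpoint (2 * c - fst p, snd p)) \<in> bcontfun"
    by (intro bcontfun_normI[of _ "norm fixpoint"] continuous_on_minus) (auto simp: norm_bounded[of fixpoint, simplified])
  then have v: "v p = - fixpoint (2 * c - fst p, snd p)" for p
    unfolding v_def by (simp add: Bcontfun_inverse)
  have src: "src v y s = - src fixpoint (2 * c - y) s" for y s
    using F[of "2 * c - y" "exp (2 * L * clampT s) * fixpoint (2 * c - y, s)"] by (simp add: src_def v)
  have U': "U0 = (\<lambda>y. - U0 (2 * c - y))" using U by auto
  have "picard v = v"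
  proof (rule bcontfun_eqI)
    fix p :: "real \<times> real"
    obtain x t where p: "p = (x, t)" by (cases p)
    have "picard v p = exp (- 2 * L * clampT t) * (heat_avg U0 x (clampT t) + duhamel (src v) 0 x (clampT t))"
      by (simp add: picard_apply picard_fun_def p)
    also have "heat_avg U0 x (clampT t) = - heat_avg U0 (2 * c - x) (clampT t)"
      by (subst U') (rule gauss_avg_reflect)
    also have "duhamel (src v) 0 x (clampT t) = - duhamel (src fixpoint) 0 (2 * c - x) (clampT t)"
      by (rule duhamel_reflect[where g="src v" and f="src fixpoint" and c=c]) (rule src)
    finally have "picard v p = - picard fixpoint (2 * c - x, t)"
      by (simp add: picard_apply picard_fun_def algebra_simps)
    then show "picard v p = v p" by (simp add: picard_fixpoint_eq v p)
  qed
  then have "v = fixpoint" using picard_fixpoint picard_fixpoint_eq by blast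
  then have "fixpoint (c, t) = - fixpoint (c, t)" using v[of "(c, t)"] by simp
  then show ?thesis by (simp add: sol_def)
qed

text \<open>Both values are taken at the same point \<open>y\<close>, so only the Lipschitz bound of
  \<open>F\<close> in the unknown enters and no modulus of continuity of the coefficient in space.
  The evolution of merely continuous initial data is Hoelder only away from time zero, which is why
  the constant depends on \<open>t1\<close>.\<close>

lemma rhs_holder:
  assumes "0 < t1"
  obtains H where "\<And>y s t. t1 / 2 \<le> s \<Longrightarrow> s \<le> t \<Longrightarrow> t \<le> T \<Longrightarrow> \<bar>rhs y s - rhs y t\<bar> \<le> H * sqrt (t - s)"
proof -
  define K where "K = (2 + gauss_norm (\<lambda>z. z\<^sup>2 - 1)) * M"
  have K: "0 \<le> K" using init.B_nonneg by (simp add: K_def)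
  define C where "C = (2 * (2 + gauss_norm (\<lambda>z. z\<^sup>2 - 1)) + 1) * (L * (exp (2 * L * T) * norm fixpoint)) * sqrt T"
  show thesis
  proof (rule that[of "L * (K / sqrt (t1 / 2) + C)"])
    fix y s t assume st: "t1 / 2 \<le> s" "s \<le> t" "t \<le> T"
    have s: "0 < s" using st assms by linarith
    have "\<bar>heat_avg U0 y t - heat_avg U0 y s\<bar> \<le> K * sqrt ((t - s) / s)"
      unfolding K_def by (rule heat_avg_time_holder[OF U0_cont U0_bound s st(2)])
    also have "\<dots> \<le> K * (sqrt (t - s) / sqrt (t1 / 2))"
      unfolding real_sqrt_divide[of "t - s"] using st assms s K
      by (intro mult_left_mono divide_left_mono real_sqrt_le_mono mult_pos_pos) auto
    finally have 1: "\<bar>heat_avg U0 y t - heat_avg U0 y s\<bar> \<le> K / sqrt (t1 / 2) * sqrt (t - s)" by simp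
    have 2: "\<bar>duhamel rhs 0 y t - duhamel rhs 0 y s\<bar> \<le> C * sqrt (t - s)"
      unfolding C_def by (rule rhs.duhamel_time_holder) (use st s in auto)
    have "\<bar>rhs y s - rhs y t\<bar> \<le> L * \<bar>sol y s - sol y t\<bar>"
      unfolding rhs_def by (rule F_lip)
    also have "\<dots> \<le> L * (K / sqrt (t1 / 2) * sqrt (t - s) + C * sqrt (t - s))"
      using 1 2 L_pos sol_mild[of s y] sol_mild[of t y] st s by (intro mult_left_mono) auto
    finally show "\<bar>rhs y s - rhs y t\<bar> \<le> L * (K / sqrt (t1 / 2) + C) * sqrt (t - s)"
      by (simp add: algebra_simps)
  qed
qed

lemma sol_classical_local:
  assumes t1: "0 < t1"
  obtains X Z where
    "continuous_on ({x1<..<x2} \<times> {t1<..<T}) (\<lambda>(x, t). Z x t)"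
    "\<And>x t. x \<in> {x1<..<x2} \<Longrightarrow> t \<in> {t1<..<T} \<Longrightarrow> ((\<lambda>x. sol x t) has_real_derivative X x t) (at x)"
    "\<And>x t. x \<in> {x1<..<x2} \<Longrightarrow> t \<in> {t1<..<T} \<Longrightarrow> ((\<lambda>x. X x t) has_real_derivative Z x t) (at x)"
    "\<And>x t. x \<in> {x1<..<x2} \<Longrightarrow> t \<in> {t1<..<T} \<Longrightarrow> ((\<lambda>t. sol x t) has_real_derivative Z x t + rhs x t) (at t)"
proof -
  obtain H where H: "\<And>y s t. t1 / 2 \<le> s \<Longrightarrow> s \<le> t \<Longrightarrow> t \<le> T \<Longrightarrow> \<bar>rhs y s - rhs y t\<bar> \<le> H * sqrt (t - s)"
    by (rule rhs_holder[OF t1]) (rule that)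
  obtain X Z where
    Z: "continuous_on ({x1<..<x2} \<times> {t1<..<T}) (\<lambda>(x, t). Z x t)" and
    dx: "\<And>x t. x \<in> {x1<..<x2} \<Longrightarrow> t \<in> {t1<..<T} \<Longrightarrow> ((\<lambda>x. duhamel rhs 0 x t) has_real_derivative X x t) (at x)" and
    dxx: "\<And>x t. x \<in> {x1<..<x2} \<Longrightarrow> t \<in> {t1<..<T} \<Longrightarrow> ((\<lambda>x. X x t) has_real_derivative Z x t) (at x)" and
    dt: "\<And>x t. x \<in> {x1<..<x2} \<Longrightarrow> t \<in> {t1<..<T} \<Longrightarrow> ((\<lambda>t. duhamel rhs 0 x t) has_real_derivative rhs x t + Z x t) (at t)"
    by (rule rhs.duhamel_classical[where ?t1.0=t1 and ?t2.0=T and ?x1.0=x1 and ?x2.0=x2 and H=H, OF t1]) (erule (2) H, rule that)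
  show thesis
  proof (rule that[of "\<lambda>x t. heat_dt U0 x t + Z x t" "\<lambda>x t. heat_dx U0 x t + X x t"])
    have "continuous_on ({x1<..<x2} \<times> {t1<..<T}) (\<lambda>p. heat_dt U0 (fst p) (snd p))"
      using t1 by (intro init.source_dt_compose continuous_intros) auto
    with Z show "continuous_on ({x1<..<x2} \<times> {t1<..<T}) (\<lambda>(x, t). heat_dt U0 x t + Z x t)"
      unfolding case_prod_unfold by (intro continuous_on_add)
    fix x t assume x: "x \<in> {x1<..<x2}" and t: "t \<in> {t1<..<T}"
    have t0: "0 < t" "t \<le> T" using t t1 by auto
    have "((\<lambda>x. heat_avg U0 x t + duhamel rhs 0 x t) has_real_derivative heat_dx U0 x t + X x t) (at x)"
      by (intro DERIV_add heat_avg_deriv_space[OF U0_cont U0_bound] t0 dx x t)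
    then show "((\<lambda>x. sol x t) has_real_derivative heat_dx U0 x t + X x t) (at x)"
      using sol_mild[of t] t0 by simp
    show "((\<lambda>x. heat_dx U0 x t + X x t) has_real_derivative heat_dt U0 x t + Z x t) (at x)"
      by (intro DERIV_add heat_dx_deriv_space[OF U0_cont U0_bound] t0 dxx x t)
    have "((\<lambda>t. heat_avg U0 x t + duhamel rhs 0 x t) has_real_derivative heat_dt U0 x t + (rhs x t + Z x t)) (at t)"
      by (intro DERIV_add heat_avg_deriv_time[OF U0_cont U0_bound] t0 dt x t)
    then have "((\<lambda>t. sol x t) has_real_derivative heat_dt U0 x t + (rhs x t + Z x t)) (at t)"
      by (rule has_field_derivative_transform_within_open[where S="{t1<..<T}"])
         (use t t1 sol_mild in auto)
    then show "((\<lambda>t. sol x t) has_real_derivative heat_dt U0 x t + Z x t + rhs x t) (at t)"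
      by (simp add: algebra_simps)
  qed
qed

text \<open>The local result yields derivatives separately for each rectangle. Naming them by
  \<open>deriv\<close> makes them independent of the rectangle, and continuity is a local
  property.\<close>

theorem sol_classical:
  obtains ut ux uxx where
    "continuous_on (UNIV \<times> {0<..<T}) (\<lambda>(x, t). ut x t)"
    "continuous_on (UNIV \<times> {0<..<T}) (\<lambda>(x, t). uxx x t)"
    "\<And>x t. t \<in> {0<..<T} \<Longrightarrow> ((\<lambda>s. sol x s) has_real_derivative ut x t) (at t)"
    "\<And>x t. t \<in> {0<..<T} \<Longrightarrow> ((\<lambda>y. sol y t) has_real_derivative ux x t) (at x)"
    "\<And>x t. t \<in> {0<..<T} \<Longrightarrow> ((\<lambda>y. ux y t) has_real_derivative uxx x t) (at x)"
    "\<And>x t. t \<in> {0<..<T} \<Longrightarrow> ut x t - uxx x t = F x (sol x t)"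
proof -
  define ux where "ux = (\<lambda>x t. deriv (\<lambda>y. sol y t) x)"
  define uxx where "uxx = (\<lambda>x t. deriv (\<lambda>y. ux y t) x)"
  have main: "((\<lambda>y. sol y t) has_real_derivative ux x t) (at x) \<and>
      ((\<lambda>y. ux y t) has_real_derivative uxx x t) (at x) \<and>
      ((\<lambda>s. sol x s) has_real_derivative uxx x t + rhs x t) (at t) \<and>
      isCont (\<lambda>(x, t). uxx x t) (x, t)" if t: "t \<in> {0<..<T}" for x t
  proof -
    have t1: "0 < t / 2" using t by auto
    obtain X Z where
      Z: "continuous_on ({x-1<..<x+1} \<times> {t/2<..<T}) (\<lambda>(x, t). Z x t)" and
      dx: "\<And>x' t'. x' \<in> {x-1<..<x+1} \<Longrightarrow> t' \<in> {t/2<..<T} \<Longrightarrow> ((\<lambda>x. sol x t') has_real_derivative X x' t') (at x')" and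
      dxx: "\<And>x' t'. x' \<in> {x-1<..<x+1} \<Longrightarrow> t' \<in> {t/2<..<T} \<Longrightarrow> ((\<lambda>x. X x t') has_real_derivative Z x' t') (at x')" and
      dt: "\<And>x' t'. x' \<in> {x-1<..<x+1} \<Longrightarrow> t' \<in> {t/2<..<T} \<Longrightarrow> ((\<lambda>t. sol x' t) has_real_derivative Z x' t' + rhs x' t') (at t')"
      by (rule sol_classical_local[OF t1, of "x - 1" "x + 1"]) (rule that)
    have X: "ux x' t' = X x' t'" if "x' \<in> {x-1<..<x+1}" "t' \<in> {t/2<..<T}" for x' t'
      unfolding ux_def by (rule DERIV_imp_deriv[OF dx[OF that]])
    have ux': "((\<lambda>y. ux y t') has_real_derivative Z x' t') (at x')"
      if "x' \<in> {x-1<..<x+1}" "t' \<in> {t/2<..<T}" for x' t'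
      by (rule has_field_derivative_transform_within_open[OF dxx[OF that], where S="{x-1<..<x+1}"])
         (use that X in auto)
    have Z': "uxx x' t' = Z x' t'" if "x' \<in> {x-1<..<x+1}" "t' \<in> {t/2<..<T}" for x' t'
      unfolding uxx_def by (rule DERIV_imp_deriv[OF ux'[OF that]])
    have x: "x \<in> {x-1<..<x+1}" and t': "t \<in> {t/2<..<T}" using t by auto
    have "continuous_on ({x-1<..<x+1} \<times> {t/2<..<T}) (\<lambda>(x, t). uxx x t)"
      by (rule continuous_on_eq[OF Z]) (use Z' in auto)
    then have "isCont (\<lambda>(x, t). uxx x t) (x, t)"
      using x t' by (subst (asm) continuous_on_eq_continuous_at) (auto intro: open_Times)
    then show ?thesis
      using dx[OF x t'] ux'[OF x t'] dt[OF x t'] X[OF x t'] Z'[OF x t'] by simp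
  qed
  have cont: "continuous_on (UNIV \<times> {0<..<T}) (\<lambda>(x, t). uxx x t)"
    using main by (auto intro!: continuous_at_imp_continuous_on)
  have "continuous_on (UNIV \<times> {0<..<T}) (\<lambda>(x, t). rhs x t)"
    by (rule continuous_on_subset[OF rhs.f_cont]) auto
  from continuous_on_add[OF cont this]
  have "continuous_on (UNIV \<times> {0<..<T}) (\<lambda>(x, t). uxx x t + rhs x t)"
    by (simp add: case_prod_unfold)
  then show thesis
    by (rule that[OF _ cont]) (use main in \<open>auto simp: rhs_def\<close>)
qed

end

section \<open>Comparison and the Dirichlet problem\<close>

text \<open>If the second derivative were negative, the first derivative, zero at the minimum, would
  be negative just to the right, and the mean value theorem would give a smaller value
  there.\<close>

lemma second_derivative_at_minimum:
  fixes v v' :: "real \<Rightarrow> real"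
  assumes x: "\<alpha> < x" "x < \<beta>"
    and der: "\<And>y. \<alpha> < y \<Longrightarrow> y < \<beta> \<Longrightarrow> (v has_real_derivative v' y) (at y)"
    and der2: "(v' has_real_derivative v2) (at x)"
    and min: "\<And>y. \<alpha> < y \<Longrightarrow> y < \<beta> \<Longrightarrow> v x \<le> v y"
  shows "0 \<le> v2"
proof (rule ccontr)
  assume "\<not> 0 \<le> v2"
  then obtain d where d: "0 < d" "\<And>h. 0 < h \<Longrightarrow> h < d \<Longrightarrow> v' (x + h) < v' x"
    using DERIV_neg_dec_right[OF der2] by auto
  have "v' x = 0"
  proof (rule DERIV_local_min[OF der[OF x]])
    show "0 < min (x - \<alpha>) (\<beta> - x)" using x by simp
    show "\<forall>y. \<bar>x - y\<bar> < min (x - \<alpha>) (\<beta> - x) \<longrightarrow> v x \<le> v y"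
      by (intro allI impI min) (auto simp: abs_less_iff)
  qed
  define h where "h = min d (\<beta> - x) / 2"
  have h: "0 < h" "h < d" "x + h < \<beta>" using d(1) x by (auto simp: h_def min_def field_simps)
  obtain z where z: "x < z" "z < x + h" "v (x + h) - v x = (x + h - x) * v' z"
    using MVT2[of x "x + h" v v'] der h x by auto
  have "v' z < 0" using d(2)[of "z - x"] z h \<open>v' x = 0\<close> by simp
  then have "(x + h - x) * v' z < 0" using h by (intro mult_pos_neg) auto
  then show False using z(3) min[of "x + h"] h x by simp
qed

text \<open>At a negative minimum of the rescaled function the second space derivative is
  nonnegative, so the differential inequality makes the time derivative strictly positive and the
  function was smaller a moment earlier. The inequality is therefore required only where
  \<open>v\<close> is negative.\<close>

lemma parabolic_minimum_principle:
  fixes v vt vx vxx :: "real \<Rightarrow> real \<Rightarrow> real"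
  assumes ab: "\<alpha> \<le> \<beta>" and cont: "continuous_on ({\<alpha>..\<beta>} \<times> {0..\<tau>}) (\<lambda>(x, t). v x t)"
    and init: "\<And>x. x \<in> {\<alpha>..\<beta>} \<Longrightarrow> 0 \<le> v x 0"
    and bdry: "\<And>t. t \<in> {0..\<tau>} \<Longrightarrow> 0 \<le> v \<alpha> t" "\<And>t. t \<in> {0..\<tau>} \<Longrightarrow> 0 \<le> v \<beta> t"
    and dt: "\<And>x t. x \<in> {\<alpha><..<\<beta>} \<Longrightarrow> t \<in> {0<..\<tau>} \<Longrightarrow> ((\<lambda>s. v x s) has_real_derivative vt x t) (at t)"
    and dx: "\<And>x t. x \<in> {\<alpha><..<\<beta>} \<Longrightarrow> t \<in> {0<..\<tau>} \<Longrightarrow> ((\<lambda>y. v y t) has_real_derivative vx x t) (at x)"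
    and dxx: "\<And>x t. x \<in> {\<alpha><..<\<beta>} \<Longrightarrow> t \<in> {0<..\<tau>} \<Longrightarrow> ((\<lambda>y. vx y t) has_real_derivative vxx x t) (at x)"
    and ineq: "\<And>x t. x \<in> {\<alpha><..<\<beta>} \<Longrightarrow> t \<in> {0<..\<tau>} \<Longrightarrow> v x t < 0 \<Longrightarrow> C * v x t \<le> vt x t - vxx x t"
    and xt: "x \<in> {\<alpha>..\<beta>}" "t \<in> {0..\<tau>}"
  shows "0 \<le> v x t"
proof (rule ccontr)
  assume neg: "\<not> 0 \<le> v x t"
  \<comment> \<open>The exponent uses \<open>C + 1\<close> and not \<open>C\<close>: the extra unit
    supplies the strictly positive term \<open>- v x0 t0\<close>.\<close>
  define z where "z = (\<lambda>x t. exp (- (C + 1) * t) * v x t)"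
  have "continuous_on ({\<alpha>..\<beta>} \<times> {0..\<tau>}) (\<lambda>p. z (fst p) (snd p))"
    unfolding z_def using cont by (intro continuous_intros) (simp add: case_prod_unfold)
  moreover have "compact ({\<alpha>..\<beta>} \<times> {0..\<tau>})" "{\<alpha>..\<beta>} \<times> {0..\<tau>} \<noteq> {}"
    using xt by (auto intro: compact_Times)
  ultimately obtain p where p: "p \<in> {\<alpha>..\<beta>} \<times> {0..\<tau>}"
    and pmin: "\<And>q. q \<in> {\<alpha>..\<beta>} \<times> {0..\<tau>} \<Longrightarrow> z (fst p) (snd p) \<le> z (fst q) (snd q)"
    using continuous_attains_inf by meson
  define x0 t0 where "x0 = fst p" and "t0 = snd p"
  have x0: "x0 \<in> {\<alpha>..\<beta>}" and t0: "t0 \<in> {0..\<tau>}" using p by (auto simp: x0_def t0_def)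
  have zmin: "z x0 t0 \<le> z y s" if "y \<in> {\<alpha>..\<beta>}" "s \<in> {0..\<tau>}" for y s
    using pmin[of "(y, s)"] that by (simp add: x0_def t0_def)
  have "z x t < 0" using neg by (simp add: z_def mult_pos_neg)
  then have z0: "z x0 t0 < 0" using zmin[OF xt] by simp
  then have v0: "v x0 t0 < 0" by (simp add: z_def mult_less_0_iff)
  have x0': "x0 \<in> {\<alpha><..<\<beta>}"
    using x0 v0 bdry[OF t0] by (auto simp: less_le)
  have t0': "t0 \<in> {0<..\<tau>}" using t0 v0 init[OF x0] by (auto simp: less_le)
  have "0 \<le> vxx x0 t0"
  proof (rule second_derivative_at_minimum[where v="\<lambda>y. v y t0" and v'="\<lambda>y. vx y t0" and x=x0])
    fix y assume "\<alpha> < y" "y < \<beta>"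
    then have "z x0 t0 \<le> z y t0" using zmin[of y t0] t0 by auto
    then show "v x0 t0 \<le> v y t0" by (simp add: z_def)
  qed (use x0' t0' dx dxx in auto)
  moreover have "C * v x0 t0 \<le> vt x0 t0 - vxx x0 t0" by (rule ineq[OF x0' t0' v0])
  ultimately have "0 < vt x0 t0 - (C + 1) * v x0 t0" using v0 by (simp add: algebra_simps)
  then have pos: "0 < exp (- (C + 1) * t0) * (vt x0 t0 - (C + 1) * v x0 t0)" by simp
  have "((\<lambda>s. z x0 s) has_real_derivative exp (- (C + 1) * t0) * (vt x0 t0 - (C + 1) * v x0 t0)) (at t0)"
    unfolding z_def using dt[OF x0' t0'] by (auto intro!: derivative_eq_intros simp: algebra_simps)
  \<comment> \<open>Only earlier times are compared, so a minimum at the final time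
    \<open>\<tau>\<close> needs no separate treatment.\<close>
  from DERIV_pos_inc_left[OF this pos]
  obtain d where d: "0 < d" "\<And>h. 0 < h \<Longrightarrow> h < d \<Longrightarrow> z x0 (t0 - h) < z x0 t0" by blast
  define h where "h = min d t0 / 2"
  have "0 < h" "h < d" "h \<le> t0" using d(1) t0' by (auto simp: h_def min_def)
  then show False using d(2)[of h] zmin[OF x0, of "t0 - h"] t0 by auto
qed

text \<open>A general reaction term lets the original, the truncated and the zero equation share one
  comparison principle.\<close>

definition heat_sol ::
  "(real \<Rightarrow> real \<Rightarrow> real) \<Rightarrow> (real \<Rightarrow> real) \<Rightarrow> real \<Rightarrow> (real \<Rightarrow> real \<Rightarrow> real) \<Rightarrow> bool" where
  "heat_sol g u0 T u \<longleftrightarrow>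
     0 < T \<and>
     continuous_on ({0..1} \<times> {0..<T}) (\<lambda>(x, t). u x t) \<and>
     (\<forall>x \<in> {0..1}. u x 0 = u0 x) \<and>
     (\<forall>t \<in> {0..<T}. u 0 t = 0 \<and> u 1 t = 0) \<and>
     (\<exists>ut ux uxx :: real \<Rightarrow> real \<Rightarrow> real.
        continuous_on ({0<..<1} \<times> {0<..<T}) (\<lambda>(x, t). ut x t) \<and>
        continuous_on ({0<..<1} \<times> {0<..<T}) (\<lambda>(x, t). uxx x t) \<and>
        (\<forall>x \<in> {0<..<1}. \<forall>t \<in> {0<..<T}.
           ((\<lambda>s. u x s) has_real_derivative ut x t) (at t) \<and>
           ((\<lambda>y. u y t) has_real_derivative ux x t) (at x) \<and>
           ((\<lambda>y. ux y t) has_real_derivative uxx x t) (at x) \<and>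
           ut x t - uxx x t = g x (u x t)))"

lemma is_solution_iff_heat_sol:
  "is_solution a l u0 T u \<longleftrightarrow> heat_sol (\<lambda>x w. l * w + a x * w\<^sup>2) u0 T u"
  unfolding is_solution_def heat_sol_def ..

lemma heat_sol_cong:
  assumes u: "heat_sol g u0 T u"
    and eq: "\<And>x t. x \<in> {0<..<1} \<Longrightarrow> t \<in> {0<..<T} \<Longrightarrow> h x (u x t) = g x (u x t)"
  shows "heat_sol h u0 T u"
proof -
  have "(\<forall>x \<in> {0<..<1}. \<forall>t \<in> {0<..<T}. P x t \<and> Q x t \<and> R x t \<and> D x t = h x (u x t)) \<longleftrightarrow>
        (\<forall>x \<in> {0<..<1}. \<forall>t \<in> {0<..<T}. P x t \<and> Q x t \<and> R x t \<and> D x t = g x (u x t))"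
    for P Q R and D :: "real \<Rightarrow> real \<Rightarrow> real"
    using eq by simp
  then show ?thesis using u unfolding heat_sol_def by simp
qed

lemma heat_sol_restrict:
  assumes u: "heat_sol g u0 T u" and "0 < T'" "T' \<le> T"
  shows "heat_sol g u0 T' u"
proof -
  from u obtain ut ux uxx where *:
    "continuous_on ({0..1} \<times> {0..<T}) (\<lambda>(x, t). u x t)"
    "continuous_on ({0<..<1} \<times> {0<..<T}) (\<lambda>(x, t). ut x t)"
    "continuous_on ({0<..<1} \<times> {0<..<T}) (\<lambda>(x, t). uxx x t)"
    "\<forall>x \<in> {0<..<1}. \<forall>t \<in> {0<..<T}.
       ((\<lambda>s. u x s) has_real_derivative ut x t) (at t) \<and>
       ((\<lambda>y. u y t) has_real_derivative ux x t) (at x) \<and>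
       ((\<lambda>y. ux y t) has_real_derivative uxx x t) (at x) \<and>
       ut x t - uxx x t = g x (u x t)"
    unfolding heat_sol_def by blast
  have sub: "{0<..<1} \<times> {0<..<T'} \<subseteq> {0<..<1::real} \<times> {0<..<T}"
    "{0..1} \<times> {0..<T'} \<subseteq> {0..1::real} \<times> {0..<T}" using assms by auto
  show ?thesis
    unfolding heat_sol_def
    using assms(2,3) u *(4) continuous_on_subset[OF *(1) sub(2)] continuous_on_subset[OF *(2) sub(1)]
      continuous_on_subset[OF *(3) sub(1)]
    by (intro conjI exI[of _ ut] exI[of _ ux] exI[of _ uxx]) (auto simp: heat_sol_def)
qed

lemma heat_sol_zero: "0 < T \<Longrightarrow> heat_sol (\<lambda>x w. 0) (\<lambda>x. 0) T (\<lambda>x t. 0)"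
  unfolding heat_sol_def by (auto intro!: exI[of _ "\<lambda>x t. 0"])

lemma heat_sol_bounded:
  assumes "heat_sol g u0 T u" "\<tau> < T"
  obtains M where "0 \<le> M" "\<And>x t. x \<in> {0..1} \<Longrightarrow> t \<in> {0..\<tau>} \<Longrightarrow> \<bar>u x t\<bar> \<le> M"
proof -
  have "continuous_on ({0..1} \<times> {0..\<tau>}) (\<lambda>(x, t). u x t)"
    by (rule continuous_on_subset[of "{0..1} \<times> {0..<T}"]) (use assms in \<open>auto simp: heat_sol_def\<close>)
  then have "bounded ((\<lambda>(x, t). u x t) ` ({0..1} \<times> {0..\<tau>}))"
    by (intro compact_imp_bounded compact_continuous_image compact_Times) auto
  then obtain M where M: "\<forall>w \<in> (\<lambda>(x, t). u x t) ` ({0..1} \<times> {0..\<tau>}). \<bar>w\<bar> \<le> M"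
    unfolding bounded_real by (rule exE)
  show thesis
  proof (rule that[of "max 0 M"])
    fix x t :: real assume "x \<in> {0..1}" "t \<in> {0..\<tau>}"
    then have "\<bar>u x t\<bar> \<le> M" using M by auto
    then show "\<bar>u x t\<bar> \<le> max 0 M" by simp
  qed simp
qed

text \<open>The minimum principle for \<open>v - u\<close>. The two reaction terms may differ, and
  since the estimate is needed only where the order fails, \<open>C\<close> may depend on bounds for
  these particular solutions.\<close>

lemma heat_sol_comparison:
  assumes u: "heat_sol g u0 T u" and v: "heat_sol h v0 T v"
    and init: "\<And>x. x \<in> {0..1} \<Longrightarrow> u0 x \<le> v0 x" and \<tau>: "\<tau> < T"
    and le: "\<And>x t. x \<in> {0<..<1} \<Longrightarrow> t \<in> {0<..\<tau>} \<Longrightarrow> v x t < u x t \<Longrightarrow>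
               g x (u x t) - h x (v x t) \<le> C * (u x t - v x t)"
    and xt: "x \<in> {0..1}" "t \<in> {0..\<tau>}"
  shows "u x t \<le> v x t"
proof -
  from u obtain ut ux uxx where u':
    "continuous_on ({0..1} \<times> {0..<T}) (\<lambda>(x, t). u x t)"
    "\<And>x t. x \<in> {0<..<1} \<Longrightarrow> t \<in> {0<..<T} \<Longrightarrow>
       ((\<lambda>s. u x s) has_real_derivative ut x t) (at t) \<and>
       ((\<lambda>y. u y t) has_real_derivative ux x t) (at x) \<and>
       ((\<lambda>y. ux y t) has_real_derivative uxx x t) (at x) \<and>
       ut x t - uxx x t = g x (u x t)"
    unfolding heat_sol_def by blast
  from v obtain vt vx vxx where v':
    "continuous_on ({0..1} \<times> {0..<T}) (\<lambda>(x, t). v x t)"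
    "\<And>x t. x \<in> {0<..<1} \<Longrightarrow> t \<in> {0<..<T} \<Longrightarrow>
       ((\<lambda>s. v x s) has_real_derivative vt x t) (at t) \<and>
       ((\<lambda>y. v y t) has_real_derivative vx x t) (at x) \<and>
       ((\<lambda>y. vx y t) has_real_derivative vxx x t) (at x) \<and>
       vt x t - vxx x t = h x (v x t)"
    unfolding heat_sol_def by blast
  have "0 \<le> v x t - u x t"
  proof (rule parabolic_minimum_principle[where v="\<lambda>x t. v x t - u x t" and vt="\<lambda>x t. vt x t - ut x t"
        and vx="\<lambda>x t. vx x t - ux x t" and vxx="\<lambda>x t. vxx x t - uxx x t" and \<alpha>=0 and \<beta>=1 and \<tau>=\<tau> and C=C])
    have sub: "{0..1} \<times> {0..\<tau>} \<subseteq> {0..1} \<times> {0..<T}" using \<tau> by auto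
    show "continuous_on ({0..1} \<times> {0..\<tau>}) (\<lambda>(x, t). v x t - u x t)"
      using continuous_on_diff[OF continuous_on_subset[OF v'(1) sub] continuous_on_subset[OF u'(1) sub]]
      by (simp add: case_prod_unfold)
    show "0 \<le> v x 0 - u x 0" if "x \<in> {0..1}" for x
      using that init u v by (simp add: heat_sol_def)
    show "0 \<le> v 0 t - u 0 t" "0 \<le> v 1 t - u 1 t" if "t \<in> {0..\<tau>}" for t
      using that u v \<tau> by (simp_all add: heat_sol_def)
    fix x t assume x: "x \<in> {0<..<1::real}" and t: "t \<in> {0<..\<tau>}"
    then have t': "t \<in> {0<..<T}" using \<tau> by auto
    note U = u'(2)[OF x t'] and V = v'(2)[OF x t']
    show "((\<lambda>s. v x s - u x s) has_real_derivative vt x t - ut x t) (at t)"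
      "((\<lambda>y. v y t - u y t) has_real_derivative vx x t - ux x t) (at x)"
      "((\<lambda>y. vx y t - ux y t) has_real_derivative vxx x t - uxx x t) (at x)"
      using U V by (auto intro: DERIV_diff)
    assume "v x t - u x t < 0"
    then have "g x (u x t) - h x (v x t) \<le> C * (u x t - v x t)" using le[OF x t] by simp
    then show "C * (v x t - u x t) \<le> vt x t - ut x t - (vxx x t - uxx x t)"
      using U V by (simp add: algebra_simps)
  qed (use xt in auto)
  then show ?thesis by simp
qed

text \<open>The odd function \<open>w * \<bar>w\<bar>\<close> with its second factor capped at
  \<open>M\<close>: globally Lipschitz, compatible with odd reflection, and equal to the square
  between \<open>0\<close> and \<open>M\<close>.\<close>

definition trunc_sq :: "real \<Rightarrow> real \<Rightarrow> real" where
  "trunc_sq M w = w * min \<bar>w\<bar> M"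

lemma trunc_sq_minus: "trunc_sq M (- w) = - trunc_sq M w"
  by (simp add: trunc_sq_def)

lemma trunc_sq_eq: "0 \<le> w \<Longrightarrow> w \<le> M \<Longrightarrow> trunc_sq M w = w\<^sup>2"
  by (simp add: trunc_sq_def power2_eq_square)

lemma trunc_sq_lipschitz:
  assumes "0 \<le> M" shows "\<bar>trunc_sq M w - trunc_sq M w'\<bar> \<le> 2 * M * \<bar>w - w'\<bar>"
proof -
  have *: "\<bar>trunc_sq M w - trunc_sq M w'\<bar> \<le> 2 * M * \<bar>w - w'\<bar>" if le: "\<bar>w'\<bar> \<le> \<bar>w\<bar>" for w w'
  proof -
    \<comment> \<open>With \<open>\<bar>w'\<bar> \<le> \<bar>w\<bar>\<close> the second product
      vanishes as soon as \<open>\<bar>w'\<bar>\<close> exceeds \<open>M\<close>, because both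
      minima then equal \<open>M\<close>; so its unbounded factor does no harm.\<close>
    have "trunc_sq M w - trunc_sq M w' = (w - w') * min \<bar>w\<bar> M + w' * (min \<bar>w\<bar> M - min \<bar>w'\<bar> M)"
      by (simp add: trunc_sq_def algebra_simps)
    moreover have "\<bar>(w - w') * min \<bar>w\<bar> M\<bar> \<le> \<bar>w - w'\<bar> * M"
      unfolding abs_mult using assms by (intro mult_left_mono) auto
    moreover have "\<bar>w' * (min \<bar>w\<bar> M - min \<bar>w'\<bar> M)\<bar> \<le> M * \<bar>w - w'\<bar>"
    proof (cases "\<bar>w'\<bar> \<le> M")
      case True
      then show ?thesis unfolding abs_mult using assms by (intro mult_mono) auto
    next
      case False
      then have "min \<bar>w\<bar> M = min \<bar>w'\<bar> M" using le by auto
      then show ?thesis using assms by simp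
    qed
    ultimately have "\<bar>trunc_sq M w - trunc_sq M w'\<bar> \<le> \<bar>w - w'\<bar> * M + M * \<bar>w - w'\<bar>"
      by (metis abs_triangle_ineq add_mono order_trans)
    then show ?thesis by (simp add: mult_ac)
  qed
  show ?thesis
    using *[of w' w] *[of w w'] by (cases "\<bar>w'\<bar> \<le> \<bar>w\<bar>") (auto simp: abs_minus_commute)
qed

text \<open>The triangle wave folding the line onto the unit interval: composing with it gives the even
  2-periodic extension, and the sign of \<open>sin (pi * x)\<close> turns that into the odd one.\<close>

definition fold01 :: "real \<Rightarrow> real" where
  "fold01 x = arccos (cos (pi * x)) / pi"

lemma fold01_cont: "continuous_on UNIV fold01"
  unfolding fold01_def by (intro continuous_intros) auto

lemma fold01_range: "fold01 x \<in> {0..1}"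
  using arccos_bounded[of "cos (pi * x)"] by (simp add: fold01_def)

lemma fold01_id: "x \<in> {0..1} \<Longrightarrow> fold01 x = x"
  by (simp add: fold01_def arccos_cos)

lemma fold01_reflect: "fold01 (2 * 0 - x) = fold01 x" "fold01 (2 * 1 - x) = fold01 x"
  by (simp_all add: fold01_def right_diff_distrib cos_diff)

lemma fold01_endpoint:
  assumes "sin (pi * x) = 0" shows "fold01 x = 0 \<or> fold01 x = 1"
proof -
  have "(cos (pi * x))\<^sup>2 = 1" using sin_cos_squared_add[of "pi * x"] assms by simp
  then have "cos (pi * x) = 1 \<or> cos (pi * x) = -1" by (simp add: power2_eq_1_iff)
  then show ?thesis by (auto simp: fold01_def)
qed

definition odd_extension :: "(real \<Rightarrow> real) \<Rightarrow> real \<Rightarrow> real" where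
  "odd_extension h x = sgn (sin (pi * x)) * h (fold01 x)"

lemma odd_extension_reflect:
  "odd_extension h (2 * 0 - x) = - odd_extension h x"
  "odd_extension h (2 * 1 - x) = - odd_extension h x"
  by (simp_all only: odd_extension_def fold01_reflect)
     (simp_all add: right_diff_distrib sin_diff sgn_minus)

lemma odd_extension_id:
  assumes "h 0 = 0" "h 1 = 0" "x \<in> {0..1}"
  shows "odd_extension h x = h x"
proof (cases "x = 0 \<or> x = 1")
  case False
  then have "0 < sin (pi * x)" using assms(3) by (intro sin_gt_zero) auto
  then show ?thesis using assms by (simp add: odd_extension_def fold01_id)
qed (use assms in \<open>auto simp: odd_extension_def fold01_id\<close>)

text \<open>The sign factor jumps only at zeros of the sine. There the folded point is an endpoint,
  where \<open>h\<close> vanishes, and the absolute value is squeezed to zero.\<close>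

lemma odd_extension_cont:
  assumes h: "continuous_on {0..1} h" "h 0 = 0" "h 1 = 0"
  shows "continuous_on UNIV (odd_extension h)"
proof -
  have c: "continuous_on UNIV (\<lambda>x. h (fold01 x))"
    by (rule continuous_on_compose2[OF h(1) fold01_cont]) (use fold01_range in auto)
  have "isCont (odd_extension h) x" for x
  proof (cases "sin (pi * x) = 0")
    case True
    then have 0: "h (fold01 x) = 0" using fold01_endpoint[OF True] h by auto
    have "((\<lambda>x. h (fold01 x)) \<longlongrightarrow> 0) (at x)"
      using c 0 by (simp add: continuous_on_eq_continuous_at isCont_def) metis
    then have "((\<lambda>x. \<bar>h (fold01 x)\<bar>) \<longlongrightarrow> 0) (at x)" by (simp add: tendsto_rabs_zero)
    then have "(odd_extension h \<longlongrightarrow> 0) (at x)"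
      by (rule Lim_null_comparison[rotated]) (auto simp: odd_extension_def abs_mult sgn_if)
    then show ?thesis using True by (simp add: isCont_def odd_extension_def)
  next
    case False
    have "isCont (\<lambda>x. sin (pi * x)) x" by (intro continuous_intros)
    then have "isCont (\<lambda>x. sgn (sin (pi * x))) x" using False by (rule isCont_sgn)
    moreover have "isCont (\<lambda>x. h (fold01 x)) x" using c by (simp add: continuous_on_eq_continuous_at)
    ultimately show ?thesis unfolding odd_extension_def[abs_def] by (rule isCont_mult)
  qed
  then show ?thesis by (simp add: continuous_at_imp_continuous_on)
qed

lemma bounded_on_unit_interval:
  fixes h :: "real \<Rightarrow> real"
  assumes "continuous_on {0..1} h"
  obtains K where "0 \<le> K" "\<And>x. x \<in> {0..1} \<Longrightarrow> \<bar>h x\<bar> \<le> K"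
proof -
  have "bounded (h ` {0..1})" using assms by (intro compact_imp_bounded compact_continuous_image) auto
  then obtain K where K: "\<forall>w \<in> h ` {0..1}. \<bar>w\<bar> \<le> K"
    unfolding bounded_real by (rule exE)
  show thesis
  proof (rule that[of "max 0 K"])
    fix x :: real assume "x \<in> {0..1}"
    then show "\<bar>h x\<bar> \<le> max 0 K" using K by (auto simp: le_max_iff_disj)
  qed simp
qed

text \<open>The coefficient is extended evenly and the initial value oddly, so the equation is
  invariant under odd reflection about both 0 and 1; the solution on the line then satisfies both
  boundary conditions.\<close>

theorem truncated_solution_exists:
  assumes a: "continuous_on {0..1} a" and u0: "continuous_on {0..1} u0" "u0 0 = 0" "u0 1 = 0"
    and M: "0 \<le> M" and T: "0 < T"
  shows "\<exists>u. heat_sol (\<lambda>x w. l * w + a x * trunc_sq M w) u0 T u"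
proof -
  obtain K where K: "0 \<le> K" "\<And>x. x \<in> {0..1} \<Longrightarrow> \<bar>a x\<bar> \<le> K"
    using bounded_on_unit_interval[OF a] by blast
  obtain N where N: "0 \<le> N" "\<And>x. x \<in> {0..1} \<Longrightarrow> \<bar>u0 x\<bar> \<le> N"
    using bounded_on_unit_interval[OF u0(1)] by blast
  define F where "F = (\<lambda>x w. l * w + a (fold01 x) * trunc_sq M w)"
  \<comment> \<open>\<open>2 * K * M\<close> comes from the truncated square; the added 1 makes the
    Lipschitz constant positive even for \<open>l = 0\<close> and \<open>K * M = 0\<close>.\<close>
  interpret semilinear_line F "odd_extension u0" "\<bar>l\<bar> + 2 * K * M + 1" N T
  proof
    have "continuous_on UNIV (\<lambda>x. a (fold01 x))"
      by (rule continuous_on_compose2[OF a fold01_cont]) (use fold01_range in auto)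
    then have "continuous_on UNIV (\<lambda>p::real \<times> real. a (fold01 (fst p)))"
      by (rule continuous_on_compose2) (auto intro: continuous_intros)
    then show "continuous_on UNIV (\<lambda>(x, u). F x u)"
      unfolding F_def trunc_sq_def case_prod_unfold by (intro continuous_intros)
    show "\<bar>F x u - F x v\<bar> \<le> (\<bar>l\<bar> + 2 * K * M + 1) * \<bar>u - v\<bar>" for x u v
    proof -
      have "F x u - F x v = l * (u - v) + a (fold01 x) * (trunc_sq M u - trunc_sq M v)"
        by (simp add: F_def algebra_simps)
      moreover have "\<bar>a (fold01 x) * (trunc_sq M u - trunc_sq M v)\<bar> \<le> K * (2 * M * \<bar>u - v\<bar>)"
        unfolding abs_mult using K fold01_range trunc_sq_lipschitz[OF M] by (intro mult_mono) auto
      moreover have "\<bar>l * (u - v)\<bar> = \<bar>l\<bar> * \<bar>u - v\<bar>" by (rule abs_mult)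
      ultimately have "\<bar>F x u - F x v\<bar> \<le> \<bar>l\<bar> * \<bar>u - v\<bar> + K * (2 * M * \<bar>u - v\<bar>)" by linarith
      also have "\<dots> \<le> (\<bar>l\<bar> + 2 * K * M + 1) * \<bar>u - v\<bar>" by (simp add: algebra_simps)
      finally show ?thesis .
    qed
    show "F x 0 = 0" for x by (simp add: F_def trunc_sq_def)
    show "0 < \<bar>l\<bar> + 2 * K * M + 1" using K M mult_nonneg_nonneg[of K M] by linarith
    show "continuous_on UNIV (odd_extension u0)" by (rule odd_extension_cont[OF u0])
    show "\<bar>odd_extension u0 x\<bar> \<le> N" for x
      using N fold01_range[of x] by (auto simp: odd_extension_def abs_mult sgn_if)
  qed (rule T)
  obtain ut ux uxx where s:
    "continuous_on (UNIV \<times> {0<..<T}) (\<lambda>(x, t). ut x t)"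
    "continuous_on (UNIV \<times> {0<..<T}) (\<lambda>(x, t). uxx x t)"
    "\<And>x t. t \<in> {0<..<T} \<Longrightarrow> ((\<lambda>s. sol x s) has_real_derivative ut x t) (at t)"
    "\<And>x t. t \<in> {0<..<T} \<Longrightarrow> ((\<lambda>y. sol y t) has_real_derivative ux x t) (at x)"
    "\<And>x t. t \<in> {0<..<T} \<Longrightarrow> ((\<lambda>y. ux y t) has_real_derivative uxx x t) (at x)"
    "\<And>x t. t \<in> {0<..<T} \<Longrightarrow> ut x t - uxx x t = F x (sol x t)"
    by (rule sol_classical) (rule that)
  have F_odd: "F (2 * 0 - x) (- w) = - F x w" "F (2 * 1 - x) (- w) = - F x w" for x w
    unfolding F_def fold01_reflect trunc_sq_minus by simp_all
  have sub: "continuous_on ({0<..<1} \<times> {0<..<T}) (\<lambda>(x, t). ut x t)"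
      "continuous_on ({0<..<1} \<times> {0<..<T}) (\<lambda>(x, t). uxx x t)"
    by (rule continuous_on_subset[OF s(1)] continuous_on_subset[OF s(2)], auto)+
  have "continuous_on ({0..1} \<times> {0..<T}) (\<lambda>(x, t). sol x t)"
    by (rule continuous_on_subset[OF sol_cont]) auto
  moreover have "sol x 0 = u0 x" if "x \<in> {0..1}" for x
    using odd_extension_id[OF u0(2,3) that] by (simp add: sol_init)
  moreover have "sol 0 t = 0" "sol 1 t = 0" for t
    using sol_reflect[of 0 t] sol_reflect[of 1 t] F_odd odd_extension_reflect by auto
  ultimately have "heat_sol F u0 T sol"
    unfolding heat_sol_def using T sub s(3-6)
    by simp (rule exI[of _ ut], rule conjI, assumption, rule exI[of _ ux], rule exI[of _ uxx], simp)
  then have "heat_sol (\<lambda>x w. l * w + a x * trunc_sq M w) u0 T sol"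
    by (rule heat_sol_cong) (auto simp: F_def fold01_id)
  then show ?thesis by blast
qed

section \<open>Dependence on the parameter\<close>

text \<open>Comparison with the zero solution: the reaction term is
  \<open>(l + a x * u x s) * u x s\<close>, and on a closed time interval the bracket is
  bounded.\<close>

lemma is_solution_nonneg:
  assumes a: "continuous_on {0..1} a" and u0: "\<And>x. x \<in> {0..1} \<Longrightarrow> 0 \<le> u0 x"
    and u: "is_solution a l u0 T u" and xt: "x \<in> {0..1}" "t \<in> {0..<T}"
  shows "0 \<le> u x t"
proof -
  note u' = u[unfolded is_solution_iff_heat_sol]
  obtain K where K: "0 \<le> K" "\<And>x. x \<in> {0..1} \<Longrightarrow> \<bar>a x\<bar> \<le> K"
    using bounded_on_unit_interval[OF a] by blast
  have tT: "t < T" using xt by simp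
  obtain M where M: "0 \<le> M" "\<And>x s. x \<in> {0..1} \<Longrightarrow> s \<in> {0..t} \<Longrightarrow> \<bar>u x s\<bar> \<le> M"
    using heat_sol_bounded[OF u' tT] by blast
  have T: "0 < T" using u by (simp add: is_solution_def)
  show ?thesis
  proof (rule heat_sol_comparison[OF heat_sol_zero[OF T] u' u0 tT, where C="l + K * M"])
    fix x s assume x: "x \<in> {0<..<1::real}" and s: "s \<in> {0<..t}" and neg: "u x s < 0"
    have "a x * u x s \<le> \<bar>a x\<bar> * \<bar>u x s\<bar>" unfolding abs_mult[symmetric] by (rule abs_ge_self)
    also have "\<dots> \<le> K * M" using x s K M by (intro mult_mono) auto
    finally have "(l + a x * u x s) * (0 - u x s) \<le> (l + K * M) * (0 - u x s)"
      using neg by (intro mult_right_mono) auto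
    then show "0 - (l * u x s + a x * (u x s)\<^sup>2) \<le> (l + K * M) * (0 - u x s)"
      by (simp add: algebra_simps power2_eq_square)
  qed (use xt in auto)
qed

text \<open>The reaction terms differ by \<open>(l' + a x * (u x s + v x s)) * (u x s - v x s) + (l'
  - l) * v x s\<close>; nonnegativity of \<open>v\<close> gives the last product the right
  sign.\<close>

lemma is_solution_mono_param:
  assumes a: "continuous_on {0..1} a" and u0: "\<And>x. x \<in> {0..1} \<Longrightarrow> 0 \<le> u0 x"
    and u: "is_solution a l' u0 T u" and v: "is_solution a l u0 T v" and l: "l' \<le> l"
    and xt: "x \<in> {0..1}" "t \<in> {0..<T}"
  shows "u x t \<le> v x t"
proof -
  note u' = u[unfolded is_solution_iff_heat_sol] and v' = v[unfolded is_solution_iff_heat_sol]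
  obtain K where K: "0 \<le> K" "\<And>x. x \<in> {0..1} \<Longrightarrow> \<bar>a x\<bar> \<le> K"
    using bounded_on_unit_interval[OF a] by blast
  have tT: "t < T" using xt by simp
  obtain M where M: "0 \<le> M" "\<And>x s. x \<in> {0..1} \<Longrightarrow> s \<in> {0..t} \<Longrightarrow> \<bar>u x s\<bar> \<le> M"
    using heat_sol_bounded[OF u' tT] by blast
  obtain N where N: "0 \<le> N" "\<And>x s. x \<in> {0..1} \<Longrightarrow> s \<in> {0..t} \<Longrightarrow> \<bar>v x s\<bar> \<le> N"
    using heat_sol_bounded[OF v' tT] by blast
  show ?thesis
  proof (rule heat_sol_comparison[OF u' v' order_refl tT, where C="l' + K * (M + N)"])
    fix x s assume x: "x \<in> {0<..<1::real}" and s: "s \<in> {0<..t}" and less: "v x s < u x s"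
    have v0: "0 \<le> v x s" using is_solution_nonneg[OF a u0 v, of x s] x s tT by auto
    have "a x * (u x s + v x s) \<le> \<bar>a x\<bar> * \<bar>u x s + v x s\<bar>" unfolding abs_mult[symmetric] by (rule abs_ge_self)
    also have "\<dots> \<le> K * (M + N)" using x s K M N
      by (intro mult_mono order_trans[OF abs_triangle_ineq add_mono]) auto
    finally have "(l' + a x * (u x s + v x s)) * (u x s - v x s) \<le> (l' + K * (M + N)) * (u x s - v x s)"
      using less by (intro mult_right_mono) auto
    moreover have "l' * v x s \<le> l * v x s" using l v0 by (rule mult_right_mono)
    ultimately show "l' * u x s + a x * (u x s)\<^sup>2 - (l * v x s + a x * (v x s)\<^sup>2)
        \<le> (l' + K * (M + N)) * (u x s - v x s)"
      by (simp add: algebra_simps power2_eq_square)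
  qed (use xt in auto)
qed

text \<open>The given solution is a barrier for the new one and its maximum is the truncation level.
  That maximum exists on the closed interval up to \<open>T'\<close>, whence
  \<open>T' < T\<close>.\<close>

theorem is_solution_smaller_param:
  assumes a: "continuous_on {0..1} a"
    and u0: "continuous_on {0..1} u0" "\<And>x. x \<in> {0..1} \<Longrightarrow> 0 \<le> u0 x"
    and v: "is_solution a l u0 T v" and l: "l' \<le> l" and T': "0 < T'" "T' < T"
  shows "\<exists>u. is_solution a l' u0 T' u"
proof -
  have vT: "is_solution a l u0 T' v"
    using heat_sol_restrict[OF v[unfolded is_solution_iff_heat_sol] T'(1)] T'(2) is_solution_iff_heat_sol by simp
  note v' = vT[unfolded is_solution_iff_heat_sol]
  have vv: "0 < T" "\<forall>x \<in> {0..1}. v x 0 = u0 x" "\<forall>t \<in> {0..<T}. v 0 t = 0 \<and> v 1 t = 0"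
    using v unfolding is_solution_def by blast+
  \<comment> \<open>Compatibility of the initial value with the boundary condition is read off from
    the given solution at time zero.\<close>
  have bd: "u0 0 = 0" "u0 1 = 0"
    using vv(1) bspec[OF vv(2), of 0] bspec[OF vv(2), of 1] bspec[OF vv(3), of 0] by simp_all
  obtain M where M: "0 \<le> M" "\<And>x t. x \<in> {0..1} \<Longrightarrow> t \<in> {0..T'} \<Longrightarrow> \<bar>v x t\<bar> \<le> M"
    using heat_sol_bounded[OF v[unfolded is_solution_iff_heat_sol] T'(2)] by blast
  obtain K where K: "0 \<le> K" "\<And>x. x \<in> {0..1} \<Longrightarrow> \<bar>a x\<bar> \<le> K"
    using bounded_on_unit_interval[OF a] by blast
  obtain u where u: "heat_sol (\<lambda>x w. l' * w + a x * trunc_sq M w) u0 T' u"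
    using truncated_solution_exists[OF a u0(1) bd M(1) T'(1)] by blast
  have nonneg: "0 \<le> u x t" if xt: "x \<in> {0..1}" "t \<in> {0..<T'}" for x t
  proof (rule heat_sol_comparison[OF heat_sol_zero[OF T'(1)] u u0(2), where C="l' + K * M"])
    fix x s assume x: "x \<in> {0<..<1::real}" and neg: "u x s < 0"
    have "a x * min \<bar>u x s\<bar> M \<le> \<bar>a x\<bar> * \<bar>min \<bar>u x s\<bar> M\<bar>" unfolding abs_mult[symmetric] by (rule abs_ge_self)
    also have "\<dots> \<le> K * M" using x K M by (intro mult_mono) auto
    finally have "(l' + a x * min \<bar>u x s\<bar> M) * (0 - u x s) \<le> (l' + K * M) * (0 - u x s)"
      using neg by (intro mult_right_mono) auto
    then show "0 - (l' * u x s + a x * trunc_sq M (u x s)) \<le> (l' + K * M) * (0 - u x s)"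
      by (simp add: trunc_sq_def algebra_simps)
  qed (use xt in auto)
  have le: "u x t \<le> v x t" if xt: "x \<in> {0..1}" "t \<in> {0..<T'}" for x t
  proof (rule heat_sol_comparison[OF u v' order_refl, where C="l' + K * (2 * M)"])
    fix x s assume x: "x \<in> {0<..<1::real}" and s: "s \<in> {0<..t}" and less: "v x s < u x s"
    have v0: "0 \<le> v x s" using is_solution_nonneg[OF a u0(2) vT, of x s] x s xt by auto
    have "v x s \<le> M" using M(2)[of x s] x s xt by auto
    \<comment> \<open>As \<open>v\<close> stays below the level, its square may be written as a
      truncated one. The global Lipschitz bound then applies without any prior bound on
      \<open>u\<close>.\<close>
    then have v2: "trunc_sq M (v x s) = (v x s)\<^sup>2" using v0 by (rule trunc_sq_eq[rotated])
    have "a x * (trunc_sq M (u x s) - trunc_sq M (v x s)) \<le> \<bar>a x\<bar> * \<bar>trunc_sq M (u x s) - trunc_sq M (v x s)\<bar>"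
      unfolding abs_mult[symmetric] by (rule abs_ge_self)
    also have "\<dots> \<le> K * (2 * M * \<bar>u x s - v x s\<bar>)"
      using x K M trunc_sq_lipschitz by (intro mult_mono) auto
    also have "\<bar>u x s - v x s\<bar> = u x s - v x s" using less by simp
    finally have "a x * (trunc_sq M (u x s) - (v x s)\<^sup>2) \<le> K * (2 * M * (u x s - v x s))"
      by (simp only: v2)
    moreover have "l' * v x s \<le> l * v x s" using l v0 by (rule mult_right_mono)
    ultimately show "l' * u x s + a x * trunc_sq M (u x s) - (l * v x s + a x * (v x s)\<^sup>2)
        \<le> (l' + K * (2 * M)) * (u x s - v x s)"
      by (simp add: algebra_simps)
  qed (use xt in auto)
  have "heat_sol (\<lambda>x w. l' * w + a x * w\<^sup>2) u0 T' u"
  proof (rule heat_sol_cong[OF u])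
    fix x t assume x: "x \<in> {0<..<1::real}" and t: "t \<in> {0<..<T'}"
    have "trunc_sq M (u x t) = (u x t)\<^sup>2"
      using nonneg[of x t] le[of x t] M(2)[of x t] x t by (intro trunc_sq_eq) auto
    then show "l' * u x t + a x * (u x t)\<^sup>2 = l' * u x t + a x * trunc_sq M (u x t)" by simp
  qed
  then show ?thesis using is_solution_iff_heat_sol by blast
qed

section \<open>Existence times as functions of the parameter, and the barrier\<close>

lemma Tmax_antimono:
  assumes a: "continuous_on {0..1} a"
    and u0: "continuous_on {0..1} u0" "\<And>x. x \<in> {0..1} \<Longrightarrow> 0 \<le> u0 x" and l: "l' \<le> l"
  shows "Tmax a u0 l \<le> Tmax a u0 l'"
  unfolding Tmax_def
proof (rule Sup_least, clarify)
  fix T v assume v: "is_solution a l u0 T v"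
  then have T: "0 < T" by (simp add: is_solution_def)
  show "ereal T \<le> Sup {ereal T |T. \<exists>u. is_solution a l' u0 T u}"
  \<comment> \<open>Existence carries over only to strictly shorter intervals, so \<open>T\<close>
    is approached from below.\<close>
  proof (rule dense_le)
    fix y assume y: "y < ereal T"
    \<comment> \<open>The maximum with \<open>T / 2\<close> keeps \<open>T'\<close> positive when
      \<open>y\<close> is negative or minus infinity.\<close>
    define T' where "T' = max (T / 2) (real_of_ereal y)"
    have "y \<le> ereal T'" "0 < T'" "T' < T"
      using y T by (cases y; auto simp: T'_def)+
    then obtain u where "is_solution a l' u0 T' u"
      using is_solution_smaller_param[OF a u0 v l] by blast
    then have "ereal T' \<le> Sup {ereal T |T. \<exists>u. is_solution a l' u0 T u}"
      by (intro Sup_upper) auto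
    with \<open>y \<le> ereal T'\<close> show "y \<le> Sup {ereal T |T. \<exists>u. is_solution a l' u0 T u}" by (rule order_trans)
  qed
qed

text \<open>An antitone function with values in the extended reals converges at minus infinity to
  its supremum, so the description behind \<open>Lim\<close> denotes that value.\<close>

lemma Tmax_lim_eq:
  assumes a: "continuous_on {0..1} a"
    and u0: "continuous_on {0..1} u0" "\<And>x. x \<in> {0..1} \<Longrightarrow> 0 \<le> u0 x"
  shows "Tmax_lim a u0 = (SUP l. Tmax a u0 l)"
  unfolding Tmax_lim_def
proof (rule tendsto_Lim)
  show "((\<lambda>l. Tmax a u0 l) \<longlongrightarrow> (SUP l. Tmax a u0 l)) at_bot"
  proof (rule order_tendstoI)
    fix y assume "y < (SUP l. Tmax a u0 l)"
    then obtain l where "y < Tmax a u0 l" by (auto simp: less_SUP_iff)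
    then show "\<forall>\<^sub>F l in at_bot. y < Tmax a u0 l"
      using Tmax_antimono[OF a u0] by (auto simp: eventually_at_bot_linorder intro: less_le_trans)
  next
    fix y assume "(SUP l. Tmax a u0 l) < y"
    then have "Tmax a u0 l < y" for l using SUP_upper[of l UNIV "Tmax a u0"] by (simp add: le_less_trans)
    then show "\<forall>\<^sub>F l in at_bot. Tmax a u0 l < y" by simp
  qed
qed simp

text \<open>The barrier: each of the three exponentials solves \<open>w\<^sub>t = w\<^sub>x\<^sub>x + l * w\<close>; they dominate
  the solution on the left side, the right side and the bottom of the parabolic boundary.\<close>

lemma solution_decay:
  assumes u: "is_solution a l u0 T u" and l: "l \<le> 0" and T: "t < T"
    and sub: "{x - \<delta>..x + \<delta>} \<subseteq> {y \<in> {0<..<1}. a y \<le> 0}" and \<delta>: "0 < \<delta>" and t: "0 \<le> t"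
    and M: "\<And>y s. y \<in> {x - \<delta>..x + \<delta>} \<Longrightarrow> s \<in> {0..t} \<Longrightarrow> u y s \<le> M" and M0: "0 \<le> M"
  shows "u x t \<le> M * (2 * exp (- sqrt (- l) * \<delta>) + exp (l * t))"
proof -
  define k where "k = sqrt (- l)"
  have k: "k * k = - l" "0 \<le> k" using l by (auto simp: k_def)
  define \<alpha> \<beta> where "\<alpha> = x - \<delta>" and "\<beta> = x + \<delta>"
  define b where "b = (\<lambda>y s. M * (exp (- k * (y - \<alpha>)) + exp (- k * (\<beta> - y)) + exp (l * s)))"
  from u obtain ut ux uxx where u':
    "continuous_on ({0..1} \<times> {0..<T}) (\<lambda>(x, t). u x t)"
    "\<And>x t. x \<in> {0<..<1} \<Longrightarrow> t \<in> {0<..<T} \<Longrightarrow>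
       ((\<lambda>s. u x s) has_real_derivative ut x t) (at t) \<and>
       ((\<lambda>y. u y t) has_real_derivative ux x t) (at x) \<and>
       ((\<lambda>y. ux y t) has_real_derivative uxx x t) (at x) \<and>
       ut x t - uxx x t = l * u x t + a x * (u x t)\<^sup>2"
    unfolding is_solution_def by blast
  have sub': "\<And>y. y \<in> {\<alpha>..\<beta>} \<Longrightarrow> 0 < y \<and> y < 1 \<and> a y \<le> 0"
    using sub by (auto simp: \<alpha>_def \<beta>_def)
  have "0 \<le> b x t - u x t"
  proof (rule parabolic_minimum_principle[where v="\<lambda>y s. b y s - u y s" and \<alpha>=\<alpha> and \<beta>=\<beta> and \<tau>=t and C=l
        and vt="\<lambda>y s. M * (l * exp (l * s)) - ut y s"
        and vx="\<lambda>y s. M * (- k * exp (- k * (y - \<alpha>)) + k * exp (- k * (\<beta> - y))) - ux y s"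
        and vxx="\<lambda>y s. M * (k * k * exp (- k * (y - \<alpha>)) + k * k * exp (- k * (\<beta> - y))) - uxx y s"])
    show "\<alpha> \<le> \<beta>" using \<delta> by (simp add: \<alpha>_def \<beta>_def)
    have "continuous_on ({\<alpha>..\<beta>} \<times> {0..t}) (\<lambda>p. u (fst p) (snd p))"
      using continuous_on_subset[OF u'(1), of "{\<alpha>..\<beta>} \<times> {0..t}"] sub' T
      by (force simp: case_prod_unfold)
    then show "continuous_on ({\<alpha>..\<beta>} \<times> {0..t}) (\<lambda>(y, s). b y s - u y s)"
      unfolding b_def case_prod_unfold by (intro continuous_intros)
    \<comment> \<open>On each of the three pieces of the parabolic boundary one exponential equals 1
      and the other two are positive.\<close>
    have ge: "u y s \<le> b y s" if "y \<in> {\<alpha>..\<beta>}" "s \<in> {0..t}" "y = \<alpha> \<or> y = \<beta> \<or> s = 0" for y s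
    proof -
      have "1 \<le> exp (- k * (y - \<alpha>)) + exp (- k * (\<beta> - y)) + exp (l * s)"
        using that(3) by (elim disjE) (auto intro: add_nonneg_nonneg simp: add.assoc)
      then have "M * 1 \<le> b y s" unfolding b_def using M0 by (rule mult_left_mono)
      then show ?thesis using M[of y s] that by (simp add: \<alpha>_def \<beta>_def)
    qed
    show "0 \<le> b y 0 - u y 0" if "y \<in> {\<alpha>..\<beta>}" for y using ge[of y 0] that t by simp
    show "0 \<le> b \<alpha> s - u \<alpha> s" "0 \<le> b \<beta> s - u \<beta> s" if "s \<in> {0..t}" for s
      using ge[of \<alpha> s] ge[of \<beta> s] that \<open>\<alpha> \<le> \<beta>\<close> by auto
    show "x \<in> {\<alpha>..\<beta>}" "t \<in> {0..t}" using \<delta> t by (auto simp: \<alpha>_def \<beta>_def)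
    fix y s assume y: "y \<in> {\<alpha><..<\<beta>}" and s: "s \<in> {0<..t}"
    have y': "y \<in> {0<..<1}" "a y \<le> 0" and s': "s \<in> {0<..<T}" using sub'[of y] y s T by auto
    note U = u'(2)[OF y'(1) s']
    have "((\<lambda>s. b y s) has_real_derivative M * (l * exp (l * s))) (at s)"
      unfolding b_def by (auto intro!: derivative_eq_intros)
    then show "((\<lambda>s. b y s - u y s) has_real_derivative M * (l * exp (l * s)) - ut y s) (at s)"
      using U by (intro DERIV_diff) auto
    have "((\<lambda>y. b y s) has_real_derivative M * (- k * exp (- k * (y - \<alpha>)) + k * exp (- k * (\<beta> - y)))) (at y)"
      unfolding b_def by (auto intro!: derivative_eq_intros)
    then show "((\<lambda>y. b y s - u y s) has_real_derivative
        M * (- k * exp (- k * (y - \<alpha>)) + k * exp (- k * (\<beta> - y))) - ux y s) (at y)"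
      using U by (intro DERIV_diff) auto
    have "((\<lambda>y. M * (- k * exp (- k * (y - \<alpha>)) + k * exp (- k * (\<beta> - y)))) has_real_derivative
        M * (k * k * exp (- k * (y - \<alpha>)) + k * k * exp (- k * (\<beta> - y)))) (at y)"
      by (auto intro!: derivative_eq_intros)
    then show "((\<lambda>y. M * (- k * exp (- k * (y - \<alpha>)) + k * exp (- k * (\<beta> - y))) - ux y s) has_real_derivative
        M * (k * k * exp (- k * (y - \<alpha>)) + k * k * exp (- k * (\<beta> - y))) - uxx y s) (at y)"
      using U by (intro DERIV_diff) auto
    have "a y * (u y s)\<^sup>2 \<le> 0" using y'(2) by (simp add: mult_nonpos_nonneg)
    moreover have "ut y s - uxx y s = l * u y s + a y * (u y s)\<^sup>2" using U by blast
    moreover have "M * (l * exp (l * s)) - M * (k * k * exp (- k * (y - \<alpha>)) + k * k * exp (- k * (\<beta> - y))) = l * b y s"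
      unfolding k(1) b_def by (simp add: algebra_simps)
    ultimately show "l * (b y s - u y s) \<le> M * (l * exp (l * s)) - ut y s
        - (M * (k * k * exp (- k * (y - \<alpha>)) + k * k * exp (- k * (\<beta> - y))) - uxx y s)"
      unfolding right_diff_distrib by linarith
  qed
  then show ?thesis by (simp add: b_def \<alpha>_def \<beta>_def k_def algebra_simps)
qed

text \<open>A negative value forces the point into one of the open cells, and all cells lie between
  0 and 1. This excludes the endpoints, so points of negativity are interior, where the differential
  equation is available.\<close>

lemma interlacing_weight_support:
  assumes "interlacing_weight a" "x \<in> {0..1}" "a x < 0"
  shows "0 < x \<and> x < 1"
proof -
  from assms(1) obtain n :: nat and p :: "nat \<Rightarrow> real" where
    p: "\<forall>i<n. p i < p (Suc i)" "0 \<le> p 0" "p n \<le> 1"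
    and z: "\<forall>x \<in> {0..1}. (\<forall>i<n. x \<notin> {p i<..<p (Suc i)}) \<longrightarrow> a x = 0"
    unfolding interlacing_weight_def by blast
  have mono: "p i \<le> p j" if "i \<le> j" "j \<le> n" for i j
    using that
  proof (induction j rule: dec_induct)
    case (step j)
    then show ?case using p(1) by (meson Suc_leD Suc_le_lessD less_eq_real_def order_trans)
  qed simp
  obtain i where i: "i < n" "x \<in> {p i<..<p (Suc i)}" using z assms by force
  then show ?thesis using mono[of 0 i] mono[of "Suc i" n] p(2,3) by auto
qed

text \<open>A single \<open>\<delta>\<close> for the whole compact set makes the barrier, and with
  it the decay rate, uniform.\<close>

lemma compact_negativity_margin:
  assumes a: "continuous_on {0..1} a" "interlacing_weight a"
    and K: "compact K" "K \<subseteq> {x \<in> {0..1}. a x < 0}"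
  obtains \<delta> where "0 < \<delta>" "\<And>x. x \<in> K \<Longrightarrow> {x - \<delta>..x + \<delta>} \<subseteq> {y \<in> {0<..<1}. a y \<le> 0}"
proof -
  let ?O = "{y \<in> {0<..<1}. a y < 0}"
  have "continuous_on {0<..<1} a" by (rule continuous_on_subset[OF a(1)]) auto
  then have "open ({0<..<1} \<inter> a -` {..<0})" by (intro continuous_open_preimage) auto
  moreover have "{0<..<1} \<inter> a -` {..<0} = ?O" by auto
  ultimately have O: "open ?O" by simp
  have "K \<subseteq> ?O"
  proof
    fix x assume "x \<in> K"
    then have "x \<in> {0..1}" "a x < 0" using K(2) by auto
    then show "x \<in> ?O" using interlacing_weight_support[OF a(2)] by auto
  qed
  with K(1) O obtain e where e: "0 < e" "(\<Union>x\<in>K. ball x e) \<subseteq> ?O"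
    by (rule compact_subset_open_imp_ball_epsilon_subset)
  show thesis
  proof (rule that[of "e / 2"])
    show "0 < e / 2" using e by simp
    fix x assume x: "x \<in> K"
    have "{x - e / 2..x + e / 2} \<subseteq> ball x e" using e by (auto simp: dist_real_def abs_less_iff)
    also have "\<dots> \<subseteq> ?O" using e(2) x by auto
    finally show "{x - e / 2..x + e / 2} \<subseteq> {y \<in> {0<..<1}. a y \<le> 0}" by (auto intro: less_imp_le)
  qed
qed

theorem theorem3p2:
  fixes a u0 :: "real \<Rightarrow> real"
    and U :: "real \<Rightarrow> real \<Rightarrow> real \<Rightarrow> real"
  assumes a_cont: "continuous_on {0..1} a"
    and a_struct: "interlacing_weight a"
    and u0_cont: "continuous_on {0..1} u0"
    and u0_nonneg: "\<forall>x \<in> {0..1}. u0 x \<ge> 0"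
    and u0_nonzero: "\<exists>x \<in> {0..1}. u0 x \<noteq> 0"
    and u0_sub: "\<exists>l0. weak_subsolution a l0 u0"
    and U_sol: "\<forall>l T. 0 < T \<and> ereal T \<le> Tmax a u0 l \<longrightarrow> is_solution a l u0 T (U l)"
  shows "\<forall>t. 0 < t \<and> ereal t < Tmax_lim a u0 \<longrightarrow>
           (\<forall>x \<in> {x \<in> {0..1}. a x < 0}. ((\<lambda>l. U l x t) \<longlongrightarrow> 0) at_bot) \<and>
           (\<forall>K. compact K \<and> K \<subseteq> {x \<in> {0..1}. a x < 0} \<longrightarrow>
                uniform_limit K (\<lambda>l x. U l x t) (\<lambda>x. 0) at_bot)"
proof (intro allI impI)
  fix t assume "0 < t \<and> ereal t < Tmax_lim a u0"
  then have t: "0 < t" "ereal t < Tmax_lim a u0" by auto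
  have u0: "\<And>x. x \<in> {0..1} \<Longrightarrow> 0 \<le> u0 x" using u0_nonneg by blast
  have "ereal t < (SUP l. Tmax a u0 l)"
    using t(2) Tmax_lim_eq[OF a_cont u0_cont u0] by simp
  then obtain l1 where "ereal t < Tmax a u0 l1" by (auto simp: less_SUP_iff)
  \<comment> \<open>A time strictly between \<open>t\<close> and the maximal time: the solutions
    then exist beyond the closed interval up to \<open>t\<close>, on which bounds and comparison are
    needed.\<close>
  from ereal_dense2[OF this] obtain T where T: "t < T" "ereal T < Tmax a u0 l1" by auto
  have sol: "is_solution a l u0 T (U l)" if "l \<le> l1" for l
    using U_sol T t Tmax_antimono[OF a_cont u0_cont u0 that] by (auto intro: less_imp_le less_le_trans)
  obtain M where M: "0 \<le> M" "\<And>x s. x \<in> {0..1} \<Longrightarrow> s \<in> {0..t} \<Longrightarrow> \<bar>U l1 x s\<bar> \<le> M"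
    using heat_sol_bounded[OF sol[OF order_refl, unfolded is_solution_iff_heat_sol] T(1)] by blast
  have uniform: "uniform_limit K (\<lambda>l x. U l x t) (\<lambda>x. 0) at_bot"
    if K: "compact K" "K \<subseteq> {x \<in> {0..1}. a x < 0}" for K
  proof -
    obtain \<delta> where \<delta>: "0 < \<delta>" "\<And>x. x \<in> K \<Longrightarrow> {x - \<delta>..x + \<delta>} \<subseteq> {y \<in> {0<..<1}. a y \<le> 0}"
      using compact_negativity_margin[OF a_cont a_struct K] by blast
    define \<eta> where "\<eta> = (\<lambda>l. M * (2 * exp (- sqrt (- l) * \<delta>) + exp (l * t)))"
    \<comment> \<open>\<open>l \<le> l1\<close> is for comparison with \<open>U l1\<close>, and
      \<open>l \<le> 0\<close> makes \<open>sqrt (- l)\<close> a genuine square root of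
      \<open>- l\<close>.\<close>
    have bound: "\<bar>U l x t\<bar> \<le> \<eta> l" if l: "l \<le> min l1 0" and x: "x \<in> K" for l x
    proof -
      have l1: "l \<le> l1" "l \<le> 0" using l by auto
      have "U l x t \<le> \<eta> l"
        unfolding \<eta>_def
      proof (rule solution_decay[OF sol[OF l1(1)] l1(2) T(1) \<delta>(2)[OF x] \<delta>(1) _ _ M(1)])
        fix y s assume y: "y \<in> {x - \<delta>..x + \<delta>}" and s: "s \<in> {0..t}"
        have "y \<in> {0..1}" using \<delta>(2)[OF x] y by force
        then have "U l y s \<le> U l1 y s" "\<bar>U l1 y s\<bar> \<le> M"
          using is_solution_mono_param[OF a_cont u0 sol[OF l1(1)] sol[OF order_refl] l1(1), of y s] M(2) s T(1)
          by auto
        then show "U l y s \<le> M" by simp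
      qed (use t in simp)
      moreover have "0 \<le> U l x t"
        using is_solution_nonneg[OF a_cont u0 sol[OF l1(1)], of x t] K(2) x t T(1) by auto
      ultimately show ?thesis by simp
    qed
    have "(\<eta> \<longlongrightarrow> 0) at_bot"
      unfolding \<eta>_def using t(1) \<delta>(1) by real_asymp
    show ?thesis
    proof (rule uniform_limitI)
      fix e :: real assume "0 < e"
      with \<open>(\<eta> \<longlongrightarrow> 0) at_bot\<close> have "\<forall>\<^sub>F l in at_bot. \<eta> l < e" by (rule order_tendstoD(2))
      then show "\<forall>\<^sub>F l in at_bot. \<forall>x\<in>K. dist (U l x t) 0 < e"
        using eventually_le_at_bot[of "min l1 0"]
      proof eventually_elim
        case (elim l)
        then show ?case using bound[OF elim(2)] by (force intro: le_less_trans)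
      qed
    qed
  qed
  show "(\<forall>x \<in> {x \<in> {0..1}. a x < 0}. ((\<lambda>l. U l x t) \<longlongrightarrow> 0) at_bot) \<and>
      (\<forall>K. compact K \<and> K \<subseteq> {x \<in> {0..1}. a x < 0} \<longrightarrow>
           uniform_limit K (\<lambda>l x. U l x t) (\<lambda>x. 0) at_bot)"
  proof (intro conjI ballI allI impI)
    fix x assume "x \<in> {x \<in> {0..1}. a x < 0}"
    \<comment> \<open>The pointwise claim is the uniform one on a singleton.\<close>
    then have "uniform_limit {x} (\<lambda>l x. U l x t) (\<lambda>x. 0) at_bot" by (intro uniform) auto
    then show "((\<lambda>l. U l x t) \<longlongrightarrow> 0) at_bot" by (rule tendsto_uniform_limitI) simp
  qed (use uniform in blast)
qed

end
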